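(* Let $\beta>1$ and let $y_1,y_2,\ldots$ be i.i.d. random variables in $\mathbb{R}^2$ with bounded support and with a probability density function $f$ with respect to Lebesgue measure (i.e. their law has no singular part). Let $T$ be the transport capacity under the protocol model with parameter $\beta$. Then, with probability one, $$\lim_{n\to\infty}\frac{T(\{y_1,y_2,\ldots,y_n\})}{\sqrt n}=A_2\int_{\mathbb{R}^2}\sqrt{f(x)}\,dx ,$$ where $A_2$ is the constant, depending only on $\beta$, to which $T(\{x_1,\dots,x_n\})/\sqrt n$ converges with probability one when $x_1,x_2,\ldots$ are i.i.d. uniform on $[0,1]^2$.
   Context: Protocol model. Fix $\beta>1$. Nodes are a finite set $\{x_1,\dots,x_n\}\subset\mathbb{R}^2$ and time is divided into discrete slots. In each slot a set of ordered (transmitter, receiver) pairs of nodes is active, each transmitter sending to one receiver. The transmission from $x_i$ to $x_j$ ($i\ne j$) is successful if the ball centered at $x_j$ with radius $\beta|x_i-x_j|$ contains no transmitter active in that slot other than $x_i$. A successful transmission conveys exactly one packet. No cooperative communication techniques are used other than relaying: packets may be stored and forwarded over several hops. The messages of different source-destination pairs are independent. Transport capacity. A rate matrix $(\lambda_{ij})$ is supportable if some scheduling and routing scheme of this type delivers, for every source-destination pair $(i,j)$, packets originating at $x_i$ and destined to $x_j$ at long-run average rate $\lambda_{ij}$ packets per slot (relay hops are not counted separately). The transport capacity is $$T(\{x_1,\dots,x_n\})=\sup\sum_{(i,j)\in\{1,\dots,n\}^2}\lambda_{ij}|x_i-x_j|,$$ the supremum being over all supportable rate matrices. By convention $T$ of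 a single node (and of the empty set) is $0$. Two cases are considered: $T$ with no constraint on the $\lambda_{ij}$, and $T$ with the supremum restricted to supportable rate matrices satisfying Constraint 1: $\max_{j\neq i}\lambda_{ij}>0$ for every $i$. The statement is for either version. It is known that for i.i.d. uniform points on $[0,1]^2$ the limit $A_2$ exists almost surely as a non-random constant. *)

theory Defs
  imports "HOL-Probability.Probability"
begin

type_synonym node = "real ^ 2"

datatype packet = Packet (origin: node) (destination: node) (serial: nat)

text \<open>
  \<open>E\<close> is the set of (transmitter, receiver) pairs active in a slot, so \<open>Domain E\<close> is the set of
  active transmitters. If the receiver \<open>v\<close> is itself transmitting then \<open>v\<close> lies in its own
  interference ball, hence successful nodes are half-duplex.
\<close>

definition successful :: "real \<Rightarrow> (node \<times> node) set \<Rightarrow> node \<Rightarrow> node \<Rightarrow> bool" where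
  "successful \<beta> E u v \<longleftrightarrow> (u, v) \<in> E \<and> ball v (\<beta> * dist u v) \<inter> Domain E \<subseteq> {u}"

definition valid_schedule :: "node set \<Rightarrow> (nat \<Rightarrow> (node \<times> node) set) \<Rightarrow> bool" where
  "valid_schedule X E \<longleftrightarrow> (\<forall>t. E t \<subseteq> X \<times> X \<and> single_valued (E t) \<and> irrefl (E t))"

text \<open>
  \<open>buffer \<beta> E p t v\<close> is the set of packets known to node \<open>v\<close> before slot \<open>t\<close>, where \<open>p t u\<close> is the
  packet that \<open>u\<close> sends if it transmits in slot \<open>t\<close>. Sources are saturated: each holds from the start
  infinitely many distinct packets for every destination. A transmission conveys a packet only if
  the transmitter already knows it, so a packet can reach a node only along a chain of hops from
  its origin. Nodes may keep what they have relayed.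
\<close>

primrec buffer ::
  "real \<Rightarrow> (nat \<Rightarrow> (node \<times> node) set) \<Rightarrow> (nat \<Rightarrow> node \<Rightarrow> packet) \<Rightarrow> nat \<Rightarrow> node \<Rightarrow> packet set" where
  "buffer \<beta> E p 0 v = {q. origin q = v}"
| "buffer \<beta> E p (Suc t) v =
     buffer \<beta> E p t v \<union> {p t u | u. successful \<beta> (E t) u v \<and> p t u \<in> buffer \<beta> E p t u}"

text \<open>
  Meaningful for \<open>i \<noteq> j\<close>, where the counted set is finite. It is a set of packets, so repeated
  deliveries of one packet and intermediate hops do not count.
\<close>

definition delivered ::
  "real \<Rightarrow> (nat \<Rightarrow> (node \<times> node) set) \<Rightarrow> (nat \<Rightarrow> node \<Rightarrow> packet) \<Rightarrow> nat \<Rightarrow> node \<Rightarrow> node \<Rightarrow> nat" where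
  "delivered \<beta> E p t i j =
     card {q \<in> buffer \<beta> E p t j. origin q = i \<and> destination q = j}"

text \<open>
  Rate matrices are indexed by the nodes themselves. Diagonal entries carry no requirement; their
  weight in the transport capacity is zero.
\<close>

definition supportable :: "real \<Rightarrow> node set \<Rightarrow> (node \<Rightarrow> node \<Rightarrow> real) \<Rightarrow> bool" where
  "supportable \<beta> X rate \<longleftrightarrow>
     (\<exists>E p. valid_schedule X E \<and>
        (\<forall>i\<in>X. \<forall>j\<in>X. i \<noteq> j \<longrightarrow>
           (\<lambda>t. real (delivered \<beta> E p t i j) / real t) \<longlonglongrightarrow> rate i j))"

definition constraint1 :: "node set \<Rightarrow> (node \<Rightarrow> node \<Rightarrow> real) \<Rightarrow> bool" where
  "constraint1 X rate \<longleftrightarrow> (\<forall>i\<in>X. Max (rate i ` (X - {i})) > 0)"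

text \<open>
  The flag \<open>c\<close> selects the version of the transport capacity: with Constraint 1 if \<open>c\<close> is true,
  unconstrained otherwise. For finite \<open>X\<close> the supremum is over a bounded set, because at most
  \<open>card X\<close> packets are received per slot; it is nonempty when \<open>X\<close> has at least two nodes.
\<close>

definition transport_capacity :: "real \<Rightarrow> bool \<Rightarrow> node set \<Rightarrow> real" where
  "transport_capacity \<beta> c X =
     (if card X \<le> 1 then 0
      else Sup {\<Sum>(i, j)\<in>X \<times> X. rate i j * dist i j | rate.
                  supportable \<beta> X rate \<and> (c \<longrightarrow> constraint1 X rate)})"

text \<open>
  The points \<open>x 0, x 1, \<dots>\<close> are the coordinates of the infinite product of the uniform distribution
  on the unit square. At most one \<open>a\<close> satisfies this.
\<close>

definition uniform_limit_constant :: "real \<Rightarrow> bool \<Rightarrow> real \<Rightarrow> bool" where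
  "uniform_limit_constant \<beta> c a \<longleftrightarrow>
     (AE x in (\<Pi>\<^sub>M i\<in>(UNIV :: nat set). uniform_measure lborel (cbox 0 (1 :: node))).
        (\<lambda>n. transport_capacity \<beta> c (x ` {..<n}) / sqrt (real n)) \<longlonglongrightarrow> a)"

end

theory Submission
  imports Defs "HOL-Real_Asymp.Real_Asymp"
begin

text \<open>
  By the triangle inequality a packet travels at most the total length of its hops, and every hop
  could just as well carry a packet of its own. Hence the transport capacity is the maximal total
  length \<open>W(X)\<close> of the hops that can succeed simultaneously in one slot; Constraint 1 costs only a
  vanishing fraction of the slots. The sum of the squared lengths of simultaneous hops is bounded, so
  \<open>m\<close> hops contribute at most \<open>O(sqrt m)\<close>, and hops longer than \<open>\<delta>\<close> at most \<open>O(1/\<delta>)\<close>. Therefore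
  \<open>W\<close> is additive over disjoint cells up to the points near the cell boundaries, and changing \<open>m\<close>
  points changes it by \<open>O(sqrt m)\<close>. For a density that is constant on squares the samples in
  each square are i.i.d. uniform, so the limit follows by scaling from the uniform case. A general
  density is coupled with a step density close to it in \<open>L\<^sup>1\<close>, so that few samples differ.
\<close>

section \<open>Reduction to a single slot\<close>

text \<open>The square root in the limit comes from two scalings. A square of side \<open>h\<close>
  with density \<open>\<alpha>\<close> receives about \<open>\<alpha> * h^2 * n\<close> points, and
  lengths in it shrink by \<open>h\<close>, so its share is about
  \<open>A * h * sqrt (\<alpha> * h^2 * n)\<close>, that is
  \<open>A * sqrt \<alpha> * h^2 * sqrt n\<close>. Over all squares these shares add up to the
  integral of the square root of the step density.

  The obstacle is that the uniform case is given only as an almost sure statement about one sequence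
  law. It reaches other laws through image measures, so the events involved have to be measurable.
  For a supremum over infinite schedules this is hard to see; for a maximum over finitely many edge
  sets it is elementary. The single-slot form also identifies the two versions of the capacity and
  is monotone in the point set.

  The approximating density, and with it the coupling, depends on the tolerance \<open>e\<close>.
  Hence for a general density one only transfers that the normalized capacity is eventually within
  \<open>e\<close> of the target, and countably many tolerances give convergence.\<close>

definition feasible :: "real \<Rightarrow> (node \<times> node) set \<Rightarrow> bool" where
  "feasible \<beta> E \<longleftrightarrow> (\<forall>e\<in>E. fst e \<noteq> snd e) \<and>
     (\<forall>e\<in>E. \<forall>e'\<in>E. e \<noteq> e' \<longrightarrow> \<beta> * dist (fst e) (snd e) \<le> dist (fst e') (snd e))"

definition edge_length :: "(node \<times> node) set \<Rightarrow> real" where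
  "edge_length E = (\<Sum>e\<in>E. dist (fst e) (snd e))"

definition slot_capacity :: "real \<Rightarrow> node set \<Rightarrow> real" where
  "slot_capacity \<beta> X = Max (edge_length ` {E. E \<subseteq> X \<times> X \<and> feasible \<beta> E})"

lemma feasible_subset: "feasible \<beta> E \<Longrightarrow> F \<subseteq> E \<Longrightarrow> feasible \<beta> F"
  unfolding feasible_def by blast

lemma feasible_empty [simp]: "feasible \<beta> {}"
  by (simp add: feasible_def)

lemma edge_length_Un:
  "finite E \<Longrightarrow> finite F \<Longrightarrow> E \<inter> F = {} \<Longrightarrow> edge_length (E \<union> F) = edge_length E + edge_length F"
  by (simp add: edge_length_def sum.union_disjoint)

lemma finite_feasible: "finite X \<Longrightarrow> finite {E. E \<subseteq> X \<times> X \<and> feasible \<beta> E}"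
  by (rule finite_subset[of _ "Pow (X \<times> X)"]) auto

lemma slot_capacity_ge:
  "finite X \<Longrightarrow> E \<subseteq> X \<times> X \<Longrightarrow> feasible \<beta> E \<Longrightarrow> edge_length E \<le> slot_capacity \<beta> X"
  unfolding slot_capacity_def by (intro Max_ge finite_imageI finite_feasible) auto

lemma slot_capacity_attained:
  assumes "finite X"
  obtains E where "E \<subseteq> X \<times> X" "feasible \<beta> E" "slot_capacity \<beta> X = edge_length E"
proof -
  have "slot_capacity \<beta> X \<in> edge_length ` {E. E \<subseteq> X \<times> X \<and> feasible \<beta> E}"
    unfolding slot_capacity_def using feasible_empty
    by (intro Max_in finite_imageI finite_feasible[OF assms]) auto
  with that show thesis by auto
qed

lemma slot_capacity_mono:
  assumes "finite Y" "X \<subseteq> Y" shows "slot_capacity \<beta> X \<le> slot_capacity \<beta> Y"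
proof -
  obtain E where "E \<subseteq> X \<times> X" "feasible \<beta> E" "slot_capacity \<beta> X = edge_length E"
    by (rule slot_capacity_attained[OF finite_subset[OF assms(2,1)], of \<beta>])
  moreover have "E \<subseteq> Y \<times> Y" using \<open>E \<subseteq> X \<times> X\<close> assms(2) by blast
  ultimately show ?thesis using slot_capacity_ge[OF assms(1), of E \<beta>] by simp
qed

text \<open>Since \<open>\<beta> > 1\<close>, every receiver is strictly closer to its own
  transmitter than to any other. A shared transmitter would make a distance smaller than itself, and
  a shared receiver would make each of two hops shorter than the other. This is why
  \<open>feasible\<close> can compare distinct edges, rather than distinct transmitters, and still
  describe valid slots.\<close>

lemma feasible_inj:
  assumes "1 < \<beta>" "feasible \<beta> E"
  shows "inj_on fst E" "inj_on snd E"
proof -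
  have *: "\<not> \<beta> * d \<le> d" if "0 < d" for d :: real
    using assms(1) that by simp
  have key: "fst e \<noteq> fst e' \<and> snd e \<noteq> snd e'" if "e \<in> E" "e' \<in> E" "e \<noteq> e'" for e e'
  proof -
    have d: "0 < dist (fst e) (snd e)" "0 < dist (fst e') (snd e')"
      using assms(2) that by (auto simp: feasible_def)
    have le: "\<beta> * dist (fst e) (snd e) \<le> dist (fst e') (snd e)"
      "\<beta> * dist (fst e') (snd e') \<le> dist (fst e) (snd e')"
      using assms(2) that by (auto simp: feasible_def)
    have "dist (fst e) (snd e) < dist (fst e') (snd e)" "dist (fst e') (snd e') < dist (fst e) (snd e')"
      using le *[OF d(1)] *[OF d(2)] d assms(1)
      by (meson less_le_trans mult_less_cancel_right1 not_less)+
    then show ?thesis by auto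
  qed
  show "inj_on fst E" "inj_on snd E" using key by (auto simp: inj_on_def)
qed

lemma feasible_successful:
  assumes "1 < \<beta>" "feasible \<beta> E"
  shows "successful \<beta> E u v \<longleftrightarrow> (u, v) \<in> E"
proof
  assume uv: "(u, v) \<in> E"
  have "u' = u" if "(u', v') \<in> E" "dist v u' < \<beta> * dist u v" for u' v'
    using assms(2) uv that by (force simp: feasible_def dist_commute)
  with uv show "successful \<beta> E u v" by (auto simp: successful_def)
qed (simp add: successful_def)

text \<open>Distinct edges of a single-valued slot have distinct transmitters, so the interference
  ball of one edge, free of other transmitters, gives the distance bound against the other. Together
  with \<open>feasible_successful\<close>, the hops that can succeed together in a valid slot are
  exactly the feasible sets.\<close>

lemma successful_feasible:
  assumes "single_valued E" "irrefl E"
  shows "feasible \<beta> {(u, v). successful \<beta> E u v}"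
  unfolding feasible_def
proof (intro conjI ballI impI)
  fix e assume "e \<in> {(u, v). successful \<beta> E u v}"
  then show "fst e \<noteq> snd e" using assms(2) by (auto simp: successful_def irrefl_def)
next
  fix e e' assume e: "e \<in> {(u, v). successful \<beta> E u v}" "e' \<in> {(u, v). successful \<beta> E u v}" "e \<noteq> e'"
  then obtain u v u' v' where *: "e = (u, v)" "e' = (u', v')" by (cases e, cases e') auto
  have "u' \<noteq> u" using e assms(1) * by (auto simp: successful_def single_valued_def)
  moreover have "u' \<in> Domain E" using e * by (auto simp: successful_def)
  ultimately have "u' \<notin> ball v (\<beta> * dist u v)" using e * by (auto simp: successful_def)
  then show "\<beta> * dist (fst e) (snd e) \<le> dist (fst e') (snd e)" by (simp add: * dist_commute)
qed

lemma successful_subset: "{(u, v). successful \<beta> E u v} \<subseteq> E"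
  by (auto simp: successful_def)

text \<open>
  Following every packet backwards, each slot brings it closer to its origin by at most the length
  of the hop that carried it, and different packets use different hops.
\<close>

lemma packet_displacement:
  assumes "finite X" "valid_schedule X E" "finite Q"
    and "\<And>q. q \<in> Q \<Longrightarrow> q \<in> buffer \<beta> E p t (loc q)"
  shows "(\<Sum>q\<in>Q. dist (origin q) (loc q)) \<le> real t * slot_capacity \<beta> X"
  using assms(3-)
proof (induction t arbitrary: Q loc)
  case 0
  then show ?case by simp
next
  case (Suc t)
  define N where "N = {q \<in> Q. q \<notin> buffer \<beta> E p t (loc q)}"
  define S where "S = {(u, v). successful \<beta> (E t) u v}"
  have "\<exists>u. q = p t u \<and> (u, loc q) \<in> S \<and> q \<in> buffer \<beta> E p t u" if "q \<in> N" for q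
    using Suc.prems(2)[of q] that by (auto simp: N_def S_def)
  then obtain src where src: "q = p t (src q)" "(src q, loc q) \<in> S" "q \<in> buffer \<beta> E p t (src q)"
    if "q \<in> N" for q by metis
  \<comment> \<open>The induction needs an arbitrary location function: a packet that arrived in
    slot \<open>t\<close> is pursued from its transmitter, while all others stay where they
    are.\<close>
  define loc' where "loc' q = (if q \<in> N then src q else loc q)" for q
  have E: "E t \<subseteq> X \<times> X" "single_valued (E t)" "irrefl (E t)"
    using assms(2) by (auto simp: valid_schedule_def)
  have S: "S \<subseteq> X \<times> X" "feasible \<beta> S"
    using E successful_feasible[of "E t" \<beta>] successful_subset[of \<beta> "E t"] unfolding S_def by auto
  have fS: "finite S" using S(1) assms(1) by (meson finite_SigmaI finite_subset)
  have fN: "finite N" using Suc.prems(1) by (simp add: N_def)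
  have "dist (origin q) (loc q) \<le> dist (origin q) (loc' q) + (if q \<in> N then dist (src q) (loc q) else 0)" for q
    by (simp add: loc'_def dist_triangle)
  then have "(\<Sum>q\<in>Q. dist (origin q) (loc q))
      \<le> (\<Sum>q\<in>Q. dist (origin q) (loc' q) + (if q \<in> N then dist (src q) (loc q) else 0))"
    by (rule sum_mono)
  also have "\<dots> = (\<Sum>q\<in>Q. dist (origin q) (loc' q)) + (\<Sum>q\<in>N. dist (src q) (loc q))"
    using Suc.prems(1) by (simp add: sum.distrib sum.If_cases N_def Int_def)
  also have "(\<Sum>q\<in>Q. dist (origin q) (loc' q)) \<le> real t * slot_capacity \<beta> X"
    by (rule Suc.IH[OF Suc.prems(1)]) (auto simp: loc'_def src N_def)
  \<comment> \<open>A transmitter sends a single packet per slot, so \<open>src q\<close> determines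
    \<open>q\<close> and no hop is used for two packets.\<close>
  also have "(\<Sum>q\<in>N. dist (src q) (loc q)) = edge_length ((\<lambda>q. (src q, loc q)) ` N)"
    unfolding edge_length_def
    using src(1) by (subst sum.reindex) (auto intro!: inj_onI, metis)
  also have "\<dots> \<le> edge_length S"
    unfolding edge_length_def by (rule sum_mono2[OF fS]) (use src(2) in auto)
  also have "\<dots> \<le> slot_capacity \<beta> X"
    by (rule slot_capacity_ge[OF assms(1) S])
  finally show ?case by (simp add: algebra_simps)
qed

text \<open>The case \<open>i = j\<close> is excluded because a source holds infinitely many packets
  of its own from the start. At any other node, a slot adds at most the packets sent in that
  slot.\<close>

lemma finite_delivered:
  assumes "finite X" "valid_schedule X E" "i \<noteq> j"
  shows "finite {q \<in> buffer \<beta> E p t j. origin q = i}"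
proof (induction t)
  case 0
  have "{q \<in> buffer \<beta> E p 0 j. origin q = i} = {}" using assms(3) by auto
  then show ?case by (simp only: finite.emptyI)
next
  case (Suc t)
  have "{q \<in> buffer \<beta> E p (Suc t) j. origin q = i}
      \<subseteq> {q \<in> buffer \<beta> E p t j. origin q = i} \<union> p t ` X"
    using assms(2) by (auto simp: valid_schedule_def successful_def)
  then show ?case using Suc assms(1) by (meson finite_UnI finite_imageI finite_subset)
qed

text \<open>A packet carries its origin and destination, so the packets counted for different pairs
  are different and can all be tracked at once, with \<open>destination\<close> as the location
  function.\<close>

lemma delivered_bound:
  assumes "finite X" "valid_schedule X E"
  shows "(\<Sum>(i, j)\<in>X \<times> X. real (delivered \<beta> E p t i j) * dist i j) \<le> real t * slot_capacity \<beta> X"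
proof -
  define P where "P = {(i, j). (i, j) \<in> X \<times> X \<and> i \<noteq> j}"
  define D where "D = (\<lambda>(i, j). {q \<in> buffer \<beta> E p t j. origin q = i \<and> destination q = j})"
  have fD: "finite (D x)" if "x \<in> P" for x
    using that finite_delivered[OF assms, of "fst x" "snd x" \<beta> p t]
    by (auto simp: D_def P_def split: prod.splits intro: rev_finite_subset)
  have fP: "finite P" unfolding P_def by (rule finite_subset[of _ "X \<times> X"]) (use assms(1) in auto)
  have "(\<Sum>(i, j)\<in>X \<times> X. real (delivered \<beta> E p t i j) * dist i j)
      = (\<Sum>(i, j)\<in>P. real (delivered \<beta> E p t i j) * dist i j)"
    by (rule sum.mono_neutral_right) (use assms(1) in \<open>auto simp: P_def\<close>)
  also have "\<dots> = (\<Sum>x\<in>P. \<Sum>q\<in>D x. dist (origin q) (destination q))"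
  proof (rule sum.cong[OF refl], clarify)
    fix i j
    have "(\<Sum>q\<in>D (i, j). dist (origin q) (destination q)) = (\<Sum>q\<in>D (i, j). dist i j)"
      by (rule sum.cong) (auto simp: D_def)
    then show "real (delivered \<beta> E p t i j) * dist i j
        = (\<Sum>q\<in>D (i, j). dist (origin q) (destination q))"
      by (simp add: delivered_def D_def)
  qed
  also have "\<dots> = (\<Sum>q\<in>(\<Union>x\<in>P. D x). dist (origin q) (destination q))"
    by (rule sum.UNION_disjoint[symmetric]) (use fP fD in \<open>auto simp: D_def\<close>)
  also have "\<dots> \<le> real t * slot_capacity \<beta> X"
    by (rule packet_displacement[OF assms]) (use fP fD in \<open>auto simp: D_def\<close>)
  finally show ?thesis .
qed

lemma supportable_bound:
  assumes "finite X" "supportable \<beta> X rate"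
  shows "(\<Sum>(i, j)\<in>X \<times> X. rate i j * dist i j) \<le> slot_capacity \<beta> X"
proof -
  obtain E p where E: "valid_schedule X E"
    and lim: "\<And>i j. i \<in> X \<Longrightarrow> j \<in> X \<Longrightarrow> i \<noteq> j \<Longrightarrow>
      (\<lambda>t. real (delivered \<beta> E p t i j) / real t) \<longlonglongrightarrow> rate i j"
    using assms(2) by (auto simp: supportable_def)
  have "(\<lambda>t. real (delivered \<beta> E p t i j) / real t * dist i j) \<longlonglongrightarrow> rate i j * dist i j"
    if "(i, j) \<in> X \<times> X" for i j
    using that tendsto_mult[OF lim[of i j] tendsto_const, of "dist i j"] by (cases "i = j") auto
  then have "(\<lambda>t. \<Sum>(i, j)\<in>X \<times> X. real (delivered \<beta> E p t i j) / real t * dist i j)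
      \<longlonglongrightarrow> (\<Sum>(i, j)\<in>X \<times> X. rate i j * dist i j)"
    by (intro tendsto_sum) auto
  moreover have "\<forall>\<^sub>F t in sequentially.
      (\<Sum>(i, j)\<in>X \<times> X. real (delivered \<beta> E p t i j) / real t * dist i j) \<le> slot_capacity \<beta> X"
  proof (intro eventually_sequentiallyI[of 1])
    fix t :: nat assume "1 \<le> t"
    have "(\<Sum>(i, j)\<in>X \<times> X. real (delivered \<beta> E p t i j) / real t * dist i j)
        = (\<Sum>(i, j)\<in>X \<times> X. real (delivered \<beta> E p t i j) * dist i j) / real t"
      by (simp add: sum_divide_distrib split_def)
    also have "\<dots> \<le> slot_capacity \<beta> X"
      using delivered_bound[OF assms(1) E, of \<beta> p t] \<open>1 \<le> t\<close> by (simp add: divide_le_eq mult.commute)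
    finally show "(\<Sum>(i, j)\<in>X \<times> X. real (delivered \<beta> E p t i j) / real t * dist i j) \<le> slot_capacity \<beta> X" .
  qed
  ultimately show ?thesis by (rule tendsto_upperbound) simp
qed

section \<open>Attaining the single-slot bound by direct transmission\<close>

lemma delivered_direct:
  assumes "1 < \<beta>" "\<And>t. feasible \<beta> (F t)" "i \<noteq> j"
  shows "delivered \<beta> F (\<lambda>t u. Packet u (SOME v. (u, v) \<in> F t) t) t i j = card {s. s < t \<and> (i, j) \<in> F s}"
proof -
  \<comment> \<open>Each packet is addressed to the receiver of its hop and stamped with the slot as
    serial number, so every hop delivers a new packet. The choice made by \<open>SOME\<close> is
    forced, because a feasible set has at most one edge per transmitter.\<close>
  let ?p = "\<lambda>t u. Packet u (SOME v. (u, v) \<in> F t) t"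
  have some: "(SOME v. (u, v) \<in> F t) = v" if "(u, v) \<in> F t" for u v t
  proof (rule some_equality[where P = "\<lambda>v. (u, v) \<in> F t", OF that])
    fix v' assume "(u, v') \<in> F t"
    then show "v' = v" using inj_onD[OF feasible_inj(1)[OF assms(1) assms(2)[of t]], of "(u, v')" "(u, v)"] that by simp
  qed
  have buf: "buffer \<beta> F ?p t v = {q. origin q = v} \<union> {Packet u v s | u s. s < t \<and> (u, v) \<in> F s}" for t v
  proof (induction t arbitrary: v)
    case (Suc t)
    have "{?p t u | u. successful \<beta> (F t) u v \<and> ?p t u \<in> buffer \<beta> F ?p t u}
        = {Packet u v t | u. (u, v) \<in> F t}"
      by (auto simp: feasible_successful[OF assms(1,2)] some Suc.IH)
    then show ?case by (auto simp: Suc.IH less_Suc_eq)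
  qed simp
  have "q \<in> {q \<in> buffer \<beta> F ?p t j. origin q = i \<and> destination q = j}
      \<longleftrightarrow> q \<in> Packet i j ` {s. s < t \<and> (i, j) \<in> F s}" for q
    unfolding buf using assms(3) by (cases q) auto
  then have "{q \<in> buffer \<beta> F ?p t j. origin q = i \<and> destination q = j}
      = Packet i j ` {s. s < t \<and> (i, j) \<in> F s}" by blast
  then show ?thesis by (simp add: delivered_def card_image inj_on_def)
qed

text \<open>Full periods contribute exactly the claimed frequency; only the incomplete last period
  deviates, which costs \<open>O(N / t)\<close>.\<close>

lemma periodic_frequency:
  fixes P :: "nat \<Rightarrow> bool"
  assumes "0 < N" "\<And>s. P (s mod N) = P s"
  shows "(\<lambda>t. real (card {s. s < t \<and> P s}) / real t) \<longlonglongrightarrow> real (card {s. s < N \<and> P s}) / real N"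
proof -
  define c where "c t = card {s. s < t \<and> P s}" for t
  have cadd: "c (m + k) = c m + card {s. m \<le> s \<and> s < m + k \<and> P s}" for m k
    unfolding c_def 
  proof -
    have eq: "{s. s < m + k \<and> P s} = {s. s < m \<and> P s} \<union> {s. m \<le> s \<and> s < m + k \<and> P s}" by auto
    show "card {s. s < m + k \<and> P s} = card {s. s < m \<and> P s} + card {s. m \<le> s \<and> s < m + k \<and> P s}"
      unfolding eq by (rule card_Un_disjoint) auto
  qed
  have shift: "P (N * q + s) = P s" for q s
    using assms(2)[of s] assms(2)[of "N * q + s"] by simp
  have per: "card {s. N * q \<le> s \<and> s < N * q + k \<and> P s} = c k" for q k
  proof -
    have "{s. N * q \<le> s \<and> s < N * q + k \<and> P s} = (\<lambda>s. N * q + s) ` {s. s < k \<and> P s}"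
    proof (intro equalityI subsetI)
      fix s assume "s \<in> {s. N * q \<le> s \<and> s < N * q + k \<and> P s}"
      moreover then have "P (s - N * q)"
        using shift[of q "s - N * q"] by simp
      ultimately show "s \<in> (\<lambda>s. N * q + s) ` {s. s < k \<and> P s}"
        by (intro image_eqI[of _ _ "s - N * q"]) auto
    next
      fix s assume "s \<in> (\<lambda>s. N * q + s) ` {s. s < k \<and> P s}"
      then show "s \<in> {s. N * q \<le> s \<and> s < N * q + k \<and> P s}"
        by (auto simp: shift)
    qed
    then show ?thesis by (simp add: card_image c_def)
  qed
  have cmult: "c (N * q) = q * c N" for q
  proof (induction q)
    case 0
    then show ?case by (simp add: c_def)
  next
    case (Suc q)
    then show ?case using cadd[of "N * q" N] per[of q N] by (simp add: add.commute)
  qed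
  have c_eq: "c t = (t div N) * c N + c (t mod N)" for t
    using cadd[of "N * (t div N)" "t mod N"] per[of "t div N" "t mod N"] by (simp only: cmult mult_div_mod_eq)
  have cb: "c (t mod N) \<le> N" for t
  proof -
    have "c (t mod N) \<le> card {..<t mod N}" unfolding c_def by (intro card_mono) auto
    also have "\<dots> \<le> N" using mod_less_divisor[OF assms(1), of t] by simp
    finally show ?thesis .
  qed
  have cN: "c N \<le> N" unfolding c_def using card_mono[of "{..<N}" "{s. s < N \<and> P s}"] by auto
  have bound: "\<bar>real (c t) / real t - real (c N) / real N\<bar> \<le> 2 * real N / real t" if "0 < t" for t
  proof -
    have t: "real t = real N * real (t div N) + real (t mod N)"
      by (metis mult_div_mod_eq of_nat_add of_nat_mult)
    have "real N * real (c t) - real t * real (c N) = real N * real (c (t mod N)) - real (t mod N) * real (c N)"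
      unfolding c_eq[of t] by (subst t) (simp add: algebra_simps)
    also have "\<bar>\<dots>\<bar> \<le> real N * real N + real N * real N"
      using cb[of t] cN mod_less_divisor[OF assms(1), of t]
      by (intro order_trans[OF abs_triangle_ineq4] add_mono)
        (auto simp: abs_mult intro!: mult_mono)
    finally have "\<bar>real N * real (c t) - real t * real (c N)\<bar> \<le> 2 * real N * real N" by simp
    moreover have "real (c t) / real t - real (c N) / real N
        = (real N * real (c t) - real t * real (c N)) / (real t * real N)"
      using that assms(1) by (simp add: field_simps)
    ultimately show ?thesis
      using that assms(1) by (simp add: abs_mult field_simps)
  qed
  have "(\<lambda>t. real (c t) / real t - real (c N) / real N) \<longlonglongrightarrow> 0"
  proof (rule Lim_null_comparison)
    show "\<forall>\<^sub>F t in sequentially. norm (real (c t) / real t - real (c N) / real N) \<le> 2 * real N / real t"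
      using eventually_gt_at_top[of 0] by eventually_elim (use bound in auto)
    show "(\<lambda>t. 2 * real N / real t) \<longlonglongrightarrow> 0" by (rule lim_const_over_n)
  qed
  then show ?thesis unfolding c_def by (simp add: LIM_zero_iff)
qed

text \<open>
  Time sharing: \<open>M\<close> slots with an optimal edge set, followed by one slot per node in which that
  node alone transmits. The latter enforce Constraint 1 at a cost vanishing as \<open>M\<close> grows.
\<close>

lemma supportable_time_sharing:
  assumes "1 < \<beta>" "finite X" "2 \<le> card X" "E \<subseteq> X \<times> X" "feasible \<beta> E"
  shows "\<exists>rate. supportable \<beta> X rate \<and> constraint1 X rate \<and>
    real M / real (M + card X) * edge_length E \<le> (\<Sum>(i, j)\<in>X \<times> X. rate i j * dist i j)"
proof -
  obtain enum where enum: "bij_betw enum {..<card X} X"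
    using assms(2) ex_bij_betw_nat_finite[of X] by (auto simp: atLeast0LessThan)
  have "\<exists>j\<in>X. j \<noteq> i" for i
  proof (rule ccontr)
    assume "\<not> ?thesis"
    then have "X \<subseteq> {i}" by auto
    then show False using assms(3) card_mono[of "{i}" X] by simp
  qed
  then obtain other where other: "other i \<in> X" "other i \<noteq> i" for i by metis
  define N where "N = M + card X"
  define F where "F t = (let s = t mod N in
    if s < M then E else {(enum (s - M), other (enum (s - M)))})" for t
  have N: "0 < N" using assms(3) by (simp add: N_def)
  have Fmod: "F (t mod N) = F t" for t by (simp add: F_def)
  have enumX: "enum k \<in> X" if "k < card X" for k using enum that by (auto simp: bij_betw_def)
  have FX: "F t \<subseteq> X \<times> X" for t
    using assms(4) other enumX[of "t mod N - M"] mod_less_divisor[OF N, of t]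
    by (auto simp: F_def Let_def N_def)
  have Ff: "feasible \<beta> (F t)" for t
    using assms(5) other[of "enum (t mod N - M)"] by (auto simp: F_def Let_def feasible_def)
  have valid: "valid_schedule X F"
    unfolding valid_schedule_def
  proof (intro allI conjI)
    fix t
    show "F t \<subseteq> X \<times> X" by (rule FX)
    show "single_valued (F t)" using feasible_inj(1)[OF assms(1) Ff, of t]
      unfolding single_valued_def inj_on_def by (metis fst_conv snd_conv)
    show "irrefl (F t)" using Ff[of t] by (auto simp: feasible_def irrefl_def)
  qed
  define rate where "rate i j = real (card {s. s < N \<and> (i, j) \<in> F s}) / real N" for i j
  have "supportable \<beta> X rate"
    unfolding supportable_def
  proof (intro exI conjI ballI impI)
    show "valid_schedule X F" by (rule valid)
    fix i j :: node assume "i \<noteq> j"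
    show "(\<lambda>t. real (delivered \<beta> F (\<lambda>t u. Packet u (SOME v. (u, v) \<in> F t) t) t i j) / real t)
        \<longlonglongrightarrow> rate i j"
      unfolding delivered_direct[OF assms(1) Ff \<open>i \<noteq> j\<close>] rate_def
      by (rule periodic_frequency[OF N]) (simp add: Fmod)
  qed
  moreover have "constraint1 X rate"
    unfolding constraint1_def
  proof
    fix i assume "i \<in> X"
    then obtain k where k: "k < card X" "enum k = i" using enum by (metis bij_betw_imp_surj_on imageE lessThan_iff)
    have "M + k \<in> {s. s < N \<and> (i, other i) \<in> F s}"
      using k by (auto simp: F_def N_def)
    then have "card {s. s < N \<and> (i, other i) \<in> F s} \<noteq> 0" by (subst card_eq_0_iff) auto
    then have "0 < rate i (other i)"
      unfolding rate_def using N by (intro divide_pos_pos) (simp_all only: of_nat_0_less_iff neq0_conv)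
    also have "rate i (other i) \<le> Max (rate i ` (X - {i}))"
      using assms(2) other[of i] by (intro Max_ge) auto
    finally show "0 < Max (rate i ` (X - {i}))" .
  qed
  moreover have "real M / real (M + card X) * edge_length E \<le> (\<Sum>(i, j)\<in>X \<times> X. rate i j * dist i j)"
  proof -
    have rE: "real M / real N \<le> rate i j" if "(i, j) \<in> E" for i j
    proof -
      have "card {..<M} \<le> card {s. s < N \<and> (i, j) \<in> F s}"
        by (rule card_mono) (use that in \<open>auto simp: F_def N_def\<close>)
      then show ?thesis by (simp add: rate_def divide_right_mono)
    qed
    have "real M / real N * edge_length E = (\<Sum>(i, j)\<in>E. real M / real N * dist i j)"
      by (simp add: edge_length_def sum_distrib_left split_def)
    also have "\<dots> \<le> (\<Sum>(i, j)\<in>E. rate i j * dist i j)"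
      by (rule sum_mono) (clarsimp simp del: times_divide_eq_left, intro mult_right_mono rE, auto)
    also have "\<dots> \<le> (\<Sum>(i, j)\<in>X \<times> X. rate i j * dist i j)"
      by (intro sum_mono2) (use assms(2,4) in \<open>auto simp: rate_def\<close>)
    finally show ?thesis by (simp add: N_def)
  qed
  ultimately show ?thesis by blast
qed

text \<open>Time sharing yields values with the factor \<open>M / (M + card X)\<close>, so the upper
  bound is approached as \<open>M\<close> grows and equals the supremum, with or without Constraint
  1. For at most one node, the convention agrees with the fact that the only feasible edge set is
  empty.\<close>

lemma transport_capacity_eq_slot_capacity:
  assumes "1 < \<beta>" "finite X"
  shows "transport_capacity \<beta> c X = slot_capacity \<beta> X"
proof (cases "card X \<le> 1")
  case True
  then obtain a where a: "X \<subseteq> {a}"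
    using assms(2) by (metis card_1_singletonE card_0_eq empty_subsetI le_numeral_extra(4) less_one nat_less_le order_refl)
  obtain E where E: "E \<subseteq> X \<times> X" "feasible \<beta> E" "slot_capacity \<beta> X = edge_length E"
    using slot_capacity_attained assms(2) by blast
  have "E = {}"
  proof (rule equals0I)
    fix e assume "e \<in> E"
    moreover from this have "fst e = snd e" using E(1) a by (metis mem_Sigma_iff prod.collapse singletonD subsetD)
    ultimately show False using E(2) by (auto simp: feasible_def)
  qed
  with E True show ?thesis by (simp add: transport_capacity_def edge_length_def)
next
  case False
  let ?V = "{\<Sum>(i, j)\<in>X \<times> X. rate i j * dist i j | rate.
                  supportable \<beta> X rate \<and> (c \<longrightarrow> constraint1 X rate)}"
  obtain E where E: "E \<subseteq> X \<times> X" "feasible \<beta> E" "slot_capacity \<beta> X = edge_length E"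
    using slot_capacity_attained assms(2) by blast
  have ub: "v \<le> slot_capacity \<beta> X" if "v \<in> ?V" for v
    using that supportable_bound[OF assms(2)] by blast
  have lb: "\<exists>v\<in>?V. real M / real (M + card X) * edge_length E \<le> v" for M
    using supportable_time_sharing[OF assms _ E(1,2), of M] False by auto
  then have ne: "?V \<noteq> {}" by blast
  have bdd: "bdd_above ?V" by (rule bdd_aboveI[of _ "slot_capacity \<beta> X"]) (rule ub)
  have "Sup ?V \<le> slot_capacity \<beta> X" by (rule cSup_least[OF ne ub])
  moreover have "slot_capacity \<beta> X \<le> Sup ?V"
  proof (rule LIMSEQ_le_const2)
    have "(\<lambda>M. real M / real (M + card X) * edge_length E) \<longlonglongrightarrow> 1 * edge_length E"
    proof (intro tendsto_mult tendsto_const)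
      show "(\<lambda>M. real M / real (M + card X)) \<longlonglongrightarrow> 1"
        by real_asymp
    qed
    then show "(\<lambda>M. real M / real (M + card X) * edge_length E) \<longlonglongrightarrow> slot_capacity \<beta> X"
      by (simp add: E)
    show "\<exists>K. \<forall>M\<ge>K. real M / real (M + card X) * edge_length E \<le> Sup ?V"
      using lb cSup_upper[OF _ bdd] order_trans by meson
  qed
  ultimately show ?thesis using False by (simp add: transport_capacity_def)
qed

section \<open>Geometry of feasible edge sets\<close>

text \<open>With hop lengths \<open>d\<close>, \<open>d'\<close> and receiver distance
  \<open>D\<close>, the triangle inequality turns the two interference conditions into
  \<open>\<beta> * d \<le> d' + D\<close> and \<open>\<beta> * d' \<le> d + D\<close>. Adding them
  gives the claim.\<close>

lemma feasible_receiver_dist: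
  assumes "feasible \<beta> E" "e \<in> E" "e' \<in> E" "e \<noteq> e'"
  shows "(\<beta> - 1) / 2 * (dist (fst e) (snd e) + dist (fst e') (snd e')) \<le> dist (snd e) (snd e')"
proof -
  have "\<beta> * dist (fst e) (snd e) \<le> dist (fst e') (snd e)"
    "\<beta> * dist (fst e') (snd e') \<le> dist (fst e) (snd e')"
    using assms by (auto simp: feasible_def)
  moreover have "dist (fst e') (snd e) \<le> dist (fst e') (snd e') + dist (snd e) (snd e')"
    "dist (fst e) (snd e') \<le> dist (fst e) (snd e) + dist (snd e) (snd e')"
    by (metis dist_commute dist_triangle)+
  ultimately show ?thesis by (simp add: field_simps)
qed

text \<open>Ratio of two radii: disjoint disks of radius \<open>(\<beta> - 1) / 2\<close> times the
  hop length all lie in a disk of radius \<open>\<beta> * R\<close>. The absolute value makes the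
  constant nonnegative without a condition on \<open>R\<close>.\<close>

definition edge_const :: "real \<Rightarrow> real \<Rightarrow> real" where
  "edge_const \<beta> R = 2 * \<beta> * \<bar>R\<bar> / (\<beta> - 1)"

lemma edge_const_nonneg: "1 < \<beta> \<Longrightarrow> 0 \<le> edge_const \<beta> R"
  by (simp add: edge_const_def)

text \<open>
  The disks of radius proportional to the hop length around the receivers are disjoint; comparing
  areas bounds the sum of squared hop lengths.
\<close>

lemma feasible_sum_squares:
  assumes "1 < \<beta>" "X \<subseteq> cball 0 R" "E \<subseteq> X \<times> X" "feasible \<beta> E" "finite E"
  shows "(\<Sum>e\<in>E. (dist (fst e) (snd e))\<^sup>2) \<le> (edge_const \<beta> R)\<^sup>2"
proof (cases "E = {}")
  case False
  then obtain u v where "(u, v) \<in> E" by auto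
  then have "norm u \<le> R" using assms(2,3) by auto
  then have R: "0 \<le> R" using norm_ge_zero[of u] by linarith
  define r where "r e = (\<beta> - 1) / 2 * dist (fst e) (snd e)" for e :: "node \<times> node"
  have r0: "0 \<le> r e" for e using assms(1) by (simp add: r_def)
  have disj: "disjoint_family_on (\<lambda>e. ball (snd e) (r e)) E"
    unfolding disjoint_family_on_def
  proof (intro ballI impI)
    fix e e' assume e: "e \<in> E" "e' \<in> E" "e \<noteq> e'"
    have "r e + r e' \<le> dist (snd e) (snd e')"
      using feasible_receiver_dist[OF assms(4) e] by (simp add: r_def algebra_simps)
    then show "ball (snd e) (r e) \<inter> ball (snd e') (r e') = {}"
      by (rule disjoint_ballI)
  qed
  \<comment> \<open>A hop inside the ball has length at most \<open>2 * R\<close>, so its disk has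
    radius at most \<open>(\<beta> - 1) * R\<close> and stays within
    \<open>R + (\<beta> - 1) * R\<close> of the origin.\<close>
  have sub: "(\<Union>e\<in>E. ball (snd e) (r e)) \<subseteq> cball 0 (\<beta> * R)"
  proof clarify
    fix x u v assume uv: "(u, v) \<in> E" and x: "x \<in> ball (snd (u, v)) (r (u, v))"
    have "norm u \<le> R" "norm v \<le> R" using uv assms(2,3) by auto
    moreover have "dist u v \<le> norm u + norm v" by (simp add: dist_norm norm_triangle_ineq4)
    ultimately have "dist u v \<le> 2 * R" by simp
    then have "r (u, v) \<le> (\<beta> - 1) / 2 * (2 * R)" unfolding r_def
      using assms(1) by (intro mult_left_mono) auto
    moreover have "norm x \<le> norm v + dist v x" by (metis add.commute dist_norm norm_triangle_sub dist_commute)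
    ultimately have "norm x \<le> \<beta> * R" using x \<open>norm v \<le> R\<close> by (simp add: algebra_simps)
    then show "x \<in> cball 0 (\<beta> * R)" by simp
  qed
  have "(\<Sum>e\<in>E. unit_ball_vol 2 * (r e)\<^sup>2) = (\<Sum>e\<in>E. measure lborel (ball (snd e) (r e)))"
    using r0 by (simp add: content_ball)
  also have "\<dots> = measure lborel (\<Union>e\<in>E. ball (snd e) (r e))"
    using assms(5) disj by (intro measure_finite_Union[symmetric])
      (simp_all add: less_imp_neq[OF emeasure_lborel_ball_finite, simplified] image_subset_iff)
  also have "\<dots> \<le> measure lborel (cball (0::node) (\<beta> * R))"
    using sub assms(5)
    by (intro measure_mono_fmeasurable) (simp_all add: fmeasurable_def emeasure_lborel_cball_finite[simplified] sets.finite_UN)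
  also have "\<dots> = unit_ball_vol 2 * (\<beta> * R)\<^sup>2"
    using R assms(1) by (simp add: content_cball)
  finally have "(\<Sum>e\<in>E. (r e)\<^sup>2) \<le> (\<beta> * R)\<^sup>2"
    by (simp add: sum_distrib_left[symmetric] unit_ball_vol_2)
  then have "((\<beta> - 1) / 2)\<^sup>2 * (\<Sum>e\<in>E. (dist (fst e) (snd e))\<^sup>2) \<le> (\<beta> * R)\<^sup>2"
    by (simp only: r_def power_mult_distrib sum_distrib_left)
  then show ?thesis using assms(1) by (simp add: edge_const_def power_divide power_mult_distrib field_simps)
qed simp

lemma sum_le_sqrt_card:
  fixes f :: "'a \<Rightarrow> real"
  assumes "(\<Sum>e\<in>E. (f e)\<^sup>2) \<le> K\<^sup>2" "0 \<le> K"
  shows "(\<Sum>e\<in>E. f e) \<le> K * sqrt (card E)"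
proof -
  have "(\<Sum>e\<in>E. f e)\<^sup>2 \<le> (\<Sum>e\<in>E. (f e)\<^sup>2) * (\<Sum>e\<in>E. 1\<^sup>2)"
    using Cauchy_Schwarz_ineq_sum[of f "\<lambda>_. 1" E] by simp
  also have "\<dots> \<le> K\<^sup>2 * card E" using assms(1) by (simp add: mult_right_mono)
  finally have "\<bar>\<Sum>e\<in>E. f e\<bar> \<le> sqrt (K\<^sup>2 * card E)" by (metis real_sqrt_abs real_sqrt_le_iff)
  then show ?thesis using assms(2) by (simp add: real_sqrt_mult)
qed

lemma edge_length_le_sqrt_card:
  assumes "1 < \<beta>" "X \<subseteq> cball 0 R" "E \<subseteq> X \<times> X" "feasible \<beta> E" "finite E"
  shows "edge_length E \<le> edge_const \<beta> R * sqrt (card E)"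
  unfolding edge_length_def
  by (rule sum_le_sqrt_card[OF feasible_sum_squares[OF assms] edge_const_nonneg[OF assms(1)]])

text \<open>A length above \<open>\<delta>\<close> is at most its square divided by
  \<open>\<delta>\<close>. The bound does not depend on the number of hops, so it disappears after
  division by \<open>sqrt n\<close>.\<close>

lemma edge_length_long:
  assumes "1 < \<beta>" "X \<subseteq> cball 0 R" "E \<subseteq> X \<times> X" "feasible \<beta> E" "finite E"
    and "0 < \<delta>" "\<And>e. e \<in> E \<Longrightarrow> \<delta> < dist (fst e) (snd e)"
  shows "edge_length E \<le> (edge_const \<beta> R)\<^sup>2 / \<delta>"
proof -
  have "edge_length E \<le> (\<Sum>e\<in>E. (dist (fst e) (snd e))\<^sup>2 / \<delta>)"
    unfolding edge_length_def
  proof (rule sum_mono)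
    fix e assume "e \<in> E"
    from assms(7)[OF this] assms(6) have "\<delta> * dist (fst e) (snd e) \<le> dist (fst e) (snd e) * dist (fst e) (snd e)"
      by (intro mult_right_mono) auto
    then show "dist (fst e) (snd e) \<le> (dist (fst e) (snd e))\<^sup>2 / \<delta>"
      using assms(6) by (simp add: power2_eq_square field_simps)
  qed
  also have "\<dots> \<le> (edge_const \<beta> R)\<^sup>2 / \<delta>"
    using feasible_sum_squares[OF assms(1-5)] assms(6)
    by (simp add: sum_divide_distrib[symmetric] divide_right_mono)
  finally show ?thesis .
qed

text \<open>At most \<open>2 * card Y\<close> hops have an endpoint in \<open>Y\<close>.\<close>

lemma slot_capacity_Un:
  assumes "1 < \<beta>" "X \<union> Y \<subseteq> cball 0 R" "finite X" "finite Y"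
  shows "slot_capacity \<beta> (X \<union> Y) \<le> slot_capacity \<beta> X + edge_const \<beta> R * sqrt (2 * card Y)"
proof -
  have fXY: "finite (X \<union> Y)" using assms(3,4) by simp
  obtain E where E: "E \<subseteq> (X \<union> Y) \<times> (X \<union> Y)" "feasible \<beta> E" "slot_capacity \<beta> (X \<union> Y) = edge_length E"
    by (rule slot_capacity_attained[OF fXY, of \<beta>])
  have fE: "finite E" using E(1) fXY by (meson finite_SigmaI finite_subset)
  define A where "A = E \<inter> X \<times> X"
  define B where "B = E - A"
  have fB: "feasible \<beta> B" by (rule feasible_subset[OF E(2)]) (auto simp: B_def)
  have fA: "feasible \<beta> A" by (rule feasible_subset[OF E(2)]) (auto simp: A_def)
  have finB: "finite B" using fE by (simp add: B_def)
  \<comment> \<open>Both projections are injective on a feasible set, so a point of \<open>Y\<close>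
    is the transmitter of at most one edge and the receiver of at most one.\<close>
  have "card {e\<in>B. fst e \<in> Y} \<le> card Y"
    by (rule card_inj_on_le[of fst]) (use feasible_inj(1)[OF assms(1) fB] assms(4) in \<open>auto intro: inj_on_subset\<close>)
  moreover have "card {e\<in>B. snd e \<in> Y} \<le> card Y"
    by (rule card_inj_on_le[of snd]) (use feasible_inj(2)[OF assms(1) fB] assms(4) in \<open>auto intro: inj_on_subset\<close>)
  moreover have "card B \<le> card ({e\<in>B. fst e \<in> Y} \<union> {e\<in>B. snd e \<in> Y})"
    by (rule card_mono) (use finB E(1) in \<open>simp, auto simp: A_def B_def\<close>)
  ultimately have cB: "card B \<le> 2 * card Y"
    using card_Un_le[of "{e\<in>B. fst e \<in> Y}" "{e\<in>B. snd e \<in> Y}"] by linarith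
  have "edge_length E = edge_length A + edge_length B"
    using edge_length_Un[of A B] fE by (simp add: A_def B_def Un_Diff_cancel2 Int_Diff Un_absorb1 inf_commute)
  moreover have "edge_length A \<le> slot_capacity \<beta> X"
    by (rule slot_capacity_ge[OF assms(3) _ fA]) (simp add: A_def)
  moreover have "edge_length B \<le> edge_const \<beta> R * sqrt (card B)"
    by (rule edge_length_le_sqrt_card[OF assms(1,2) _ fB finB]) (use E(1) in \<open>auto simp: B_def\<close>)
  moreover have "edge_const \<beta> R * sqrt (card B) \<le> edge_const \<beta> R * sqrt (2 * card Y)"
    by (intro mult_left_mono edge_const_nonneg assms(1)) (use cB in simp)
  ultimately show ?thesis using E(3) by linarith
qed

section \<open>Scaling and additivity over cells\<close>

lemma slot_capacity_similarity:
  assumes "0 < h" "finite X"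
  shows "slot_capacity \<beta> ((\<lambda>x. a + h *\<^sub>R x) ` X) = h * slot_capacity \<beta> X"
proof -
  \<comment> \<open>Feasibility compares distances only, so a similarity preserves it. One
    inequality is enough, since it can be applied to the inverse similarity as well.\<close>
  have ge: "h * slot_capacity \<beta> X \<le> slot_capacity \<beta> ((\<lambda>x. a + h *\<^sub>R x) ` X)"
    if "0 < h" "finite X" for h a and X :: "node set"
  proof -
    let ?f = "\<lambda>x. a + h *\<^sub>R x"
    have d: "dist (?f x) (?f y) = h * dist x y" "dist (h *\<^sub>R x) (h *\<^sub>R y) = h * dist x y" for x y
      using that(1) by (simp_all add: dist_norm scaleR_diff_right[symmetric])
    have inj: "inj ?f" using that(1) by (auto simp: inj_on_def)
    obtain E where E: "E \<subseteq> X \<times> X" "feasible \<beta> E" "slot_capacity \<beta> X = edge_length E"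
      by (rule slot_capacity_attained[OF \<open>finite X\<close>, of \<beta>])
    have "feasible \<beta> (map_prod ?f ?f ` E)"
      unfolding feasible_def
    proof (intro conjI ballI impI)
      fix e assume "e \<in> map_prod ?f ?f ` E"
      then show "fst e \<noteq> snd e" using E(2) that(1) by (auto simp: feasible_def)
    next
      fix e e' assume "e \<in> map_prod ?f ?f ` E" "e' \<in> map_prod ?f ?f ` E" and ne: "e \<noteq> e'"
      then obtain g g' where g: "g \<in> E" "g' \<in> E" "e = map_prod ?f ?f g" "e' = map_prod ?f ?f g'"
        unfolding image_iff by metis
      with ne have "g \<noteq> g'" by metis
      then have "\<beta> * dist (fst g) (snd g) \<le> dist (fst g') (snd g)"
        using E(2) g(1,2) by (simp add: feasible_def)
      then show "\<beta> * dist (fst e) (snd e) \<le> dist (fst e') (snd e)"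
        unfolding g(3,4) fst_map_prod snd_map_prod d using that(1) by (simp add: mult.left_commute[of \<beta>])
    qed
    then have "edge_length (map_prod ?f ?f ` E) \<le> slot_capacity \<beta> (?f ` X)"
      by (intro slot_capacity_ge) (use that E(1) in auto)
    moreover have "edge_length (map_prod ?f ?f ` E) = h * edge_length E"
      unfolding edge_length_def
      by (subst sum.reindex) (simp_all add: d sum_distrib_left inj_on_subset[OF prod.inj_map[OF inj inj]])
    ultimately show ?thesis using E by simp
  qed
  have "(\<lambda>x. (- (1/h) *\<^sub>R a) + (1/h) *\<^sub>R x) ` (\<lambda>x. a + h *\<^sub>R x) ` X = X"
    using assms(1) by (simp add: image_image scaleR_add_right)
  with ge[of "1/h" "(\<lambda>x. a + h *\<^sub>R x) ` X" "- (1/h) *\<^sub>R a"] assms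
  have "1 / h * slot_capacity \<beta> ((\<lambda>x. a + h *\<^sub>R x) ` X) \<le> slot_capacity \<beta> X" by simp
  then have "slot_capacity \<beta> ((\<lambda>x. a + h *\<^sub>R x) ` X) \<le> h * slot_capacity \<beta> X"
    using assms(1) by (simp add: field_simps)
  with ge[OF assms] show ?thesis by (meson order_antisym)
qed

text \<open>The erosion of \<open>Q\<close> by \<open>r\<close>. Defined through open balls it is a
  closed set for every \<open>Q\<close>, which later gives its measurability.\<close>

definition core :: "real \<Rightarrow> 'a::metric_space set \<Rightarrow> 'a set" where
  "core r Q = {x. ball x r \<subseteq> Q}"

lemma core_dist: "x \<in> core r Q \<Longrightarrow> y \<notin> Q \<Longrightarrow> r \<le> dist x y"
  by (force simp: core_def)

text \<open>
  Hops longer than \<open>\<delta>\<close> are negligible, and shorter ones neither join nor disturb the cores of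
  different cells. Hence on the union of the cores the capacity is additive up to \<open>O(1/\<delta>)\<close>.
\<close>

lemma slot_capacity_cores:
  assumes "1 < \<beta>" "finite K" "disjoint_family_on Q K" "0 < \<delta>"
    and "finite X" "X \<subseteq> cball 0 R" "X \<subseteq> (\<Union>k\<in>K. core (\<beta> * \<delta>) (Q k))"
  shows "\<bar>slot_capacity \<beta> X - (\<Sum>k\<in>K. slot_capacity \<beta> (X \<inter> Q k))\<bar>
    \<le> real (card K + 1) * ((edge_const \<beta> R)\<^sup>2 / \<delta>)"
proof -
  let ?C = "(edge_const \<beta> R)\<^sup>2 / \<delta>"
  have C0: "0 \<le> ?C" using assms(4) by simp
  have \<beta>\<delta>: "0 < \<beta> * \<delta>" "\<delta> < \<beta> * \<delta>" using assms(1,4) by auto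
  have core_sub: "core (\<beta> * \<delta>) A \<subseteq> A" for A :: "node set"
    using \<beta>\<delta> by (auto simp: core_def)
  \<comment> \<open>The margin is \<open>\<beta> * \<delta>\<close> and not just
    \<open>\<delta>\<close>: it is at least the interference range of any hop of length at most
    \<open>\<delta>\<close>, and it exceeds the hop itself, so a short hop can neither leave its
    cell nor be disturbed from another one.\<close>
  have far: "\<beta> * \<delta> \<le> dist x y" if xy: "x \<in> X" "y \<in> X" "x \<in> Q k" "y \<notin> Q k" "k \<in> K" for x y k
  proof -
    obtain l where l: "l \<in> K" "x \<in> core (\<beta> * \<delta>) (Q l)" using assms(7) xy(1) by blast
    then have "x \<in> Q l" using core_sub by blast
    then have "l = k" using l xy assms(3) by (auto simp: disjoint_family_on_def)
    then show ?thesis using core_dist l(2) xy(4) by blast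
  qed
  define short where "short E = {e\<in>E. dist (fst e) (snd e) \<le> \<delta>}" for E :: "(node \<times> node) set"
  have short: "edge_length E \<le> edge_length (short E) + ?C"
    if "E \<subseteq> X \<times> X" "feasible \<beta> E" for E
  proof -
    have fE: "finite E" using that(1) assms(5) by (meson finite_SigmaI finite_subset)
    have "edge_length E = edge_length (short E) + edge_length (E - short E)"
      using edge_length_Un[of "short E" "E - short E"] fE
      by (simp add: short_def Un_absorb1 Collect_mono_iff)
    moreover have "edge_length (E - short E) \<le> ?C"
      by (rule edge_length_long[OF assms(1,6) _ feasible_subset[OF that(2)] _ assms(4)])
        (use that(1) fE in \<open>auto simp: short_def\<close>)
    ultimately show ?thesis by linarith
  qed
  have "slot_capacity \<beta> X \<le> (\<Sum>k\<in>K. slot_capacity \<beta> (X \<inter> Q k)) + ?C"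
  proof -
    obtain E where E: "E \<subseteq> X \<times> X" "feasible \<beta> E" "slot_capacity \<beta> X = edge_length E"
      by (rule slot_capacity_attained[OF assms(5), of \<beta>])
    have fE: "finite E" using E(1) assms(5) by (meson finite_SigmaI finite_subset)
    define P where "P k = short E \<inter> Q k \<times> Q k" for k
    have fP: "feasible \<beta> (P k)" for k
      by (rule feasible_subset[OF E(2)]) (auto simp: P_def short_def)
    have "short E = (\<Union>k\<in>K. P k)"
    proof (intro equalityI subsetI)
      fix e assume e: "e \<in> short E"
      then have X: "fst e \<in> X" "snd e \<in> X" using E(1) by (auto simp: short_def)
      obtain k where k: "k \<in> K" "fst e \<in> Q k" using X(1) assms(7) core_sub by blast
      have "snd e \<in> Q k"
        using far[OF X k(2) _ k(1)] e \<beta>\<delta>(2) by (force simp: short_def)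
      then show "e \<in> (\<Union>k\<in>K. P k)" using k e by (cases e) (auto simp: P_def)
    qed (auto simp: P_def)
    then have "edge_length (short E) = (\<Sum>k\<in>K. edge_length (P k))"
      unfolding edge_length_def
      by (simp only:) (rule sum.UNION_disjoint, use assms(2,3) fE in \<open>auto simp: P_def short_def disjoint_family_on_def\<close>)
    also have "\<dots> \<le> (\<Sum>k\<in>K. slot_capacity \<beta> (X \<inter> Q k))"
      by (intro sum_mono slot_capacity_ge fP) (use assms(5) E(1) in \<open>auto simp: P_def short_def\<close>)
    finally show ?thesis using short[OF E(1,2)] E(3) by linarith
  qed
  \<comment> \<open>Conversely, the short parts of optimal edge sets of the cells can be glued. Each
    cell gives up at most \<open>?C\<close> with its long hops, whence the factor
    \<open>card K\<close>.\<close>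
  moreover have "(\<Sum>k\<in>K. slot_capacity \<beta> (X \<inter> Q k)) \<le> slot_capacity \<beta> X + real (card K) * ?C"
  proof -
    have "\<exists>E. E \<subseteq> (X \<inter> Q k) \<times> (X \<inter> Q k) \<and> feasible \<beta> E \<and> slot_capacity \<beta> (X \<inter> Q k) = edge_length E" for k
      by (rule slot_capacity_attained[of "X \<inter> Q k" \<beta>]) (use assms(5) in auto)
    then obtain E where E: "\<And>k. E k \<subseteq> (X \<inter> Q k) \<times> (X \<inter> Q k)" "\<And>k. feasible \<beta> (E k)"
      "\<And>k. slot_capacity \<beta> (X \<inter> Q k) = edge_length (E k)" by metis
    have fE: "finite (E k)" for k using E(1) assms(5) by (meson finite_Int finite_SigmaI finite_subset)
    define U where "U = (\<Union>k\<in>K. short (E k))"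
    have "feasible \<beta> U"
      unfolding feasible_def
    proof (intro conjI ballI impI)
      fix e assume "e \<in> U" then show "fst e \<noteq> snd e" using E(2) by (auto simp: U_def short_def feasible_def)
    next
      fix e e' assume "e \<in> U" "e' \<in> U" and ne: "e \<noteq> e'"
      then obtain k l where k: "k \<in> K" "e \<in> short (E k)" and l: "l \<in> K" "e' \<in> short (E l)"
        by (auto simp: U_def)
      show "\<beta> * dist (fst e) (snd e) \<le> dist (fst e') (snd e)"
      proof (cases "k = l")
        case True
        then show ?thesis using k l ne E(2)[of k] by (auto simp: feasible_def short_def)
      next
        case False
        have m: "snd e \<in> X" "snd e \<in> Q k" "fst e' \<in> X" "fst e' \<in> Q l"
          using k l E(1)[of k] E(1)[of l] by (auto simp: short_def)
        then have "fst e' \<notin> Q k" using False k l assms(3) by (auto simp: disjoint_family_on_def)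
        then have "\<beta> * \<delta> \<le> dist (fst e') (snd e)"
          using far[of "snd e" "fst e'" k] m k by (simp add: dist_commute)
        moreover have "\<beta> * dist (fst e) (snd e) \<le> \<beta> * \<delta>"
          using k assms(1) by (intro mult_left_mono) (auto simp: short_def)
        ultimately show ?thesis by linarith
      qed
    qed
    then have "edge_length U \<le> slot_capacity \<beta> X"
      by (intro slot_capacity_ge[OF assms(5)]) (use E(1) in \<open>fastforce simp: U_def short_def\<close>)+
    moreover have "edge_length U = (\<Sum>k\<in>K. edge_length (short (E k)))"
      unfolding edge_length_def U_def
    proof (rule sum.UNION_disjoint[OF assms(2)])
      show "\<forall>k\<in>K. finite (short (E k))" using fE by (simp add: short_def)
      show "\<forall>k\<in>K. \<forall>l\<in>K. k \<noteq> l \<longrightarrow> short (E k) \<inter> short (E l) = {}"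
      proof (intro ballI impI)
        fix k l assume "k \<in> K" "l \<in> K" "k \<noteq> l"
        then have "Q k \<inter> Q l = {}" using assms(3) by (auto simp: disjoint_family_on_def)
        then show "short (E k) \<inter> short (E l) = {}" using E(1)[of k] E(1)[of l] by (auto simp: short_def)
      qed
    qed
    moreover have "(\<Sum>k\<in>K. edge_length (E k)) \<le> (\<Sum>k\<in>K. edge_length (short (E k)) + ?C)"
    proof (intro sum_mono short E(2))
      fix k show "E k \<subseteq> X \<times> X" using E(1)[of k] by auto
    qed
    ultimately show ?thesis using E(3) by (simp add: sum.distrib)
  qed
  moreover have "?C \<le> real (card K + 1) * ?C" "real (card K) * ?C \<le> real (card K + 1) * ?C"
    using C0 mult_right_mono[of 1 "real (card K + 1)" ?C] mult_right_mono[of "real (card K)" "real (card K + 1)" ?C]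
    by simp_all
  ultimately show ?thesis by linarith
qed

lemma slot_capacity_diff_le:
  assumes "1 < \<beta>" "X \<subseteq> cball 0 R" "finite X" "Y \<subseteq> X" "card (X - Y) \<le> m"
  shows "\<bar>slot_capacity \<beta> X - slot_capacity \<beta> Y\<bar> \<le> edge_const \<beta> R * sqrt (2 * real m)"
proof -
  have "slot_capacity \<beta> (Y \<union> (X - Y)) \<le> slot_capacity \<beta> Y + edge_const \<beta> R * sqrt (2 * card (X - Y))"
    by (rule slot_capacity_Un) (use assms finite_subset in auto)
  moreover have "Y \<union> (X - Y) = X" using assms(4) by auto
  moreover have "edge_const \<beta> R * sqrt (2 * card (X - Y)) \<le> edge_const \<beta> R * sqrt (2 * real m)"
    by (intro mult_left_mono edge_const_nonneg assms(1)) (use assms(5) in simp)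
  ultimately show ?thesis using slot_capacity_mono[OF assms(3,4), of \<beta>] by simp
qed

text \<open>The at most \<open>m\<close> points outside the cores are deleted before
  \<open>slot_capacity_cores\<close> is applied. The deletion is paid for once in the whole set and
  once in each cell, which gives \<open>card K + 1\<close> such terms.\<close>

lemma slot_capacity_cells:
  assumes "1 < \<beta>" "finite K" "disjoint_family_on Q K" "0 < \<delta>" "finite X" "X \<subseteq> cball 0 R"
    and "card (X - (\<Union>k\<in>K. core (\<beta> * \<delta>) (Q k))) \<le> m"
  shows "\<bar>slot_capacity \<beta> X - (\<Sum>k\<in>K. slot_capacity \<beta> (X \<inter> Q k))\<bar>
    \<le> real (card K + 1) * (edge_const \<beta> R * sqrt (2 * real m) + (edge_const \<beta> R)\<^sup>2 / \<delta>)"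
proof -
  let ?U = "\<Union>k\<in>K. core (\<beta> * \<delta>) (Q k)"
  let ?D = "edge_const \<beta> R * sqrt (2 * real m)"
  define Y where "Y = X \<inter> ?U"
  have Y: "finite Y" "Y \<subseteq> cball 0 R" "Y \<subseteq> ?U" using assms by (auto simp: Y_def)
  have XY: "X - Y = X - ?U" by (auto simp: Y_def)
  have "\<bar>slot_capacity \<beta> X - slot_capacity \<beta> Y\<bar> \<le> ?D"
    by (rule slot_capacity_diff_le) (use assms XY in \<open>auto simp: Y_def\<close>)
  moreover have "\<bar>(\<Sum>k\<in>K. slot_capacity \<beta> (X \<inter> Q k)) - (\<Sum>k\<in>K. slot_capacity \<beta> (Y \<inter> Q k))\<bar> \<le> real (card K) * ?D"
  proof -
    have "\<bar>slot_capacity \<beta> (X \<inter> Q k) - slot_capacity \<beta> (Y \<inter> Q k)\<bar> \<le> ?D" for k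
    proof (rule slot_capacity_diff_le[OF assms(1)])
      have "card (X \<inter> Q k - Y \<inter> Q k) \<le> card (X - Y)"
        by (rule card_mono) (use assms(5) in auto)
      then show "card (X \<inter> Q k - Y \<inter> Q k) \<le> m" using assms(7) XY by simp
    qed (use assms in \<open>auto simp: Y_def\<close>)
    then have "(\<Sum>k\<in>K. \<bar>slot_capacity \<beta> (X \<inter> Q k) - slot_capacity \<beta> (Y \<inter> Q k)\<bar>) \<le> (\<Sum>k\<in>K. ?D)"
      by (rule sum_mono)
    then show ?thesis
      using sum_abs[of "\<lambda>k. slot_capacity \<beta> (X \<inter> Q k) - slot_capacity \<beta> (Y \<inter> Q k)" K]
      by (simp add: sum_subtractf)
  qed
  moreover note slot_capacity_cores[OF assms(1-4) Y]
  ultimately show ?thesis by (simp add: algebra_simps)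
qed

section \<open>Sequences of independent samples\<close>

abbreviation iid :: "'a measure \<Rightarrow> (nat \<Rightarrow> 'a) measure" where
  "iid \<mu> \<equiv> \<Pi>\<^sub>M i\<in>(UNIV :: nat set). \<mu>"

lemma prob_space_iid: "prob_space \<mu> \<Longrightarrow> prob_space (iid \<mu>)"
  by (rule prob_space_PiM) simp

lemma iid_cong: "sets \<mu> = sets \<nu> \<Longrightarrow> sets (iid \<mu>) = sets (iid \<nu>)"
  by (rule sets_PiM_cong) auto

lemma AE_iid: "prob_space \<mu> \<Longrightarrow> AE x in \<mu>. P x \<Longrightarrow> AE x in iid \<mu>. \<forall>i. P (x i)"
  by (simp add: AE_all_countable AE_PiM_component)

lemma indep_vars_iid:
  assumes "prob_space \<mu>"
  shows "prob_space.indep_vars (iid \<mu>) (\<lambda>_. \<mu>) (\<lambda>i x. x i) UNIV"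
proof -
  interpret prob_space "iid \<mu>" by (rule prob_space_iid[OF assms])
  have "distr (iid \<mu>) (iid \<mu>) (\<lambda>x. \<lambda>i\<in>UNIV. x i) = iid \<mu>"
    by (simp add: restrict_UNIV)
  moreover have "distr (iid \<mu>) \<mu> (\<lambda>x. x i) = \<mu>" for i
    by (rule distr_PiM_component) (use assms in auto)
  ultimately show ?thesis
    by (subst indep_vars_iff_distr_eq_PiM') auto
qed

text \<open>Hoeffding's inequality makes the probability of a deviation by \<open>\<epsilon>\<close>
  geometrically small in \<open>n\<close>. These probabilities are summable, so Borel-Cantelli gives
  the strong law for indicators.\<close>

lemma frequency:
  assumes "prob_space \<mu>" and [measurable]: "B \<in> sets \<mu>"
  shows "AE x in iid \<mu>. (\<lambda>n. real (card {i. i < n \<and> x i \<in> B}) / real n) \<longlonglongrightarrow> measure \<mu> B"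
proof -
  interpret \<mu>: prob_space \<mu> by fact
  interpret prob_space "iid \<mu>" by (rule prob_space_iid[OF assms(1)])
  let ?X = "\<lambda>i x. indicator B (x i) :: real"
  have ind: "indep_vars (\<lambda>_. borel) ?X I" for I
    by (rule indep_vars_compose2[OF indep_vars_subset[OF indep_vars_iid[OF assms(1)]]]) auto
  have card_eq: "(\<Sum>i<n. ?X i x) = real (card {i. i < n \<and> x i \<in> B})" for n :: nat and x
  proof -
    have "(\<Sum>i<n. ?X i x) = (\<Sum>i\<in>{i. i < n \<and> x i \<in> B}. 1)"
      by (rule sum.mono_neutral_cong_right) auto
    then show ?thesis by simp
  qed
  have expec: "expectation (?X i) = measure \<mu> B" for i
  proof -
    have "expectation (?X i) = (\<integral>y. indicator B y \<partial>distr (iid \<mu>) \<mu> (\<lambda>x. x i))"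
      by (rule integral_distr[symmetric]) auto
    then show ?thesis using distr_PiM_component[of UNIV "\<lambda>_. \<mu>" i] assms(1) by simp
  qed
  have tail: "prob {x\<in>space (iid \<mu>). \<epsilon> * real n \<le> \<bar>real (card {i. i < n \<and> x i \<in> B}) - real n * measure \<mu> B\<bar>}
      \<le> 2 * exp (- 2 * \<epsilon>\<^sup>2) ^ n" if "0 < n" "0 < \<epsilon>" for n \<epsilon>
  proof -
    interpret H: Hoeffding_ineq "iid \<mu>" "{..<n}" ?X "\<lambda>_. 0" "\<lambda>_. 1" "\<Sum>i<n. expectation (?X i)"
      by unfold_locales (use ind in \<open>simp_all add: indicator_le_1\<close>)
    show ?thesis
      using H.Hoeffding_ineq_abs_ge[of "\<epsilon> * real n"] that
      by (simp add: card_eq expec power_mult_distrib power2_eq_square exp_of_nat_mult[symmetric] mult_ac)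
  qed
  have "AE x in iid \<mu>. \<forall>\<^sub>F n in sequentially. \<bar>real (card {i. i < n \<and> x i \<in> B}) / real n - measure \<mu> B\<bar> < \<epsilon>"
    if "0 < \<epsilon>" for \<epsilon>
  proof -
    define A where "A n = {x\<in>space (iid \<mu>). \<epsilon> * real n \<le> \<bar>(\<Sum>i<n. ?X i x) - real n * measure \<mu> B\<bar>}" for n
    have A[measurable]: "A n \<in> sets (iid \<mu>)" for n unfolding A_def by measurable
    have "summable (\<lambda>n. prob (A n))"
    proof (rule summable_comparison_test)
      show "summable (\<lambda>n. 2 * exp (- 2 * \<epsilon>\<^sup>2) ^ n)"
        using that by (intro summable_mult summable_geometric) simp
      show "\<exists>N. \<forall>n\<ge>N. norm (prob (A n)) \<le> 2 * exp (- 2 * \<epsilon>\<^sup>2) ^ n"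
        using tail that by (intro exI[of _ 1]) (simp add: A_def card_eq)
    qed
    then have "AE x in iid \<mu>. \<forall>\<^sub>F n in sequentially. x \<in> space (iid \<mu>) - A n"
      by (intro borel_cantelli_AE1) (auto simp: less_top[symmetric])
    then show ?thesis
    proof eventually_elim
      case (elim x)
      show ?case using elim eventually_gt_at_top[of 0]
      proof eventually_elim
        case (elim n)
        then have "\<bar>real (card {i. i < n \<and> x i \<in> B}) - real n * measure \<mu> B\<bar> < \<epsilon> * real n"
          by (auto simp: A_def card_eq)
        moreover have "real (card {i. i < n \<and> x i \<in> B}) / real n - measure \<mu> B
            = (real (card {i. i < n \<and> x i \<in> B}) - real n * measure \<mu> B) / real n"
          using elim(2) by (simp add: field_simps)
        ultimately show ?case using elim(2) by (simp add: abs_divide divide_less_eq)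
      qed
    qed
  qed
  then have "AE x in iid \<mu>. \<forall>k. \<forall>\<^sub>F n in sequentially.
      \<bar>real (card {i. i < n \<and> x i \<in> B}) / real n - measure \<mu> B\<bar> < 1 / real (Suc k)"
    by (simp add: AE_all_countable)
  then show ?thesis
  proof eventually_elim
    case (elim x)
    show ?case
    proof (rule tendstoI)
      fix e :: real assume "0 < e"
      then obtain k where k: "1 / real (Suc k) < e" using nat_approx_posE by blast
      show "\<forall>\<^sub>F n in sequentially. dist (real (card {i. i < n \<and> x i \<in> B}) / real n) (measure \<mu> B) < e"
        using elim[rule_format, of k] by eventually_elim (use k in \<open>simp add: dist_real_def\<close>)
    qed
  qed
qed

text \<open>A law on sequences is determined by finite cylinders, and the preimage of a cylinder
  under a coordinatewise map is again a cylinder.\<close>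

lemma distr_iid_map:
  assumes "prob_space P" and [measurable]: "\<phi> \<in> measurable P N"
  shows "distr (iid P) (iid N) (\<lambda>\<omega> i. \<phi> (\<omega> i)) = iid (distr P N \<phi>)"
proof (rule measure_eqI_PiM_infinite)
  interpret P: prob_space P by fact
  have D: "prob_space (distr P N \<phi>)" by (rule P.prob_space_distr) fact
  have [measurable]: "(\<lambda>\<omega> i. \<phi> (\<omega> i)) \<in> measurable (iid P) (iid N)"
    by (rule measurable_PiM_single') (auto simp: space_PiM PiE_iff measurable_space[OF assms(2)])
  interpret prob_space "distr (iid P) (iid N) (\<lambda>\<omega> i. \<phi> (\<omega> i))"
    by (rule prob_space.prob_space_distr[OF prob_space_iid[OF assms(1)]]) measurable
  show "finite_measure (distr (iid P) (iid N) (\<lambda>\<omega> i. \<phi> (\<omega> i)))" by unfold_locales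
  show "sets (distr (iid P) (iid N) (\<lambda>\<omega> i. \<phi> (\<omega> i))) = sets (iid N)"
    "sets (iid (distr P N \<phi>)) = sets (iid N)" by (simp, rule iid_cong, simp)
  fix J :: "nat set" and A assume J: "finite J" "J \<subseteq> UNIV" and A[measurable]: "\<And>i. i \<in> J \<Longrightarrow> A i \<in> sets N"
  let ?E = "prod_emb UNIV (\<lambda>_. N) J (Pi\<^sub>E J A)"
  have E[measurable]: "?E \<in> sets (iid N)" using J A by (intro sets_PiM_I) auto
  have "emeasure (distr (iid P) (iid N) (\<lambda>\<omega> i. \<phi> (\<omega> i))) ?E
      = emeasure (iid P) ((\<lambda>\<omega> i. \<phi> (\<omega> i)) -` ?E \<inter> space (iid P))"
    by (rule emeasure_distr) auto
  also have "(\<lambda>\<omega> i. \<phi> (\<omega> i)) -` ?E \<inter> space (iid P)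
      = prod_emb UNIV (\<lambda>_. P) J (\<Pi>\<^sub>E i\<in>J. \<phi> -` A i \<inter> space P)"
    using measurable_space[OF assms(2)] by (auto simp: prod_emb_def space_PiM PiE_iff)
  also have "emeasure (iid P) \<dots> = (\<Prod>i\<in>J. emeasure P (\<phi> -` A i \<inter> space P))"
    by (rule emeasure_PiM_emb) (use J A assms(1) in auto)
  also have "\<dots> = (\<Prod>i\<in>J. emeasure (distr P N \<phi>) (A i))"
    using A by (intro prod.cong refl emeasure_distr[symmetric]) auto
  also have "\<dots> = emeasure (iid (distr P N \<phi>)) (prod_emb UNIV (\<lambda>_. distr P N \<phi>) J (Pi\<^sub>E J A))"
    by (rule emeasure_PiM_emb[symmetric]) (use J A D in auto)
  also have "prod_emb UNIV (\<lambda>_. distr P N \<phi>) J (Pi\<^sub>E J A) = ?E" by (simp add: prod_emb_def)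
  finally show "emeasure (distr (iid P) (iid N) (\<lambda>\<omega> i. \<phi> (\<omega> i))) ?E = emeasure (iid (distr P N \<phi>)) ?E" .
qed

text \<open>By Fubini one may fix \<open>a\<close>; the section of a cylinder is then a cylinder in
  the other sequence. Its measure is a product of functions of single coordinates
  \<open>a i\<close>, and by independence the integral of this product factorizes.\<close>

lemma distr_iid_zip:
  assumes "prob_space A" "prob_space B" and h[measurable]: "h \<in> measurable (A \<Otimes>\<^sub>M B) N"
  shows "distr (iid A \<Otimes>\<^sub>M iid B) (iid N) (\<lambda>(a, b) i. h (a i, b i)) = iid (distr (A \<Otimes>\<^sub>M B) N h)"
proof (rule measure_eqI_PiM_infinite)
  interpret A: prob_space A by fact
  interpret B: prob_space B by fact
  interpret AB: pair_prob_space A B ..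
  interpret iA: prob_space "iid A" by (rule prob_space_iid[OF assms(1)])
  interpret iB: prob_space "iid B" by (rule prob_space_iid[OF assms(2)])
  interpret iAB: pair_prob_space "iid A" "iid B" ..
  let ?z = "\<lambda>(a, b) i. h (a i, b i)"
  have D: "prob_space (distr (A \<Otimes>\<^sub>M B) N h)" by (rule AB.prob_space_distr) fact
  have hs: "h (a, b) \<in> space N" if "a \<in> space A" "b \<in> space B" for a b
    using measurable_space[OF h] that by (auto simp: space_pair_measure)
  have [measurable]: "?z \<in> measurable (iid A \<Otimes>\<^sub>M iid B) (iid N)"
    by (rule measurable_PiM_single') (auto simp: space_PiM space_pair_measure PiE_iff hs case_prod_beta)
  interpret prob_space "distr (iid A \<Otimes>\<^sub>M iid B) (iid N) ?z"
    by (rule iAB.prob_space_distr) measurable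
  show "finite_measure (distr (iid A \<Otimes>\<^sub>M iid B) (iid N) ?z)" by unfold_locales
  show "sets (distr (iid A \<Otimes>\<^sub>M iid B) (iid N) ?z) = sets (iid N)"
    "sets (iid (distr (A \<Otimes>\<^sub>M B) N h)) = sets (iid N)" by (simp, rule iid_cong, simp)
  fix J :: "nat set" and C assume J: "finite J" "J \<subseteq> UNIV" and C[measurable]: "\<And>i. i \<in> J \<Longrightarrow> C i \<in> sets N"
  let ?E = "prod_emb UNIV (\<lambda>_. N) J (Pi\<^sub>E J C)"
  let ?H = "\<lambda>i. h -` C i \<inter> space (A \<Otimes>\<^sub>M B)"
  have H[measurable]: "?H i \<in> sets (A \<Otimes>\<^sub>M B)" if "i \<in> J" for i using C[OF that] by measurable
  have E[measurable]: "?E \<in> sets (iid N)" using J C by (intro sets_PiM_I) auto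
  \<comment> \<open>Outside \<open>J\<close> nothing is known about \<open>C i\<close>; the value 1
    makes \<open>\<kappa> i\<close> measurable for every index.\<close>
  define \<kappa> where "\<kappa> i a = (if i \<in> J then emeasure B (Pair a -` ?H i) else 1)" for i a
  have \<kappa>[measurable]: "\<kappa> i \<in> borel_measurable A" for i
    unfolding \<kappa>_def using B.measurable_emeasure_Pair[OF H] by (cases "i \<in> J") auto
  have "emeasure (distr (iid A \<Otimes>\<^sub>M iid B) (iid N) ?z) ?E
      = emeasure (iid A \<Otimes>\<^sub>M iid B) (?z -` ?E \<inter> space (iid A \<Otimes>\<^sub>M iid B))"
    by (rule emeasure_distr) auto
  also have "\<dots> = (\<integral>\<^sup>+a. emeasure (iid B) (Pair a -` (?z -` ?E \<inter> space (iid A \<Otimes>\<^sub>M iid B))) \<partial>iid A)"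
    by (rule iB.emeasure_pair_measure_alt) measurable
  also have "\<dots> = (\<integral>\<^sup>+a. (\<Prod>i\<in>J. \<kappa> i (a i)) \<partial>iid A)"
  proof (rule nn_integral_cong)
    fix a assume a: "a \<in> space (iid A)"
    then have "Pair a -` (?z -` ?E \<inter> space (iid A \<Otimes>\<^sub>M iid B))
        = prod_emb UNIV (\<lambda>_. B) J (\<Pi>\<^sub>E i\<in>J. Pair (a i) -` ?H i)"
      by (auto simp: prod_emb_def space_PiM PiE_iff space_pair_measure hs)
    also have "emeasure (iid B) \<dots> = (\<Prod>i\<in>J. emeasure B (Pair (a i) -` ?H i))"
      by (rule emeasure_PiM_emb) (use J assms(2) sets_Pair1[OF H] in auto)
    finally show "emeasure (iid B) (Pair a -` (?z -` ?E \<inter> space (iid A \<Otimes>\<^sub>M iid B))) = (\<Prod>i\<in>J. \<kappa> i (a i))"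
      by (simp add: \<kappa>_def)
  qed
  also have "\<dots> = (\<Prod>i\<in>J. \<integral>\<^sup>+a. \<kappa> i (a i) \<partial>iid A)"
    by (rule iA.indep_vars_nn_integral[OF J(1)])
      (auto intro!: iA.indep_vars_compose2[OF iA.indep_vars_subset[OF indep_vars_iid[OF assms(1)]]])
  also have "\<dots> = (\<Prod>i\<in>J. emeasure (distr (A \<Otimes>\<^sub>M B) N h) (C i))"
  proof (rule prod.cong[OF refl])
    fix i assume i: "i \<in> J"
    have "(\<integral>\<^sup>+a. \<kappa> i (a i) \<partial>iid A) = (\<integral>\<^sup>+a. \<kappa> i a \<partial>distr (iid A) A (\<lambda>a. a i))"
      by (rule nn_integral_distr[symmetric]) auto
    also have "\<dots> = (\<integral>\<^sup>+a. \<kappa> i a \<partial>A)" using distr_PiM_component[of UNIV "\<lambda>_. A" i] assms(1) by simp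
    also have "\<dots> = emeasure (A \<Otimes>\<^sub>M B) (?H i)"
      using i by (simp add: \<kappa>_def B.emeasure_pair_measure_alt H)
    also have "\<dots> = emeasure (distr (A \<Otimes>\<^sub>M B) N h) (C i)"
      using i C by (simp add: emeasure_distr)
    finally show "(\<integral>\<^sup>+a. \<kappa> i (a i) \<partial>iid A) = emeasure (distr (A \<Otimes>\<^sub>M B) N h) (C i)" .
  qed
  also have "\<dots> = emeasure (iid (distr (A \<Otimes>\<^sub>M B) N h)) (prod_emb UNIV (\<lambda>_. distr (A \<Otimes>\<^sub>M B) N h) J (Pi\<^sub>E J C))"
    by (rule emeasure_PiM_emb[symmetric]) (use J C D in auto)
  also have "prod_emb UNIV (\<lambda>_. distr (A \<Otimes>\<^sub>M B) N h) J (Pi\<^sub>E J C) = ?E" by (simp add: prod_emb_def)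
  finally show "emeasure (distr (iid A \<Otimes>\<^sub>M iid B) (iid N) ?z) ?E = emeasure (iid (distr (A \<Otimes>\<^sub>M B) N h)) ?E" .
qed

section \<open>Measurability of the capacity\<close>

text \<open>Edges between points are replaced by edges between indices, so that the quantifier
  ranges over a finite family independent of \<open>x\<close>. Samples may coincide: the condition
  that distinct index edges have distinct images prevents a hop from being counted twice, and
  conversely \<open>inv_into\<close> selects one index for each point.\<close>

lemma slot_capacity_le_iff:
  assumes "finite I"
  shows "slot_capacity \<beta> (x ` I) \<le> a \<longleftrightarrow>
    (\<forall>E\<in>Pow (I \<times> I). (\<forall>e\<in>E. x (fst e) \<noteq> x (snd e)) \<and>
      (\<forall>e\<in>E. \<forall>e'\<in>E. e \<noteq> e' \<longrightarrow> map_prod x x e \<noteq> map_prod x x e' \<and>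
         \<beta> * dist (x (fst e)) (x (snd e)) \<le> dist (x (fst e')) (x (snd e))) \<longrightarrow>
      (\<Sum>e\<in>E. dist (x (fst e)) (x (snd e))) \<le> a)" (is "?L \<longleftrightarrow> (\<forall>E\<in>_. ?F E \<longrightarrow> ?S E \<le> a)")
proof
  assume L: ?L
  show "\<forall>E\<in>Pow (I \<times> I). ?F E \<longrightarrow> ?S E \<le> a"
  proof (intro ballI impI)
    fix E assume E: "E \<in> Pow (I \<times> I)" "?F E"
    have "edge_length (map_prod x x ` E) = ?S E"
      unfolding edge_length_def using E(2) by (subst sum.reindex) (auto simp: inj_on_def)
    moreover have "edge_length (map_prod x x ` E) \<le> slot_capacity \<beta> (x ` I)"
    proof (rule slot_capacity_ge)
      show "feasible \<beta> (map_prod x x ` E)"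
        unfolding feasible_def
      proof (intro conjI ballI impI)
        fix e assume "e \<in> map_prod x x ` E" then show "fst e \<noteq> snd e" using E(2) by auto
      next
        fix e e' assume "e \<in> map_prod x x ` E" "e' \<in> map_prod x x ` E" and ne: "e \<noteq> e'"
        then obtain g g' where g: "g \<in> E" "g' \<in> E" "e = map_prod x x g" "e' = map_prod x x g'"
          unfolding image_iff by metis
        with ne have "g \<noteq> g'" by metis
        then show "\<beta> * dist (fst e) (snd e) \<le> dist (fst e') (snd e)"
          using E(2) g by simp
      qed
    qed (use E(1) assms in auto)
    ultimately show "?S E \<le> a" using L by linarith
  qed
next
  assume R: "\<forall>E\<in>Pow (I \<times> I). ?F E \<longrightarrow> ?S E \<le> a"
  obtain E where E: "E \<subseteq> x ` I \<times> x ` I" "feasible \<beta> E" "slot_capacity \<beta> (x ` I) = edge_length E"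
    by (rule slot_capacity_attained[of "x ` I" \<beta>]) (use assms in auto)
  let ?s = "inv_into I x"
  define G where "G = map_prod ?s ?s ` E"
  have inv: "map_prod x x (map_prod ?s ?s e) = e" if "e \<in> E" for e
    using E(1) that by (cases e) (auto simp: f_inv_into_f)
  have G: "\<exists>e\<in>E. g = map_prod ?s ?s e \<and> x (fst g) = fst e \<and> x (snd g) = snd e" if gG: "g \<in> G" for g
    
  proof -
    obtain e where e: "e \<in> E" "g = map_prod ?s ?s e" using gG unfolding G_def by (rule imageE)
    with inv[OF e(1)] have "x (fst g) = fst e" "x (snd g) = snd e"
      by (metis fst_map_prod, metis snd_map_prod)
    with e show ?thesis by blast
  qed
  have inj: "inj_on (map_prod ?s ?s) E" using inv by (rule inj_on_inverseI)
  have GI: "G \<in> Pow (I \<times> I)" using E(1) unfolding G_def by (auto simp: inv_into_into)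
  have "?F G"
  proof (intro conjI ballI impI)
    fix g assume "g \<in> G" then show "x (fst g) \<noteq> x (snd g)"
      using G[of g] E(2) by (metis feasible_def)
  next
    fix g g' assume "g \<in> G" "g' \<in> G" and ne: "g \<noteq> g'"
    then obtain e e' where e: "e \<in> E" "e' \<in> E" "g = map_prod ?s ?s e" "g' = map_prod ?s ?s e'"
      "x (fst g) = fst e" "x (snd g) = snd e" "x (fst g') = fst e'" "x (snd g') = snd e'"
      using G by metis
    then have "e \<noteq> e'" using ne by metis
    then show "map_prod x x g \<noteq> map_prod x x g'" using e(1-4) inv by metis
    show "\<beta> * dist (x (fst g)) (x (snd g)) \<le> dist (x (fst g')) (x (snd g))"
      using E(2) e(1,2) \<open>e \<noteq> e'\<close> unfolding e(5-8) by (simp add: feasible_def)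
  qed
  with R[THEN bspec, OF GI] have "?S G \<le> a" by (rule mp)
  moreover have "?S G = edge_length E"
    unfolding edge_length_def G_def using inj
    by (subst sum.reindex) (auto intro!: sum.cong simp: inv[unfolded map_prod_def] dest!: inv)
  ultimately show ?L using E(3) by simp
qed

text \<open>Here \<open>iid borel\<close> serves only as a carrier of the sigma-algebra shared by
  all sequence laws considered.\<close>

lemma slot_capacity_measurable:
  fixes Q :: "node set"
  assumes [measurable]: "Q \<in> sets borel"
  shows "(\<lambda>x. slot_capacity \<beta> (x ` {..<n} \<inter> Q)) \<in> borel_measurable (iid borel)"
proof (rule borel_measurable_iff_le[THEN iffD2], intro allI)
  fix a :: real
  have eq: "x ` {..<n} \<inter> Q = x ` {i\<in>{..<n}. x i \<in> Q}" for x :: "nat \<Rightarrow> node" by auto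
  have "slot_capacity \<beta> (x ` {..<n} \<inter> Q) \<le> a \<longleftrightarrow>
    (\<forall>E\<in>Pow ({..<n} \<times> {..<n}). (\<forall>e\<in>E. x (fst e) \<in> Q \<and> x (snd e) \<in> Q) \<longrightarrow> (\<forall>e\<in>E. x (fst e) \<noteq> x (snd e)) \<and>
      (\<forall>e\<in>E. \<forall>e'\<in>E. e \<noteq> e' \<longrightarrow> \<not> (x (fst e) = x (fst e') \<and> x (snd e) = x (snd e')) \<and>
         \<beta> * dist (x (fst e)) (x (snd e)) \<le> dist (x (fst e')) (x (snd e))) \<longrightarrow>
      (\<Sum>e\<in>E. dist (x (fst e)) (x (snd e))) \<le> a)" for x
  proof -
    \<comment> \<open>The index set of the points in \<open>Q\<close> depends on \<open>x\<close>.
      Moving membership in \<open>Q\<close> into the condition on \<open>E\<close> leaves a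
      quantifier over fixed index sets.\<close>
    have 1: "E \<in> Pow ({i\<in>{..<n}. x i \<in> Q} \<times> {i\<in>{..<n}. x i \<in> Q}) \<longleftrightarrow>
        E \<in> Pow ({..<n} \<times> {..<n}) \<and> (\<forall>e\<in>E. x (fst e) \<in> Q \<and> x (snd e) \<in> Q)" for E by auto
    have 2: "map_prod x x e \<noteq> map_prod x x e' \<longleftrightarrow> \<not> (x (fst e) = x (fst e') \<and> x (snd e) = x (snd e'))" for e e'
      by (cases e; cases e') simp
    have fin: "finite {i\<in>{..<n}. x i \<in> Q}" by simp
    show ?thesis
      unfolding eq slot_capacity_le_iff[OF fin] Ball_def[of "Pow _"] 1 2 by (simp only: imp_conjL)
  qed
  then have "{x \<in> space (iid borel). slot_capacity \<beta> (x ` {..<n} \<inter> Q) \<le> a} = {x \<in> space (iid borel).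
    (\<forall>E\<in>Pow ({..<n} \<times> {..<n}). (\<forall>e\<in>E. x (fst e) \<in> Q \<and> x (snd e) \<in> Q) \<longrightarrow> (\<forall>e\<in>E. x (fst e) \<noteq> x (snd e)) \<and>
      (\<forall>e\<in>E. \<forall>e'\<in>E. e \<noteq> e' \<longrightarrow> \<not> (x (fst e) = x (fst e') \<and> x (snd e) = x (snd e')) \<and>
         \<beta> * dist (x (fst e)) (x (snd e)) \<le> dist (x (fst e')) (x (snd e))) \<longrightarrow>
      (\<Sum>e\<in>E. dist (x (fst e)) (x (snd e))) \<le> a)}" by simp
  also have "\<dots> \<in> sets (iid borel)"
  proof -
    have inner: "Measurable.pred (iid borel) (\<lambda>x :: nat \<Rightarrow> node.
       (\<forall>e\<in>E. x (fst e) \<in> Q \<and> x (snd e) \<in> Q) \<longrightarrow> (\<forall>e\<in>E. x (fst e) \<noteq> x (snd e)) \<and>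
      (\<forall>e\<in>E. \<forall>e'\<in>E. e \<noteq> e' \<longrightarrow> \<not> (x (fst e) = x (fst e') \<and> x (snd e) = x (snd e')) \<and>
         \<beta> * dist (x (fst e)) (x (snd e)) \<le> dist (x (fst e')) (x (snd e))) \<longrightarrow>
      (\<Sum>e\<in>E. dist (x (fst e)) (x (snd e))) \<le> a)" if "E \<in> Pow ({..<n} \<times> {..<n})" for E
    proof -
      have fin: "finite E" using that by (auto intro: finite_subset)
      have d[measurable]: "(\<lambda>x :: nat \<Rightarrow> node. dist (x i) (x j)) \<in> borel_measurable (iid borel)" for i j :: nat
        by (intro borel_measurable_dist measurable_component_singleton) auto
      have eq_pred: "Measurable.pred (iid borel) (\<lambda>x :: nat \<Rightarrow> node. x i = x j)" for i j
      proof -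
        have "Measurable.pred (iid borel) (\<lambda>x :: nat \<Rightarrow> node. dist (x i) (x j) = 0)"
          unfolding pred_def by (intro borel_measurable_eq borel_measurable_const d)
        then show ?thesis by simp
      qed
      have dist_le: "Measurable.pred (iid borel) (\<lambda>x :: nat \<Rightarrow> node. \<beta> * dist (x i) (x j) \<le> dist (x k) (x j))" for i j k
        unfolding pred_def by (intro borel_measurable_le borel_measurable_times borel_measurable_const d)
      have mem: "Measurable.pred (iid borel) (\<lambda>x :: nat \<Rightarrow> node. x i \<in> Q)" for i
        by (rule measurable_compose[of "\<lambda>x. x i" _ borel]) (auto simp: pred_def)
      have 1: "Measurable.pred (iid borel) (\<lambda>x :: nat \<Rightarrow> node. \<forall>e\<in>E. x (fst e) \<in> Q \<and> x (snd e) \<in> Q)"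
        by (rule pred_intros_finite(3)[OF fin]) (intro pred_intros_logic mem)
      have 2: "Measurable.pred (iid borel) (\<lambda>x :: nat \<Rightarrow> node. \<forall>e\<in>E. x (fst e) \<noteq> x (snd e))"
        by (rule pred_intros_finite(3)[OF fin]) (intro pred_intros_logic eq_pred)
      have 3: "Measurable.pred (iid borel) (\<lambda>x :: nat \<Rightarrow> node. \<forall>e\<in>E. \<forall>e'\<in>E. e \<noteq> e' \<longrightarrow>
          \<not> (x (fst e) = x (fst e') \<and> x (snd e) = x (snd e')) \<and>
          \<beta> * dist (x (fst e)) (x (snd e)) \<le> dist (x (fst e')) (x (snd e)))"
        by (rule pred_intros_finite(3)[OF fin], rule pred_intros_finite(3)[OF fin])
          (intro pred_intros_logic eq_pred dist_le measurable_const, simp)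
      have S: "(\<lambda>x :: nat \<Rightarrow> node. \<Sum>e\<in>E. dist (x (fst e)) (x (snd e))) \<in> borel_measurable (iid borel)"
        by (rule borel_measurable_sum) (rule d)
      have 4: "Measurable.pred (iid borel) (\<lambda>x :: nat \<Rightarrow> node. (\<Sum>e\<in>E. dist (x (fst e)) (x (snd e))) \<le> a)"
        unfolding pred_def by (intro borel_measurable_le borel_measurable_const S)
      show ?thesis by (intro pred_intros_logic 1 2 3 4)
    qed
    show ?thesis
      unfolding pred_def[symmetric] by (rule pred_intros_finite(3)[OF _ inner]) auto
  qed
  finally show "{x \<in> space (iid borel). slot_capacity \<beta> (x ` {..<n} \<inter> Q) \<le> a} \<in> sets (iid borel)" .
qed

lemma pred_tendsto:
  fixes F :: "nat \<Rightarrow> 'a \<Rightarrow> real"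
  assumes [measurable]: "\<And>n. F n \<in> borel_measurable M"
  shows "Measurable.pred M (\<lambda>x. (\<lambda>n. F n x) \<longlonglongrightarrow> a)"
proof -
  have "(\<lambda>n. F n x) \<longlonglongrightarrow> a \<longleftrightarrow> (\<forall>k. \<exists>N. \<forall>n\<in>{N..}. \<bar>F n x - a\<bar> < 1 / real (Suc k))" for x
  proof
    assume "(\<lambda>n. F n x) \<longlonglongrightarrow> a"
    then show "\<forall>k. \<exists>N. \<forall>n\<in>{N..}. \<bar>F n x - a\<bar> < 1 / real (Suc k)"
      unfolding LIMSEQ_iff real_norm_def by (metis atLeast_iff of_nat_0_less_iff zero_less_Suc zero_less_divide_1_iff)
  next
    assume *: "\<forall>k. \<exists>N. \<forall>n\<in>{N..}. \<bar>F n x - a\<bar> < 1 / real (Suc k)"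
    show "(\<lambda>n. F n x) \<longlonglongrightarrow> a"
      unfolding LIMSEQ_iff real_norm_def
    proof (intro allI impI)
      fix r :: real assume "0 < r"
      then obtain k where "1 / real (Suc k) < r" using nat_approx_posE by blast
      with * show "\<exists>N. \<forall>n\<ge>N. \<bar>F n x - a\<bar> < r" by (meson atLeast_iff order_less_trans)
    qed
  qed
  then show ?thesis by simp
qed

section \<open>The part of a sample that falls in a given set\<close>

lemma enumerate_image_lessThan:
  fixes I :: "nat set"
  assumes "infinite I"
  shows "enumerate I ` {..<card {i. i < n \<and> i \<in> I}} = {i. i < n \<and> i \<in> I}"
proof -
  let ?e = "enumerate I"
  have mono: "strict_mono ?e" by (rule strict_mono_enumerate[OF assms])
  have ran: "range ?e = I" by (rule range_enumerate[OF assms])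
  \<comment> \<open>\<open>m\<close> is the first position whose value reaches \<open>n\<close>,
    hence the number of elements of \<open>I\<close> below \<open>n\<close>. A sample restricted to
    a cell thereby becomes an initial segment of a subsequence.\<close>
  define m where "m = (LEAST k. n \<le> ?e k)"
  have "n \<le> ?e n" by (rule strict_mono_imp_increasing[OF mono])
  then have m: "n \<le> ?e m" unfolding m_def by (rule LeastI)
  have iff: "?e k < n \<longleftrightarrow> k < m" for k
  proof
    assume "?e k < n"
    then have "?e k < ?e m" using m by simp
    then show "k < m" using mono by (simp add: strict_mono_less)
  next
    assume "k < m"
    then show "?e k < n" unfolding m_def using not_less_Least[of k "\<lambda>k. n \<le> ?e k"] by simp
  qed
  have eq: "?e ` {..<m} = {i. i < n \<and> i \<in> I}" 
  proof (intro equalityI subsetI)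
    fix i assume "i \<in> ?e ` {..<m}"
    then show "i \<in> {i. i < n \<and> i \<in> I}" using iff ran by auto
  next
    fix i assume i: "i \<in> {i. i < n \<and> i \<in> I}"
    then have "i \<in> range ?e" using ran by simp
    then obtain k where "i = ?e k" by (rule rangeE)
    then show "i \<in> ?e ` {..<m}" using i iff by auto
  qed
  have "card (?e ` {..<m}) = m"
    by (subst card_image) (auto intro: strict_mono_imp_inj_on[OF mono] inj_on_subset)
  then show ?thesis using eq by simp
qed

text \<open>An iterated limit: for fixed \<open>j\<close> the bound only needs the limit
  \<open>t j\<close> as \<open>n\<close> grows, and \<open>j\<close> goes to infinity afterwards.
  This suits margins that shrink after the sample has become large.\<close>

lemma tendsto_zero_approx:
  fixes u :: "nat \<Rightarrow> real"
  assumes "\<And>j. \<forall>\<^sub>F n in sequentially. \<bar>u n\<bar> \<le> s j n" "\<And>j. s j \<longlonglongrightarrow> t j" "t \<longlonglongrightarrow> 0"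
  shows "u \<longlonglongrightarrow> 0"
proof (rule tendstoI)
  fix e :: real assume "0 < e"
  then have "\<forall>\<^sub>F j in sequentially. t j < e" using assms(3) by (intro order_tendstoD(2))
  then obtain j where j: "t j < e" by (auto simp: eventually_sequentially)
  have "\<forall>\<^sub>F n in sequentially. s j n < e" using assms(2) j by (rule order_tendstoD(2))
  with assms(1)[of j] show "\<forall>\<^sub>F n in sequentially. dist (u n) 0 < e"
    by eventually_elim simp
qed

text \<open>A property of the law of one point, so it may be established on any space that carries
  an i.i.d. sequence with this law.\<close>

definition capacity_limit :: "real \<Rightarrow> node measure \<Rightarrow> real \<Rightarrow> bool" where
  "capacity_limit \<beta> \<mu> a \<longleftrightarrow>
     (AE x in iid \<mu>. (\<lambda>n. slot_capacity \<beta> (x ` {..<n}) / sqrt (real n)) \<longlonglongrightarrow> a)"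

lemma slot_capacity_empty [simp]: "slot_capacity \<beta> {} = 0"
  by (simp add: slot_capacity_def edge_length_def)

lemma pred_capacity_tendsto:
  assumes "Q \<in> sets borel"
  shows "Measurable.pred (iid borel) (\<lambda>x. (\<lambda>n. slot_capacity \<beta> (x ` {..<n} \<inter> Q) / sqrt (real n)) \<longlonglongrightarrow> a)"
  by (rule pred_tendsto) (intro borel_measurable_divide slot_capacity_measurable[OF assms] borel_measurable_const)

text \<open>
  Replacing the samples that fall in \<open>Q\<close> by independent samples from the conditional law does not
  change the law of the sequence. Given the original sequence, the replaced samples are i.i.d.
\<close>

lemma capacity_limit_thinning:
  assumes "prob_space \<mu>" and sets\<mu>: "sets \<mu> = sets borel" and Q: "Q \<in> sets borel"
    and p: "0 < measure \<mu> Q" and lim: "capacity_limit \<beta> (uniform_measure \<mu> Q) a"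
  shows "AE x in iid \<mu>. (\<lambda>n. slot_capacity \<beta> (x ` {..<n} \<inter> Q) / sqrt (real n)) \<longlonglongrightarrow> a * sqrt (measure \<mu> Q)"
proof -
  interpret \<mu>: prob_space \<mu> by fact
  note [measurable_cong] = sets\<mu>
  note [measurable] = Q
  define \<nu> where "\<nu> = uniform_measure \<mu> Q"
  have e0: "emeasure \<mu> Q \<noteq> 0" "emeasure \<mu> Q \<noteq> \<infinity>" using p by (auto simp: \<mu>.emeasure_eq_measure)
  have prob\<nu>: "prob_space \<nu>" unfolding \<nu>_def by (rule prob_space_uniform_measure[OF e0])
  interpret \<nu>: prob_space \<nu> by fact
  have sets\<nu>: "sets \<nu> = sets borel" by (simp add: \<nu>_def sets\<mu>)
  note [measurable_cong] = sets\<nu>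
  interpret \<mu>\<nu>: pair_prob_space \<mu> \<nu> ..
  have prob1: "prob_space (iid \<mu>)" "prob_space (iid \<nu>)" by (rule prob_space_iid, fact)+
  interpret i\<mu>: prob_space "iid \<mu>" by (rule prob1)
  interpret i\<nu>: prob_space "iid \<nu>" by (rule prob1)
  interpret ii: pair_prob_space "iid \<mu>" "iid \<nu>" ..
  define h where "h = (\<lambda>(x, u). if x \<in> Q then u else x :: node)"
  have h[measurable]: "h \<in> measurable (\<mu> \<Otimes>\<^sub>M \<nu>) borel" unfolding h_def by measurable
  have law: "distr (\<mu> \<Otimes>\<^sub>M \<nu>) borel h = \<mu>"
  proof (rule measure_eqI)
    fix C assume "C \<in> sets (distr (\<mu> \<Otimes>\<^sub>M \<nu>) borel h)"
    then have C[measurable]: "C \<in> sets borel" by simp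
    have sp: "space \<mu> = UNIV" "space \<nu> = UNIV" using sets_eq_imp_space_eq[OF sets\<mu>] sets_eq_imp_space_eq[OF sets\<nu>] by simp_all
    have "emeasure (distr (\<mu> \<Otimes>\<^sub>M \<nu>) borel h) C = emeasure (\<mu> \<Otimes>\<^sub>M \<nu>) (h -` C \<inter> space (\<mu> \<Otimes>\<^sub>M \<nu>))"
      by (rule emeasure_distr) auto
    also have "h -` C \<inter> space (\<mu> \<Otimes>\<^sub>M \<nu>) = Q \<times> C \<union> (C - Q) \<times> UNIV"
      by (auto simp: h_def space_pair_measure sp split: if_splits)
    also have "emeasure (\<mu> \<Otimes>\<^sub>M \<nu>) \<dots> = emeasure (\<mu> \<Otimes>\<^sub>M \<nu>) (Q \<times> C) + emeasure (\<mu> \<Otimes>\<^sub>M \<nu>) ((C - Q) \<times> UNIV)"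
      by (rule plus_emeasure[symmetric]) (auto simp: sets\<mu> sets\<nu> intro!: pair_measureI)
    also have "\<dots> = emeasure \<mu> Q * emeasure \<nu> C + emeasure \<mu> (C - Q) * emeasure \<nu> (space \<nu>)"
      by (simp add: \<nu>.emeasure_pair_measure_Times sets\<mu> sets\<nu> sp)
    also have "\<dots> = emeasure \<mu> (Q \<inter> C) + emeasure \<mu> (C - Q)"
    proof -
      have "emeasure \<mu> Q * (emeasure \<mu> (Q \<inter> C) / emeasure \<mu> Q) = emeasure \<mu> (Q \<inter> C)"
        using e0 by (metis ennreal_mult_divide_eq ennreal_times_divide infinity_ennreal_def mult.commute)
      then show ?thesis by (simp add: \<nu>.emeasure_space_1) (simp add: \<nu>_def sets\<mu>)
    qed
    also have "\<dots> = emeasure \<mu> C"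
      by (subst plus_emeasure) (auto simp: sets\<mu> intro!: arg_cong[of _ _ "emeasure \<mu>"])
    finally show "emeasure (distr (\<mu> \<Otimes>\<^sub>M \<nu>) borel h) C = emeasure \<mu> C" .
  qed (simp add: sets\<mu>)
  let ?z = "\<lambda>(a, b) i. h (a i, b i)"
  let ?P = "\<lambda>x. (\<lambda>n. slot_capacity \<beta> (x ` {..<n} \<inter> Q) / sqrt (real n)) \<longlonglongrightarrow> a * sqrt (measure \<mu> Q)"
  have P: "{x \<in> space (iid borel). ?P x} \<in> sets (iid borel)"
    using pred_capacity_tendsto[OF Q] unfolding pred_def .
  have z: "?z \<in> measurable (iid \<mu> \<Otimes>\<^sub>M iid \<nu>) (iid borel)"
    by (rule measurable_PiM_single') (auto simp: case_prod_beta)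
  have pull: "(AE x in iid \<mu>. ?P x) \<longleftrightarrow> (AE w in iid \<mu> \<Otimes>\<^sub>M iid \<nu>. ?P (?z w))"
    using AE_distr_iff[OF z P] unfolding distr_iid_zip[OF assms(1) prob\<nu> h] law .
  have inQ: "AE u in iid \<nu>. \<forall>i. u i \<in> Q"
    by (rule AE_iid[OF prob\<nu>]) (unfold \<nu>_def, rule AE_uniform_measureI, use sets\<mu> in auto)
  have "AE w in iid \<mu> \<Otimes>\<^sub>M iid \<nu>. ?P (?z w)"
  proof (rule ii.AE_pair_measure)
    show "{w \<in> space (iid \<mu> \<Otimes>\<^sub>M iid \<nu>). ?P (?z w)} \<in> sets (iid \<mu> \<Otimes>\<^sub>M iid \<nu>)"
      using measurable_compose[OF z pred_capacity_tendsto[OF Q, of \<beta> "a * sqrt (measure \<mu> Q)"]] unfolding pred_def .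
    have "AE x in iid \<mu>. (\<lambda>n. real (card {i. i < n \<and> x i \<in> Q}) / real n) \<longlonglongrightarrow> measure \<mu> Q"
      by (rule frequency[OF assms(1)]) (simp add: sets\<mu>)
    then show "AE x in iid \<mu>. AE u in iid \<nu>. ?P (?z (x, u))"
    proof eventually_elim
      case (elim x)
      define I where "I = {i. x i \<in> Q}"
      define c where "c n = card {i. i < n \<and> i \<in> I}" for n
      have freq: "(\<lambda>n. real (c n) / real n) \<longlonglongrightarrow> measure \<mu> Q" using elim by (simp add: c_def I_def)
      have inf: "infinite I"
      proof
        assume fin: "finite I"
        have "(\<lambda>n. real (c n) / real n) \<longlonglongrightarrow> 0"
        proof (rule real_tendsto_sandwich)
          show "\<forall>\<^sub>F n in sequentially. 0 \<le> real (c n) / real n" by simp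
          show "\<forall>\<^sub>F n in sequentially. real (c n) / real n \<le> real (card I) / real n"
            unfolding c_def using fin by (intro always_eventually allI divide_right_mono of_nat_mono card_mono) auto
          show "(\<lambda>n. real (card I) / real n) \<longlonglongrightarrow> 0" by (rule lim_const_over_n)
        qed simp
        with freq have "measure \<mu> Q = 0" by (rule LIMSEQ_unique)
        with p show False by simp
      qed
      let ?e = "enumerate I"
      have inj: "inj ?e" by (rule strict_mono_imp_inj_on[OF strict_mono_enumerate[OF inf]])
      \<comment> \<open>With \<open>x\<close> fixed, the enumeration of the indices with
        \<open>x i \<in> Q\<close> is a deterministic injection, so the subsequence of
        \<open>u\<close> along it is again i.i.d. with law \<open>\<nu>\<close>.\<close>
      have "distr (iid \<nu>) (iid \<nu>) (\<lambda>u. \<lambda>n\<in>UNIV. u (?e n)) = iid \<nu>"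
        by (rule distr_PiM_reindex) (use prob\<nu> inj in auto)
      then have re: "distr (iid \<nu>) (iid \<nu>) (\<lambda>u n. u (?e n)) = iid \<nu>" by (simp add: restrict_UNIV)
      have me: "(\<lambda>u n. u (?e n)) \<in> measurable (iid \<nu>) (iid \<nu>)"
        by (rule measurable_PiM_single') (auto simp: space_PiM PiE_iff)
      have "AE u in iid \<nu>. (\<lambda>n. slot_capacity \<beta> ((\<lambda>k. u (?e k)) ` {..<n}) / sqrt (real n)) \<longlonglongrightarrow> a"
        by (rule AE_distrD[OF me], unfold re) (rule lim[unfolded capacity_limit_def, folded \<nu>_def])
      with inQ show ?case
      proof eventually_elim
        case (elim u)
        define S where "S m = slot_capacity \<beta> ((\<lambda>k. u (?e k)) ` {..<m})" for m
        have S: "(\<lambda>m. S m / sqrt (real m)) \<longlonglongrightarrow> a" using elim(2) by (simp add: S_def)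
        have "?z (x, u) ` {..<n} \<inter> Q = (\<lambda>k. u (?e k)) ` {..<c n}" for n
        proof -
          have "?z (x, u) ` {..<n} \<inter> Q = u ` {i. i < n \<and> i \<in> I}"
            using elim(1) by (auto simp: h_def I_def)
          also have "\<dots> = u ` ?e ` {..<c n}" unfolding c_def enumerate_image_lessThan[OF inf] ..
          finally show ?thesis by (simp add: image_image)
        qed
        \<comment> \<open>For \<open>c n = 0\<close> both sides are 0: the empty set has capacity 0,
          and division by 0 yields 0.\<close>
        then have eq: "slot_capacity \<beta> (?z (x, u) ` {..<n} \<inter> Q) / sqrt (real n)
            = S (c n) / sqrt (real (c n)) * sqrt (real (c n) / real n)" for n
          by (cases "c n = 0") (auto simp: S_def real_sqrt_divide)
        have "filterlim c at_top sequentially"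
        proof -
          have "filterlim (\<lambda>n. real (c n) / real n * real n) at_top sequentially"
            by (rule filterlim_tendsto_pos_mult_at_top[OF freq p filterlim_real_sequentially])
          then have "filterlim (\<lambda>n. real (c n)) at_top sequentially"
            by (rule filterlim_cong[THEN iffD1, OF refl refl, rotated])
              (use eventually_gt_at_top[of 0] in \<open>eventually_elim, simp\<close>)
          then show ?thesis by (simp add: filterlim_sequentially_iff_filterlim_real)
        qed
        then have "(\<lambda>n. S (c n) / sqrt (real (c n))) \<longlonglongrightarrow> a"
          by (rule filterlim_compose[OF S])
        then have "(\<lambda>n. S (c n) / sqrt (real (c n)) * sqrt (real (c n) / real n)) \<longlonglongrightarrow> a * sqrt (measure \<mu> Q)"
          by (intro tendsto_mult tendsto_real_sqrt freq)
        then show ?case unfolding eq .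
      qed
    qed
  qed
  then show ?thesis unfolding pull .
qed

section \<open>Image laws and scaling of the uniform case\<close>

lemma AE_iid_distr_iff:
  assumes "prob_space P" "\<phi> \<in> measurable P N" "Measurable.pred (iid N) S"
  shows "(AE x in iid (distr P N \<phi>). S x) \<longleftrightarrow> (AE \<omega> in iid P. S (\<lambda>i. \<phi> (\<omega> i)))"
proof -
  have "(\<lambda>\<omega> i. \<phi> (\<omega> i)) \<in> measurable (iid P) (iid N)"
    by (rule measurable_PiM_single') (use assms(2) in \<open>auto simp: space_PiM PiE_iff measurable_space\<close>)
  \<comment> \<open>Going from \<open>P\<close> to the image law requires a measurable event; this
    is the purpose of the measurability of the capacity.\<close>
  from AE_distr_iff[OF this assms(3)[unfolded pred_def]] show ?thesis
    unfolding distr_iid_map[OF assms(1,2)] .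
qed

lemma pred_capacity_tendsto':
  "Measurable.pred (iid borel) (\<lambda>x. (\<lambda>n. slot_capacity \<beta> (x ` {..<n}) / sqrt (real n)) \<longlonglongrightarrow> a)"
  using pred_capacity_tendsto[of UNIV] by simp

lemma pred_capacity_eventually:
  "Measurable.pred (iid borel) (\<lambda>x. \<forall>\<^sub>F n in sequentially. \<bar>slot_capacity \<beta> (x ` {..<n}) / sqrt (real n) - a\<bar> < e)"
proof -
  have [measurable]: "(\<lambda>x. slot_capacity \<beta> (x ` {..<n})) \<in> borel_measurable (iid borel)" for n
    using slot_capacity_measurable[of UNIV] by simp
  have "Measurable.pred (iid borel) (\<lambda>x. \<exists>N. \<forall>n\<in>{N..}. \<bar>slot_capacity \<beta> (x ` {..<n}) / sqrt (real n) - a\<bar> < e)"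
    by measurable
  then show ?thesis unfolding eventually_sequentially atLeast_def by simp
qed

lemma emeasure_lborel_affine:
  fixes a :: "'a :: euclidean_space"
  assumes "0 < h" and [measurable]: "D \<in> sets borel"
  shows "emeasure lborel D = ennreal (h ^ DIM('a)) * emeasure lborel ((\<lambda>x. a + h *\<^sub>R x) -` D)"
proof -
  have "emeasure lborel D = emeasure (density (distr lborel borel (\<lambda>x. a + h *\<^sub>R x)) (\<lambda>_. ennreal (\<bar>h\<bar> ^ DIM('a)))) D"
    using lborel_affine[of h a] assms(1) by simp
  also have "\<dots> = ennreal (h ^ DIM('a)) * emeasure lborel ((\<lambda>x. a + h *\<^sub>R x) -` D)"
    using assms(1) by (subst emeasure_density_const) (auto simp: emeasure_distr)
  finally show ?thesis .
qed

lemma emeasure_unit_square: "emeasure lborel (cbox 0 (1::node)) = 1"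
proof -
  have "(1::node) \<bullet> b = 1" if "b \<in> Basis" for b using that by (auto simp: Basis_vec_def inner_axis)
  then show ?thesis by (simp add: emeasure_lborel_cbox_eq)
qed

text \<open>The image is uniform on a closed square, whose boundary is null. The open square is
  preferred because open cells are disjoint and exhausted by their cores.\<close>

lemma distr_uniform_affine:
  fixes a :: node
  assumes "0 < h"
  shows "distr (uniform_measure lborel (cbox 0 1)) borel (\<lambda>x. a + h *\<^sub>R x)
    = uniform_measure lborel (box a (a + h *\<^sub>R 1))"
proof (rule measure_eqI)
  let ?f = "\<lambda>x. a + h *\<^sub>R x" and ?B = "box a (a + h *\<^sub>R (1::node))" and ?C = "cbox a (a + h *\<^sub>R (1::node))"
  have vimage: "?f -` ?C = cbox 0 1"
    using assms by (auto simp: mem_box_cart zero_le_mult_iff)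
  have null: "?C - ?B \<in> null_sets lborel"
    using negligible_frontier_interval[of a "a + h *\<^sub>R 1"]
    by (simp add: negligible_iff_null_sets null_sets_completion_iff)
  fix D assume "D \<in> sets (distr (uniform_measure lborel (cbox 0 1)) borel ?f)"
  then have D[measurable]: "D \<in> sets borel" by simp
  have CB: "emeasure lborel (?B \<inter> D) = emeasure lborel (?C \<inter> D)"
    if [measurable]: "D \<in> sets borel" for D :: "node set"
  proof -
    have "?C \<inter> D = ?B \<inter> D \<union> D \<inter> (?C - ?B)" using box_subset_cbox[of a "a + h *\<^sub>R 1"] by auto
    then show ?thesis
      using emeasure_Un_null_set[of "?B \<inter> D" lborel "D \<inter> (?C - ?B)"] null_set_Int1[OF null, of D] by simp
  qed
  have h2: "ennreal (h\<^sup>2) \<noteq> 0" "ennreal (h\<^sup>2) \<noteq> \<infinity>" using assms by auto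
  have 1: "emeasure lborel (?C \<inter> D) = ennreal (h\<^sup>2) * emeasure lborel (cbox 0 1 \<inter> ?f -` D)"
    using emeasure_lborel_affine[OF assms, of "?C \<inter> D" a] by (simp add: vimage)
  have 2: "emeasure lborel ?C = ennreal (h\<^sup>2) * emeasure lborel (cbox 0 (1::node))"
    using emeasure_lborel_affine[OF assms, of "?C" a] by (simp add: vimage)
  have "?f -` D \<in> sets borel" using measurable_sets[of ?f borel borel D] by simp
  then have "emeasure (distr (uniform_measure lborel (cbox 0 1)) borel ?f) D
      = emeasure lborel (cbox 0 1 \<inter> ?f -` D) / emeasure lborel (cbox 0 (1::node))"
    by (subst emeasure_distr) auto
  also have "\<dots> = emeasure lborel (?C \<inter> D) / emeasure lborel ?C"
    unfolding 1 2 using divide_mult_eq[OF h2] by (simp only: mult.commute[of "ennreal (h\<^sup>2)"])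
  also have "\<dots> = emeasure (uniform_measure lborel ?B) D"
    using CB[OF D] CB[of UNIV] by simp
  finally show "emeasure (distr (uniform_measure lborel (cbox 0 1)) borel ?f) D = emeasure (uniform_measure lborel ?B) D" .
qed simp

lemma capacity_limit_box:
  assumes lim: "capacity_limit \<beta> (uniform_measure lborel (cbox 0 1)) A" and "0 < h"
  shows "capacity_limit \<beta> (uniform_measure lborel (box a (a + h *\<^sub>R 1))) (h * A)"
proof -
  have U: "prob_space (uniform_measure lborel (cbox 0 (1::node)))"
    by (rule prob_space_uniform_measure) (simp_all add: emeasure_unit_square)
  have "AE x in iid (uniform_measure lborel (cbox 0 1)).
      (\<lambda>n. slot_capacity \<beta> ((\<lambda>i. a + h *\<^sub>R x i) ` {..<n}) / sqrt (real n)) \<longlonglongrightarrow> h * A"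
    using lim unfolding capacity_limit_def
  proof eventually_elim
    case (elim x)
    have "slot_capacity \<beta> ((\<lambda>i. a + h *\<^sub>R x i) ` {..<n}) / sqrt (real n)
        = h * (slot_capacity \<beta> (x ` {..<n}) / sqrt (real n))" for n
      using slot_capacity_similarity[OF assms(2), of "x ` {..<n}" \<beta> a] by (simp add: image_image)
    then show ?case using tendsto_mult_left[OF elim, of h] by (simp only:)
  qed
  then show ?thesis
    unfolding capacity_limit_def distr_uniform_affine[OF assms(2), symmetric]
    by (subst AE_iid_distr_iff[OF U _ pred_capacity_tendsto']) auto
qed

section \<open>Combining the limits of finitely many open cells\<close>

lemma closed_core: "closed (core r Q)"
proof -
  have "core r Q = - (\<Union>y\<in>-Q. ball y r)" by (auto simp: core_def subset_iff dist_commute)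
  then show ?thesis by auto
qed

text \<open>For a fixed margin \<open>\<delta> j\<close>, the long hops contribute
  \<open>O(1 / sqrt n)\<close>, while the points off the cores contribute a term proportional to
  \<open>sqrt (measure \<mu> (- U j))\<close> in the limit. As the cells are open and carry full
  mass, that term vanishes when \<open>j\<close> grows.\<close>

lemma capacity_limit_cells:
  assumes \<beta>: "1 < \<beta>" and "prob_space \<mu>" and sets\<mu>: "sets \<mu> = sets borel"
    and K: "finite K" "disjoint_family_on Q K" "\<And>k. k \<in> K \<Longrightarrow> open (Q k)" "\<And>k. k \<in> K \<Longrightarrow> Q k \<subseteq> cball 0 R"
    and full: "measure \<mu> (\<Union>k\<in>K. Q k) = 1"
    and lim: "\<And>k. k \<in> K \<Longrightarrow> 0 < measure \<mu> (Q k) \<Longrightarrow> capacity_limit \<beta> (uniform_measure \<mu> (Q k)) (a k)"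
  shows "capacity_limit \<beta> \<mu> (\<Sum>k\<in>K. a k * sqrt (measure \<mu> (Q k)))"
proof -
  interpret \<mu>: prob_space \<mu> by fact
  have sp: "space \<mu> = UNIV" using sets_eq_imp_space_eq[OF sets\<mu>] by simp
  have Qm: "Q k \<in> sets borel" if "k \<in> K" for k using K(3)[OF that] by auto
  define \<delta> where "\<delta> j = 1 / real (Suc j)" for j
  define U where "U j = (\<Union>k\<in>K. core (\<beta> * \<delta> j) (Q k))" for j
  have U: "U j \<in> sets borel" for j
    unfolding U_def by (rule borel_closed) (use K(1) closed_core in auto)
  have Ulim: "(\<lambda>j. measure \<mu> (- U j)) \<longlonglongrightarrow> 0"
  proof -
    have "incseq U"
    proof (rule incseq_SucI)
      fix j
      have "\<beta> * \<delta> (Suc j) \<le> \<beta> * \<delta> j" using \<beta> by (intro mult_left_mono) (auto simp: \<delta>_def field_simps)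
      then show "U j \<le> U (Suc j)" by (force simp: U_def core_def)
    qed
    moreover have "(\<Union>j. U j) = (\<Union>k\<in>K. Q k)"
    proof (intro equalityI subsetI)
      fix x assume "x \<in> (\<Union>j. U j)"
      then obtain j k where "k \<in> K" "ball x (\<beta> * \<delta> j) \<subseteq> Q k" by (auto simp: U_def core_def)
      moreover have "x \<in> ball x (\<beta> * \<delta> j)" using \<beta> by (simp add: \<delta>_def)
      ultimately show "x \<in> (\<Union>k\<in>K. Q k)" by blast
    next
      fix x assume "x \<in> (\<Union>k\<in>K. Q k)"
      then obtain k where k: "k \<in> K" "x \<in> Q k" by blast
      then obtain e where e: "0 < e" "ball x e \<subseteq> Q k" using K(3) open_contains_ball by blast
      obtain j where j: "1 / real (Suc j) < e / \<beta>" using nat_approx_posE[of "e / \<beta>"] e \<beta> by auto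
      have "\<beta> * \<delta> j \<le> e" using j \<beta> by (simp add: \<delta>_def field_simps)
      then have "ball x (\<beta> * \<delta> j) \<subseteq> Q k" using e(2) by (meson subset_ball subset_trans)
      then show "x \<in> (\<Union>j. U j)" using k(1) by (auto simp: U_def core_def)
    qed
    ultimately have "(\<lambda>j. measure \<mu> (U j)) \<longlonglongrightarrow> 1"
      using \<mu>.finite_Lim_measure_incseq[of U] U full sets\<mu> by auto
    then have "(\<lambda>j. 1 - measure \<mu> (U j)) \<longlonglongrightarrow> 1 - 1" by (intro tendsto_diff tendsto_const)
    moreover have "measure \<mu> (- U j) = 1 - measure \<mu> (U j)" for j
      using \<mu>.prob_compl[of "U j"] U sets\<mu> sp by (simp add: Compl_eq_Diff_UNIV)
    ultimately show ?thesis by simp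
  qed
  have A1: "AE x in iid \<mu>. \<forall>i. x i \<in> (\<Union>k\<in>K. Q k)"
  proof (rule AE_iid[OF assms(2)])
    show "AE x in \<mu>. x \<in> (\<Union>k\<in>K. Q k)"
      by (rule \<mu>.AE_prob_1) (rule full)
  qed
  have A2: "AE x in iid \<mu>. \<forall>j. (\<lambda>n. real (card {i. i < n \<and> x i \<in> - U j}) / real n) \<longlonglongrightarrow> measure \<mu> (- U j)"
    unfolding AE_all_countable by (intro allI frequency[OF assms(2)]) (use U sets\<mu> in auto)
  have A3: "AE x in iid \<mu>. (\<lambda>n. slot_capacity \<beta> (x ` {..<n} \<inter> Q k) / sqrt (real n)) \<longlonglongrightarrow> a k * sqrt (measure \<mu> (Q k))"
    if k: "k \<in> K" for k
  \<comment> \<open>A null cell has no usable conditional law, but almost surely it is never hit, so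
    the claim holds with limit 0.\<close>
  proof (cases "measure \<mu> (Q k) = 0")
    case True
    have "AE x in \<mu>. x \<notin> Q k"
      by (rule AE_not_in) (use True Qm[OF k] sets\<mu> in \<open>simp add: null_sets_def \<mu>.emeasure_eq_measure\<close>)
    then have "AE x in iid \<mu>. \<forall>i. x i \<notin> Q k" by (rule AE_iid[OF assms(2)])
    then show ?thesis
    proof eventually_elim
      case (elim x)
      then have "x ` {..<n} \<inter> Q k = {}" for n by auto
      then show ?case using True by simp
    qed
  next
    case False
    then have "0 < measure \<mu> (Q k)" by (simp add: zero_less_measure_iff)
    then show ?thesis
      by (intro capacity_limit_thinning[OF assms(2) sets\<mu> Qm[OF k]] lim[OF k])
  qed
  have A3: "AE x in iid \<mu>. \<forall>k\<in>K. (\<lambda>n. slot_capacity \<beta> (x ` {..<n} \<inter> Q k) / sqrt (real n)) \<longlonglongrightarrow> a k * sqrt (measure \<mu> (Q k))"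
    by (rule AE_finite_allI[OF K(1) A3])
  show ?thesis
    unfolding capacity_limit_def
    using A1 A2 A3
  proof eventually_elim
    case (elim x)
    define C where "C = edge_const \<beta> R"
    define W where "W n = slot_capacity \<beta> (x ` {..<n})" for n
    define S where "S n = (\<Sum>k\<in>K. slot_capacity \<beta> (x ` {..<n} \<inter> Q k))" for n
    define m where "m j n = card {i. i < n \<and> x i \<in> - U j}" for j n
    have bound: "\<bar>W n - S n\<bar> \<le> real (card K + 1) * (C * sqrt (2 * real (m j n)) + C\<^sup>2 / \<delta> j)" for j n
      unfolding W_def S_def C_def
    proof (rule slot_capacity_cells[OF \<beta> K(1,2)])
      show "0 < \<delta> j" by (simp add: \<delta>_def)
      show "x ` {..<n} \<subseteq> cball 0 R" using elim(1) K(4) by blast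
      have "x ` {..<n} - U j = x ` {i. i < n \<and> x i \<in> - U j}" by auto
      then show "card (x ` {..<n} - (\<Union>k\<in>K. core (\<beta> * \<delta> j) (Q k))) \<le> m j n"
        unfolding U_def[symmetric] m_def by (simp add: card_image_le)
    qed simp
    have "(\<lambda>n. (W n - S n) / sqrt (real n)) \<longlonglongrightarrow> 0"
    proof (rule tendsto_zero_approx)
      fix j
      show "\<forall>\<^sub>F n in sequentially. \<bar>(W n - S n) / sqrt (real n)\<bar>
          \<le> real (card K + 1) * (C * sqrt (2 * (real (m j n) / real n)) + C\<^sup>2 / \<delta> j / sqrt (real n))"
      proof (rule always_eventually, rule allI)
        fix n
        have "\<bar>(W n - S n) / sqrt (real n)\<bar> \<le> real (card K + 1) * (C * sqrt (2 * real (m j n)) + C\<^sup>2 / \<delta> j) / sqrt (real n)"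
          using bound[of n j] by (simp add: abs_divide divide_right_mono)
        also have "\<dots> = real (card K + 1) * (C * sqrt (2 * (real (m j n) / real n)) + C\<^sup>2 / \<delta> j / sqrt (real n))"
          by (simp add: real_sqrt_divide real_sqrt_mult add_divide_distrib distrib_left)
        finally show "\<bar>(W n - S n) / sqrt (real n)\<bar>
          \<le> real (card K + 1) * (C * sqrt (2 * (real (m j n) / real n)) + C\<^sup>2 / \<delta> j / sqrt (real n))" .
      qed
      have "(\<lambda>n. C\<^sup>2 / \<delta> j / sqrt (real n)) \<longlonglongrightarrow> 0" by real_asymp
      then show "(\<lambda>n. real (card K + 1) * (C * sqrt (2 * (real (m j n) / real n)) + C\<^sup>2 / \<delta> j / sqrt (real n)))
          \<longlonglongrightarrow> real (card K + 1) * (C * sqrt (2 * measure \<mu> (- U j)) + 0)"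
        using elim(2) unfolding m_def by (intro tendsto_mult tendsto_add tendsto_real_sqrt tendsto_const) auto
    next
      have "(\<lambda>j. real (card K + 1) * (C * sqrt (2 * measure \<mu> (- U j)) + 0)) \<longlonglongrightarrow> real (card K + 1) * (C * sqrt (2 * 0) + 0)"
        by (intro tendsto_mult tendsto_add tendsto_real_sqrt tendsto_const Ulim)
      then show "(\<lambda>j. real (card K + 1) * (C * sqrt (2 * measure \<mu> (- U j)) + 0)) \<longlonglongrightarrow> 0" by simp
    qed
    moreover have "(\<lambda>n. S n / sqrt (real n)) \<longlonglongrightarrow> (\<Sum>k\<in>K. a k * sqrt (measure \<mu> (Q k)))"
      unfolding S_def sum_divide_distrib by (rule tendsto_sum) (use elim(3) in auto)
    ultimately have "(\<lambda>n. (W n - S n) / sqrt (real n) + S n / sqrt (real n)) \<longlonglongrightarrow> 0 + (\<Sum>k\<in>K. a k * sqrt (measure \<mu> (Q k)))"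
      by (rule tendsto_add)
    then show ?case by (simp add: diff_divide_distrib W_def)
  qed
qed

section \<open>Coupling samples with close densities\<close>

lemma capacity_limit_coupling:
  assumes \<beta>: "1 < \<beta>" and "prob_space P"
    and \<phi>[measurable]: "\<phi> \<in> borel_measurable P" and \<psi>[measurable]: "\<psi> \<in> borel_measurable P"
    and bd: "AE \<omega> in P. \<phi> \<omega> \<in> cball 0 R" "AE \<omega> in P. \<psi> \<omega> \<in> cball 0 R"
    and lim: "capacity_limit \<beta> (distr P borel \<psi>) b"
    and e: "2 * edge_const \<beta> R * sqrt (2 * measure P {\<omega>\<in>space P. \<phi> \<omega> \<noteq> \<psi> \<omega>}) < e"
  shows "AE x in iid (distr P borel \<phi>).
    \<forall>\<^sub>F n in sequentially. \<bar>slot_capacity \<beta> (x ` {..<n}) / sqrt (real n) - b\<bar> < e"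
proof (subst AE_iid_distr_iff[OF assms(2) \<phi> pred_capacity_eventually])
  define D where "D = {\<omega>\<in>space P. \<phi> \<omega> \<noteq> \<psi> \<omega>}"
  have D: "D \<in> sets P" unfolding D_def by measurable
  have "AE \<omega> in P. \<omega> \<in> space P \<and> \<phi> \<omega> \<in> cball 0 R \<and> \<psi> \<omega> \<in> cball 0 R"
    using bd by auto
  then have A1: "AE \<omega> in iid P. \<forall>i. \<omega> i \<in> space P \<and> \<phi> (\<omega> i) \<in> cball 0 R \<and> \<psi> (\<omega> i) \<in> cball 0 R"
    by (rule AE_iid[OF assms(2)])
  have A2: "AE \<omega> in iid P. (\<lambda>n. real (card {i. i < n \<and> \<omega> i \<in> D}) / real n) \<longlonglongrightarrow> measure P D"
    by (rule frequency[OF assms(2) D])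
  have A3: "AE \<omega> in iid P. (\<lambda>n. slot_capacity \<beta> ((\<lambda>i. \<psi> (\<omega> i)) ` {..<n}) / sqrt (real n)) \<longlonglongrightarrow> b"
    using lim unfolding capacity_limit_def AE_iid_distr_iff[OF assms(2) \<psi> pred_capacity_tendsto'] .
  show "AE \<omega> in iid P. \<forall>\<^sub>F n in sequentially.
      \<bar>slot_capacity \<beta> ((\<lambda>i. \<phi> (\<omega> i)) ` {..<n}) / sqrt (real n) - b\<bar> < e"
    using A1 A2 A3
  proof eventually_elim
    case (elim \<omega>)
    define C where "C = edge_const \<beta> R"
    define d where "d n = card {i. i < n \<and> \<omega> i \<in> D}" for n
    define X where "X n = (\<lambda>i. \<phi> (\<omega> i)) ` {..<n}" for n
    define Y where "Y n = (\<lambda>i. \<psi> (\<omega> i)) ` {..<n}" for n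
    have XY: "\<bar>slot_capacity \<beta> (X n) - slot_capacity \<beta> (Y n)\<bar> \<le> 2 * C * sqrt (2 * real (d n))" for n
    proof -
      \<comment> \<open>The points on which the two samples agree form a common subset. Passing from
        \<open>X n\<close> to \<open>Y n\<close> through \<open>Z\<close> uses the deletion bound
        twice, which explains the factor 2.\<close>
      define Z where "Z = (\<lambda>i. \<phi> (\<omega> i)) ` {i. i < n \<and> \<omega> i \<notin> D}"
      have Z': "Z = (\<lambda>i. \<psi> (\<omega> i)) ` {i. i < n \<and> \<omega> i \<notin> D}"
        unfolding Z_def by (rule image_cong) (use elim(1) in \<open>auto simp: D_def\<close>)
      have fin: "finite {i. i < n \<and> \<omega> i \<in> D}" by simp
      have "card (X n - Z) \<le> card ((\<lambda>i. \<phi> (\<omega> i)) ` {i. i < n \<and> \<omega> i \<in> D})"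
        by (rule card_mono) (auto simp: X_def Z_def)
      then have "card (X n - Z) \<le> d n" unfolding d_def using card_image_le[OF fin] le_trans by blast
      then have 1: "\<bar>slot_capacity \<beta> (X n) - slot_capacity \<beta> Z\<bar> \<le> C * sqrt (2 * real (d n))"
        unfolding C_def using elim(1) by (intro slot_capacity_diff_le[OF \<beta>]) (auto simp: X_def Z_def)
      have "card (Y n - Z) \<le> card ((\<lambda>i. \<psi> (\<omega> i)) ` {i. i < n \<and> \<omega> i \<in> D})"
        by (rule card_mono) (auto simp: Y_def Z')
      then have "card (Y n - Z) \<le> d n" unfolding d_def using card_image_le[OF fin] le_trans by blast
      then have 2: "\<bar>slot_capacity \<beta> (Y n) - slot_capacity \<beta> Z\<bar> \<le> C * sqrt (2 * real (d n))"
        unfolding C_def using elim(1) by (intro slot_capacity_diff_le[OF \<beta>]) (auto simp: Y_def Z')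
      from 1 2 show ?thesis by linarith
    qed
    define s where "s n = 2 * C * sqrt (2 * (real (d n) / real n)) + \<bar>slot_capacity \<beta> (Y n) / sqrt (real n) - b\<bar>" for n
    have "s \<longlonglongrightarrow> 2 * C * sqrt (2 * measure P D) + \<bar>b - b\<bar>"
      unfolding s_def d_def Y_def using elim(2,3)
      by (intro tendsto_add tendsto_mult tendsto_const tendsto_real_sqrt tendsto_rabs tendsto_diff) auto
    then have "\<forall>\<^sub>F n in sequentially. s n < e"
      by (rule order_tendstoD(2)) (use e in \<open>simp add: C_def D_def\<close>)
    then show ?case
    proof eventually_elim
      case (elim n)
      have "\<bar>slot_capacity \<beta> (X n) / sqrt (real n) - slot_capacity \<beta> (Y n) / sqrt (real n)\<bar>
          \<le> 2 * C * sqrt (2 * real (d n)) / sqrt (real n)"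
        using XY[of n] by (simp add: diff_divide_distrib[symmetric] abs_divide divide_right_mono)
      also have "\<dots> = 2 * C * sqrt (2 * (real (d n) / real n))"
        by (simp add: real_sqrt_divide real_sqrt_mult)
      finally show ?case using elim unfolding s_def X_def[symmetric] by linarith
    qed
  qed
qed

text \<open>
  The boolean tells whether the first sample lies in the common part \<open>min f g\<close>; otherwise the second
  sample is drawn independently from the normalized excess of \<open>g\<close> over it.
\<close>

lemma density_coupling:
  fixes f g :: "node \<Rightarrow> real"
  assumes [measurable]: "f \<in> borel_measurable borel" "g \<in> borel_measurable borel"
    and nonneg: "\<And>x. 0 \<le> f x" "\<And>x. 0 \<le> g x"
    and one: "(\<integral>\<^sup>+x. f x \<partial>lborel) = 1" "(\<integral>\<^sup>+x. g x \<partial>lborel) = 1"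
  obtains P :: "(node \<times> node \<times> bool) measure" and \<phi> \<psi> :: "node \<times> node \<times> bool \<Rightarrow> node"
  where "prob_space P" "\<phi> \<in> borel_measurable P" "\<psi> \<in> borel_measurable P"
    "distr P borel \<phi> = density lborel f" "distr P borel \<psi> = density lborel g"
    "emeasure P {\<omega>\<in>space P. \<phi> \<omega> \<noteq> \<psi> \<omega>} \<le> (\<integral>\<^sup>+x. \<bar>f x - g x\<bar> \<partial>lborel)"
proof -
  define m where "m x = min (f x) (g x)" for x
  have [measurable]: "m \<in> borel_measurable borel" unfolding m_def by measurable
  have m: "0 \<le> m x" "m x \<le> f x" "m x \<le> g x" for x using nonneg by (auto simp: m_def)
  have split: "(\<integral>\<^sup>+x. ennreal (m x) * F x \<partial>lborel) + (\<integral>\<^sup>+x. ennreal (k x - m x) * F x \<partial>lborel) = (\<integral>\<^sup>+x. ennreal (k x) * F x \<partial>lborel)"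
    if [measurable]: "F \<in> borel_measurable borel" "k \<in> borel_measurable borel" and "\<And>x. m x \<le> k x" for F k
  proof -
    have "ennreal (k x) = ennreal (m x) + ennreal (k x - m x)" for x
      using m(1)[of x] that(3)[of x] by (simp add: ennreal_plus[symmetric])
    then show ?thesis
      by (simp add: distrib_right nn_integral_add)
  qed
  define r where "r = (\<integral>\<^sup>+x. ennreal (f x - m x) \<partial>lborel)"
  define c where "c = (\<integral>\<^sup>+x. ennreal (m x) \<partial>lborel)"
  have cr: "c + r = 1" using split[of "\<lambda>_. 1" f] m one by (simp add: c_def r_def)
  have cg: "c + (\<integral>\<^sup>+x. ennreal (g x - m x) \<partial>lborel) = 1" using split[of "\<lambda>_. 1" g] m one by (simp add: c_def)
  have c_fin: "c \<noteq> \<top>" using cr by (metis ennreal_add_eq_top ennreal_one_neq_top)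
  \<comment> \<open>Both densities have mass 1, so their excesses over \<open>m\<close> have the
    same mass \<open>r\<close>. The part of \<open>f\<close> above \<open>m\<close> can therefore be
    exchanged for that of \<open>g\<close>.\<close>
  have rg: "(\<integral>\<^sup>+x. ennreal (g x - m x) \<partial>lborel) = r"
    using cr cg c_fin by (metis ennreal_add_left_cancel infinity_ennreal_def)
  have r_fin: "r \<noteq> \<top>" using cr by (metis ennreal_add_eq_top ennreal_one_neq_top)
  \<comment> \<open>For \<open>r = 0\<close> there is no excess to normalize, and
    \<open>density lborel g\<close> is a placeholder that keeps \<open>R0\<close> a probability
    measure.\<close>
  define R0 where "R0 = (if r = 0 then density lborel g else density lborel (\<lambda>x. ennreal (g x - m x) / r))"
  have [measurable_cong]: "sets R0 = sets borel" by (simp add: R0_def)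
  have R0: "prob_space R0"
  proof (rule prob_spaceI)
    have "emeasure R0 UNIV = 1"
    proof (cases "r = 0")
      case True then show ?thesis using one by (simp add: R0_def emeasure_density)
    next
      case False
      then have "emeasure R0 UNIV = (\<integral>\<^sup>+x. ennreal (g x - m x) \<partial>lborel) / r"
        by (simp add: R0_def emeasure_density nn_integral_divide)
      then show ?thesis using False r_fin by (simp add: rg less_top)
    qed
    then show "emeasure R0 (space R0) = 1" using sets_eq_imp_space_eq[of R0 borel] by (simp add: R0_def)
  qed
  interpret R0: prob_space R0 by (rule R0)
  have rR0: "r * emeasure R0 C = (\<integral>\<^sup>+x. ennreal (g x - m x) * indicator C x \<partial>lborel)" if [measurable]: "C \<in> sets borel" for C
  proof (cases "r = 0")
    case True
    then have "(\<integral>\<^sup>+x. ennreal (g x - m x) \<partial>lborel) = 0" using rg by simp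
    then have "AE x in lborel. ennreal (g x - m x) = 0" by (subst (asm) nn_integral_0_iff_AE) auto
    then have "(\<integral>\<^sup>+x. ennreal (g x - m x) * indicator C x \<partial>lborel) = (\<integral>\<^sup>+x. 0 \<partial>(lborel :: node measure))"
      by (intro nn_integral_cong_AE) auto
    then show ?thesis using True by simp
  next
    case False
    have "emeasure R0 C = (\<integral>\<^sup>+x. ennreal (g x - m x) * indicator C x / r \<partial>lborel)"
      using False by (simp add: R0_def emeasure_density ennreal_times_divide[symmetric] mult.commute ennreal_divide_times)
    also have "\<dots> = (\<integral>\<^sup>+x. ennreal (g x - m x) * indicator C x \<partial>lborel) / r"
      by (rule nn_integral_divide) measurable
    finally have "r * emeasure R0 C = r * ((\<integral>\<^sup>+x. ennreal (g x - m x) * indicator C x \<partial>lborel) / r)" by simp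
    then show ?thesis using False r_fin
      by (metis ennreal_mult_divide_eq ennreal_times_divide infinity_ennreal_def mult.commute)
  qed
  let ?B = "count_space (UNIV :: bool set)"
  interpret B: sigma_finite_measure ?B by (rule sigma_finite_measure_count_space_finite) simp
  interpret RB: pair_sigma_finite R0 ?B ..
  let ?L = "lborel \<Otimes>\<^sub>M (R0 \<Otimes>\<^sub>M ?B)"
  \<comment> \<open>The weights of the two boolean values add up to \<open>f x\<close>, so the first
    sample has density \<open>f\<close>, and the value false has total probability \<open>r\<close>.
    The component \<open>w\<close> has law \<open>R0\<close> independently of the rest.\<close>
  define d where "d = (\<lambda>(x, w :: node, b). if b then ennreal (m x) else ennreal (f x - m x))"
  have d[measurable]: "d \<in> borel_measurable ?L" unfolding d_def by measurable
  define P where "P = density ?L d"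
  have setsP[measurable_cong]: "sets P = sets ?L" by (simp add: P_def)
  have int: "integral\<^sup>N P F = (\<integral>\<^sup>+x. \<integral>\<^sup>+w. ennreal (m x) * F (x, w, True) + ennreal (f x - m x) * F (x, w, False) \<partial>R0 \<partial>lborel)"
    if [measurable]: "F \<in> borel_measurable ?L" for F
  proof -
    have "integral\<^sup>N P F = (\<integral>\<^sup>+z. d z * F z \<partial>?L)" unfolding P_def by (rule nn_integral_density) measurable
    also have "\<dots> = (\<integral>\<^sup>+x. \<integral>\<^sup>+y. d (x, y) * F (x, y) \<partial>(R0 \<Otimes>\<^sub>M ?B) \<partial>lborel)"
      by (rule RB.nn_integral_fst[symmetric]) measurable
    also have "\<dots> = (\<integral>\<^sup>+x. \<integral>\<^sup>+w. \<integral>\<^sup>+b. d (x, w, b) * F (x, w, b) \<partial>?B \<partial>R0 \<partial>lborel)"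
      by (intro nn_integral_cong B.nn_integral_fst[symmetric]) measurable
    also have "\<dots> = (\<integral>\<^sup>+x. \<integral>\<^sup>+w. ennreal (m x) * F (x, w, True) + ennreal (f x - m x) * F (x, w, False) \<partial>R0 \<partial>lborel)"
      by (simp add: nn_integral_count_space_finite UNIV_bool d_def add.commute)
    finally show ?thesis .
  qed
  define \<phi> where "\<phi> = (\<lambda>(x, w :: node, b :: bool). x :: node)"
  define \<psi> where "\<psi> = (\<lambda>(x, w, b). if b then x else w :: node)"
  have \<phi>[measurable]: "\<phi> \<in> borel_measurable ?L" unfolding \<phi>_def by measurable
  have \<psi>[measurable]: "\<psi> \<in> borel_measurable ?L" unfolding \<psi>_def by measurable
  have R01: "emeasure R0 (space R0) = 1" by (rule R0.emeasure_space_1)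
  have law\<phi>: "distr P borel \<phi> = density lborel f"
  proof (rule measure_eqI)
    fix C assume "C \<in> sets (distr P borel \<phi>)"
    then have C[measurable]: "C \<in> sets borel" by simp
    have "emeasure (distr P borel \<phi>) C = integral\<^sup>N (distr P borel \<phi>) (indicator C)" by simp
    also have "\<dots> = (\<integral>\<^sup>+z. indicator C (\<phi> z) \<partial>P)" by (rule nn_integral_distr) (simp_all add: P_def)
    also have "\<dots> = (\<integral>\<^sup>+x. \<integral>\<^sup>+w. ennreal (m x) * indicator C x + ennreal (f x - m x) * indicator C x \<partial>R0 \<partial>lborel)"
      by (subst int) (simp_all add: \<phi>_def)
    also have "\<dots> = (\<integral>\<^sup>+x. ennreal (m x) * indicator C x + ennreal (f x - m x) * indicator C x \<partial>lborel)"
      by (simp add: R01)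
    also have "\<dots> = (\<integral>\<^sup>+x. ennreal (f x) * indicator C x \<partial>lborel)"
      using split[of "indicator C" f] m by (simp add: nn_integral_add)
    finally show "emeasure (distr P borel \<phi>) C = emeasure (density lborel f) C"
      by (simp add: emeasure_density)
  qed simp
  have law\<psi>: "distr P borel \<psi> = density lborel g"
  proof (rule measure_eqI)
    fix C assume "C \<in> sets (distr P borel \<psi>)"
    then have C[measurable]: "C \<in> sets borel" by simp
    have "emeasure (distr P borel \<psi>) C = integral\<^sup>N (distr P borel \<psi>) (indicator C)" by simp
    also have "\<dots> = (\<integral>\<^sup>+z. indicator C (\<psi> z) \<partial>P)" by (rule nn_integral_distr) (simp_all add: P_def)
    also have "\<dots> = (\<integral>\<^sup>+x. \<integral>\<^sup>+w. ennreal (m x) * indicator C x + ennreal (f x - m x) * indicator C w \<partial>R0 \<partial>lborel)"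
      by (subst int) (simp_all add: \<psi>_def)
    also have "\<dots> = (\<integral>\<^sup>+x. ennreal (m x) * indicator C x + ennreal (f x - m x) * emeasure R0 C \<partial>lborel)"
      by (intro nn_integral_cong) (simp add: nn_integral_add nn_integral_cmult R01)
    also have "\<dots> = (\<integral>\<^sup>+x. ennreal (m x) * indicator C x \<partial>lborel) + r * emeasure R0 C"
      by (simp add: nn_integral_add nn_integral_multc r_def)
    also have "\<dots> = (\<integral>\<^sup>+x. ennreal (g x) * indicator C x \<partial>lborel)"
      using split[of "indicator C" g] m by (simp add: rR0)
    finally show "emeasure (distr P borel \<psi>) C = emeasure (density lborel g) C"
      by (simp add: emeasure_density)
  qed simp
  have probP: "prob_space P"
  proof (rule prob_spaceI)
    have "emeasure P (space P) = integral\<^sup>N P (\<lambda>_. 1)" by simp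
    also have "\<dots> = (\<integral>\<^sup>+x. ennreal (m x) + ennreal (f x - m x) \<partial>lborel)"
      by (subst int) (simp_all add: R01)
    also have "\<dots> = 1" using cr by (simp add: nn_integral_add c_def r_def)
    finally show "emeasure P (space P) = 1" .
  qed
  have "emeasure P {\<omega>\<in>space P. \<phi> \<omega> \<noteq> \<psi> \<omega>} \<le> emeasure P {\<omega>\<in>space P. \<not> snd (snd \<omega>)}"
    by (rule emeasure_mono) (auto simp: \<phi>_def \<psi>_def)
  also have "\<dots> = (\<integral>\<^sup>+z. (if snd (snd z) then 0 else 1) \<partial>P)"
  proof -
    have "emeasure P {\<omega>\<in>space P. \<not> snd (snd \<omega>)} = (\<integral>\<^sup>+z. indicator {\<omega>\<in>space P. \<not> snd (snd \<omega>)} z \<partial>P)"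
      by (rule nn_integral_indicator[symmetric]) measurable
    also have "\<dots> = (\<integral>\<^sup>+z. (if snd (snd z) then 0 else 1) \<partial>P)"
      by (rule nn_integral_cong) (auto simp: indicator_def)
    finally show ?thesis .
  qed
  also have "\<dots> = r"
    by (subst int) (simp_all add: R01 r_def)
  also have "r \<le> (\<integral>\<^sup>+x. \<bar>f x - g x\<bar> \<partial>lborel)"
    unfolding r_def by (intro nn_integral_mono ennreal_leI) (auto simp: m_def)
  finally show thesis
    using that[OF probP _ _ law\<phi> law\<psi>] by (simp add: P_def)
qed

text \<open>The \<open>L^1\<close> distance bounds the probability that the coupled samples
  disagree, so it moves the normalized capacity by at most the order of its square root.\<close>

lemma capacity_density_perturb:
  fixes f g :: "node \<Rightarrow> real"
  assumes \<beta>: "1 < \<beta>"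
    and meas[measurable]: "f \<in> borel_measurable borel" "g \<in> borel_measurable borel"
    and nonneg: "\<And>x. 0 \<le> f x" "\<And>x. 0 \<le> g x"
    and one: "(\<integral>\<^sup>+x. f x \<partial>lborel) = 1" "(\<integral>\<^sup>+x. g x \<partial>lborel) = 1"
    and supp: "AE x in lborel. x \<notin> cball 0 R \<longrightarrow> f x = 0" "AE x in lborel. x \<notin> cball 0 R \<longrightarrow> g x = 0"
    and diff: "(\<integral>\<^sup>+x. \<bar>f x - g x\<bar> \<partial>lborel) \<le> ennreal \<epsilon>" and "0 \<le> \<epsilon>"
    and lim: "capacity_limit \<beta> (density lborel g) b"
    and e: "2 * edge_const \<beta> R * sqrt (2 * \<epsilon>) < e"
  shows "AE x in iid (density lborel f).
    \<forall>\<^sub>F n in sequentially. \<bar>slot_capacity \<beta> (x ` {..<n}) / sqrt (real n) - b\<bar> < e"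
proof -
  obtain P :: "(node \<times> node \<times> bool) measure" and \<phi> \<psi> :: "node \<times> node \<times> bool \<Rightarrow> node"
  where P: "prob_space P" "\<phi> \<in> borel_measurable P" "\<psi> \<in> borel_measurable P"
    "distr P borel \<phi> = density lborel f" "distr P borel \<psi> = density lborel g"
    "emeasure P {\<omega>\<in>space P. \<phi> \<omega> \<noteq> \<psi> \<omega>} \<le> (\<integral>\<^sup>+x. \<bar>f x - g x\<bar> \<partial>lborel)"
    by (rule density_coupling[OF meas nonneg one])
  interpret P: prob_space P by (rule P)
  have AE: "AE x in density lborel k. x \<in> cball 0 R"
    if [measurable]: "k \<in> borel_measurable borel" and "AE x in lborel. x \<notin> cball 0 R \<longrightarrow> k x = 0" for k :: "node \<Rightarrow> real"
    using that(2) by (subst AE_density) auto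
  have "AE \<omega> in P. \<phi> \<omega> \<in> cball 0 R"
    by (rule AE_distrD[OF P(2)], unfold P(4)) (rule AE[OF meas(1) supp(1)])
  moreover have "AE \<omega> in P. \<psi> \<omega> \<in> cball 0 R"
    by (rule AE_distrD[OF P(3)], unfold P(5)) (rule AE[OF meas(2) supp(2)])
  moreover have "measure P {\<omega>\<in>space P. \<phi> \<omega> \<noteq> \<psi> \<omega>} \<le> \<epsilon>"
    using order_trans[OF P(6) diff] \<open>0 \<le> \<epsilon>\<close> by (simp add: P.emeasure_eq_measure)
  then have "2 * edge_const \<beta> R * sqrt (2 * measure P {\<omega>\<in>space P. \<phi> \<omega> \<noteq> \<psi> \<omega>}) \<le> 2 * edge_const \<beta> R * sqrt (2 * \<epsilon>)"
    using edge_const_nonneg[OF \<beta>] by (intro mult_left_mono) auto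
  with e have "2 * edge_const \<beta> R * sqrt (2 * measure P {\<omega>\<in>space P. \<phi> \<omega> \<noteq> \<psi> \<omega>}) < e" by linarith
  ultimately have "AE x in iid (distr P borel \<phi>).
      \<forall>\<^sub>F n in sequentially. \<bar>slot_capacity \<beta> (x ` {..<n}) / sqrt (real n) - b\<bar> < e"
    using lim unfolding P(5)[symmetric] by (intro capacity_limit_coupling[OF \<beta> P(1-3)])
  then show ?thesis unfolding P(4) .
qed

section \<open>Step densities\<close>

lemma emeasure_square:
  fixes a :: node
  assumes "0 < h"
  shows "emeasure lborel (box a (a + h *\<^sub>R 1)) = ennreal (h\<^sup>2)"
proof -
  have "(1::node) \<bullet> b = 1" if "b \<in> Basis" for b using that by (auto simp: Basis_vec_def inner_axis)
  then show ?thesis using assms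
    by (simp add: emeasure_lborel_box_eq inner_add_left prod_ennreal[symmetric] del: prod_ennreal)
qed

lemma sum_indicator_disjoint:
  fixes \<alpha> :: "'k \<Rightarrow> real"
  assumes "finite K" "disjoint_family_on Q K" "k \<in> K" "x \<in> Q k"
  shows "(\<Sum>k\<in>K. \<alpha> k * indicator (Q k) x) = \<alpha> k"
proof -
  have "(\<Sum>l\<in>K. \<alpha> l * indicator (Q l) x) = (\<Sum>l\<in>{k}. \<alpha> l * indicator (Q l) x)"
    by (rule sum.mono_neutral_right) (use assms in \<open>auto simp: disjoint_family_on_def indicator_def\<close>)
  then show ?thesis using assms(4) by simp
qed

lemma sum_indicator_outside:
  fixes \<alpha> :: "'k \<Rightarrow> real"
  assumes "x \<notin> (\<Union>k\<in>K. Q k)"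
  shows "(\<Sum>k\<in>K. \<alpha> k * indicator (Q k) x) = 0"
  using assms by (intro sum.neutral) (auto simp: indicator_def)

lemma capacity_limit_step:
  fixes c :: "'k \<Rightarrow> node" and \<alpha> :: "'k \<Rightarrow> real"
  defines "Q h k \<equiv> box (c k) (c k + h *\<^sub>R 1)"
  assumes \<beta>: "1 < \<beta>" and lim: "capacity_limit \<beta> (uniform_measure lborel (cbox 0 1)) A"
    and K: "finite K" "disjoint_family_on (Q h) K" "\<And>k. k \<in> K \<Longrightarrow> Q h k \<subseteq> cball 0 R"
    and h: "0 < h" and \<alpha>: "\<And>k. k \<in> K \<Longrightarrow> 0 \<le> \<alpha> k" and one: "(\<Sum>k\<in>K. \<alpha> k * h\<^sup>2) = 1"
  defines "g x \<equiv> (\<Sum>k\<in>K. \<alpha> k * indicator (Q h k) x)"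
  shows "capacity_limit \<beta> (density lborel g) (A * (\<integral>x. sqrt (g x) \<partial>lborel))"
proof -
  let ?Q = "Q h"
  let ?\<mu> = "density lborel g"
  have Qm[measurable]: "?Q k \<in> sets borel" for k by (simp add: Q_def)
  have g_in: "g x = \<alpha> k" if "k \<in> K" "x \<in> ?Q k" for x k
    unfolding g_def by (rule sum_indicator_disjoint[OF K(1,2) that])
  have g_out: "g x = 0" if "x \<notin> (\<Union>k\<in>K. ?Q k)" for x
    unfolding g_def by (rule sum_indicator_outside[OF that])
  have gm[measurable]: "g \<in> borel_measurable borel" unfolding g_def by measurable
  have eQ: "emeasure lborel (?Q k) = ennreal (h\<^sup>2)" for k unfolding Q_def by (rule emeasure_square[OF h])
  have mQ: "measure lborel (?Q k) = h\<^sup>2" for k using eQ[of k] by (simp add: measure_def)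
  have cell: "emeasure ?\<mu> (?Q k \<inter> D) = ennreal (\<alpha> k) * emeasure lborel (?Q k \<inter> D)"
    if k: "k \<in> K" and [measurable]: "D \<in> sets borel" for k D
  proof -
    have "emeasure ?\<mu> (?Q k \<inter> D) = (\<integral>\<^sup>+x. ennreal (g x) * indicator (?Q k \<inter> D) x \<partial>lborel)"
      by (rule emeasure_density) auto
    also have "\<dots> = (\<integral>\<^sup>+x. ennreal (\<alpha> k) * indicator (?Q k \<inter> D) x \<partial>lborel)"
      by (rule nn_integral_cong) (auto simp: indicator_def g_in[OF k])
    finally show ?thesis by (simp add: nn_integral_cmult_indicator)
  qed
  have cellm: "emeasure ?\<mu> (?Q k) = ennreal (\<alpha> k * h\<^sup>2)" if "k \<in> K" for k
    using cell[OF that, of UNIV] \<alpha>[OF that] by (simp add: eQ ennreal_mult)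
  have full: "emeasure ?\<mu> (\<Union>k\<in>K. ?Q k) = 1"
  proof -
    have "emeasure ?\<mu> (\<Union>k\<in>K. ?Q k) = (\<Sum>k\<in>K. emeasure ?\<mu> (?Q k))"
      by (rule sum_emeasure[symmetric]) (use K in auto)
    also have "\<dots> = (\<Sum>k\<in>K. ennreal (\<alpha> k * h\<^sup>2))" by (rule sum.cong) (auto simp: cellm)
    also have "\<dots> = ennreal (\<Sum>k\<in>K. \<alpha> k * h\<^sup>2)" by (rule sum_ennreal) (auto simp: \<alpha>)
    finally show ?thesis by (simp add: one)
  qed
  have Um: "(\<Union>k\<in>K. ?Q k) \<in> sets borel" using K(1) by (intro sets.finite_UN) auto
  then have Cm: "- (\<Union>k\<in>K. ?Q k) \<in> sets borel" by (rule borel_comp)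
  have out: "emeasure ?\<mu> (- (\<Union>k\<in>K. ?Q k)) = 0"
  proof -
    have "emeasure ?\<mu> (- (\<Union>k\<in>K. ?Q k)) = (\<integral>\<^sup>+x. ennreal (g x) * indicator (- (\<Union>k\<in>K. ?Q k)) x \<partial>lborel)"
      by (rule emeasure_density) (use Cm in \<open>simp_all only: sets_lborel measurable_lborel1, measurable\<close>)
    also have "\<dots> = (\<integral>\<^sup>+x. 0 \<partial>(lborel :: node measure))"
    proof (rule nn_integral_cong)
      fix x
      show "ennreal (g x) * indicator (- (\<Union>k\<in>K. ?Q k)) x = 0"
      proof (cases "x \<in> (\<Union>k\<in>K. ?Q k)")
        case False
        then have "g x = 0" by (rule g_out)
        then show ?thesis by simp
      qed simp
    qed
    finally show ?thesis by simp
  qed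
  have prob: "prob_space ?\<mu>"
  proof (rule prob_spaceI)
    have "emeasure ?\<mu> ((\<Union>k\<in>K. ?Q k) \<union> - (\<Union>k\<in>K. ?Q k)) = emeasure ?\<mu> (\<Union>k\<in>K. ?Q k) + emeasure ?\<mu> (- (\<Union>k\<in>K. ?Q k))"
      by (rule plus_emeasure[symmetric]) (use Um Cm in \<open>simp_all only: sets_density sets_lborel Compl_disjoint\<close>)
    then show "emeasure ?\<mu> (space ?\<mu>) = 1"
      unfolding Compl_partition full out by simp
  qed
  interpret prob_space ?\<mu> by (rule prob)
  have cellp: "measure ?\<mu> (?Q k) = \<alpha> k * h\<^sup>2" if "k \<in> K" for k
    using cellm[OF that] \<alpha>[OF that] by (simp add: measure_def)
  have "capacity_limit \<beta> ?\<mu> (\<Sum>k\<in>K. (h * A) * sqrt (measure ?\<mu> (?Q k)))"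
  proof (rule capacity_limit_cells[OF \<beta> prob _ K(1,2) _ K(3)])
    fix k assume k: "k \<in> K" and pos: "0 < measure ?\<mu> (?Q k)"
    \<comment> \<open>Positive mass of the cell forces a positive value of the density on it, so
      this constant cancels and the conditional law is uniform.\<close>
    have a0: "ennreal (\<alpha> k) \<noteq> 0" "ennreal (\<alpha> k) \<noteq> \<infinity>" using pos cellp[OF k] \<alpha>[OF k] by (auto simp: zero_less_mult_iff)
    have "uniform_measure ?\<mu> (?Q k) = uniform_measure lborel (?Q k)"
    proof (rule measure_eqI)
      fix D assume "D \<in> sets (uniform_measure ?\<mu> (?Q k))"
      then have D: "D \<in> sets borel" by simp
      show "emeasure (uniform_measure ?\<mu> (?Q k)) D = emeasure (uniform_measure lborel (?Q k)) D"
        using divide_mult_eq[OF a0] cell[OF k D] cell[OF k, of UNIV] D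
        by (simp add: mult.commute[of "ennreal (\<alpha> k)"])
    qed simp
    then show "capacity_limit \<beta> (uniform_measure ?\<mu> (?Q k)) (h * A)"
      unfolding Q_def using capacity_limit_box[OF lim h] by simp
  qed (use full in \<open>auto simp: Q_def measure_def\<close>)
  \<comment> \<open>Of the two factors \<open>h\<close>, one comes from scaling lengths and the
    other is the square root of the cell area.\<close>
  also have "(\<Sum>k\<in>K. (h * A) * sqrt (measure ?\<mu> (?Q k))) = A * (\<Sum>k\<in>K. sqrt (\<alpha> k) * h\<^sup>2)"
    unfolding sum_distrib_left
    by (rule sum.cong) (use h in \<open>auto simp: cellp real_sqrt_mult power2_eq_square\<close>)
  also have "(\<Sum>k\<in>K. sqrt (\<alpha> k) * h\<^sup>2) = (\<integral>x. sqrt (g x) \<partial>lborel)"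
  proof -
    have "sqrt (g x) = (\<Sum>k\<in>K. sqrt (\<alpha> k) * indicator (?Q k) x)" for x
    proof (cases "x \<in> (\<Union>k\<in>K. ?Q k)")
      case True
      then obtain k where k: "k \<in> K" "x \<in> ?Q k" by blast
      then show ?thesis using g_in[OF k] sum_indicator_disjoint[OF K(1,2) k, of "\<lambda>k. sqrt (\<alpha> k)"] by simp
    next
      case False
      then show ?thesis using g_out[OF False] sum_indicator_outside[OF False, of "\<lambda>k. sqrt (\<alpha> k)"] by simp
    qed
    moreover have "(\<integral>x. (\<Sum>k\<in>K. sqrt (\<alpha> k) * indicator (?Q k) x) \<partial>lborel) = (\<Sum>k\<in>K. \<integral>x. sqrt (\<alpha> k) * indicator (?Q k) x \<partial>lborel)"
      by (rule Bochner_Integration.integral_sum) (auto simp: eQ less_top[symmetric])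
    ultimately show ?thesis by (simp add: mQ)
  qed
  finally show ?thesis .
qed

section \<open>Approximation of densities by step functions\<close>

definition cell_corner :: "nat \<Rightarrow> int \<times> int \<Rightarrow> node" where
  "cell_corner N k = (1 / real N) *\<^sub>R vector [real_of_int (fst k), real_of_int (snd k)]"

definition cell :: "nat \<Rightarrow> int \<times> int \<Rightarrow> node set" where
  "cell N k = box (cell_corner N k) (cell_corner N k + (1 / real N) *\<^sub>R 1)"

text \<open>Half-open ranges, because an index \<open>k\<close> stands for the interval from
  \<open>k\<close> to \<open>k + 1\<close> in units of \<open>1 / N\<close>.\<close>

definition cell_index :: "nat \<Rightarrow> nat \<Rightarrow> (int \<times> int) set" where
  "cell_index L N = {- int (L * N)..<int (L * N)} \<times> {- int (L * N)..<int (L * N)}"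

abbreviation square :: "nat \<Rightarrow> node set" where
  "square L \<equiv> cbox (- real L *\<^sub>R 1) (real L *\<^sub>R 1)"

lemma mem_cell:
  assumes "0 < N"
  shows "x \<in> cell N k \<longleftrightarrow>
    real_of_int (fst k) < real N * x $ 1 \<and> real N * x $ 1 < real_of_int (fst k) + 1 \<and>
    real_of_int (snd k) < real N * x $ 2 \<and> real N * x $ 2 < real_of_int (snd k) + 1"
  using assms by (auto simp: cell_def cell_corner_def mem_box_cart forall_2 vector_2 field_simps)

lemma disjoint_cells:
  assumes "0 < N" shows "disjoint_family_on (cell N) K"
  unfolding disjoint_family_on_def
proof (intro ballI impI)
  fix k l :: "int \<times> int" assume "k \<noteq> l"
  have "k = l" if "x \<in> cell N k" "x \<in> cell N l" for x
  proof (rule prod_eqI)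
    show "fst k = fst l" using that unfolding mem_cell[OF assms] by linarith
    show "snd k = snd l" using that unfolding mem_cell[OF assms] by linarith
  qed
  with \<open>k \<noteq> l\<close> show "cell N k \<inter> cell N l = {}" by auto
qed

lemma cell_subset_square:
  assumes "0 < N" "k \<in> cell_index L N"
  shows "cell N k \<subseteq> square L" "cell_corner N k \<in> square L"
proof -
  have "- int (L * N) \<le> fst k" "fst k + 1 \<le> int (L * N)" "- int (L * N) \<le> snd k" "snd k + 1 \<le> int (L * N)"
    using assms(2) by (auto simp: cell_index_def)
  then have "real_of_int (- int (L * N)) \<le> real_of_int (fst k)" "real_of_int (fst k + 1) \<le> real_of_int (int (L * N))"
    "real_of_int (- int (L * N)) \<le> real_of_int (snd k)" "real_of_int (snd k + 1) \<le> real_of_int (int (L * N))"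
    by (simp_all only: of_int_le_iff)
  then have k: "- (real L * real N) \<le> real_of_int (fst k)" "real_of_int (fst k) + 1 \<le> real L * real N"
    "- (real L * real N) \<le> real_of_int (snd k)" "real_of_int (snd k) + 1 \<le> real L * real N"
    by simp_all
  have *: "- real L \<le> y \<and> y \<le> real L" if "- (real L * real N) \<le> real N * y" "real N * y \<le> real L * real N" for y
  proof -
    have "real N * - real L \<le> real N * y" "real N * y \<le> real N * real L"
      using that by (simp_all add: mult.commute)
    then show ?thesis using assms(1) by (simp only: mult_le_cancel_left_pos of_nat_0_less_iff)
  qed
  have "real N * cell_corner N k $ 1 = real_of_int (fst k)" "real N * cell_corner N k $ 2 = real_of_int (snd k)"
    using assms(1) by (simp_all add: cell_corner_def vector_2)
  then show "cell_corner N k \<in> square L"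
    using k *[of "cell_corner N k $ 1"] *[of "cell_corner N k $ 2"] by (simp add: mem_box_cart forall_2)
  show "cell N k \<subseteq> square L"
  proof
    fix x assume x: "x \<in> cell N k"
    then have "- (real L * real N) \<le> real N * x $ 1" "real N * x $ 1 \<le> real L * real N"
      "- (real L * real N) \<le> real N * x $ 2" "real N * x $ 2 \<le> real L * real N"
      using k unfolding mem_cell[OF assms(1)] by linarith+
    then show "x \<in> square L"
      using *[of "x $ 1"] *[of "x $ 2"] by (simp add: mem_box_cart forall_2)
  qed
qed

lemma AE_off_grid:
  assumes "0 < N"
  shows "AE x in (lborel :: node measure). \<forall>i. \<forall>z :: int. real N * x $ i \<noteq> real_of_int z"
proof -
  have "AE x in (lborel :: node measure). real N * x $ i \<noteq> real_of_int z" for i and z :: int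
  proof -
    have "negligible {x :: node. axis i (real N) \<bullet> x = real_of_int z}"
      by (rule negligible_hyperplane) (use assms in \<open>auto simp: axis_eq_0_iff\<close>)
    then have "{x :: node. real N * x $ i = real_of_int z} \<in> null_sets lebesgue"
      by (simp add: negligible_iff_null_sets inner_axis')
    then have "AE x in (lebesgue :: node measure). x \<notin> {x :: node. real N * x $ i = real_of_int z}" by (rule AE_not_in)
    then show ?thesis unfolding AE_completion_iff by simp
  qed
  then show ?thesis by (simp add: AE_all_countable)
qed

text \<open>Off the null set of grid lines, the scaled coordinates lie strictly between consecutive
  integers, as an open cell requires. The boundary of the square consists of grid segments too,
  which removes the value \<open>L * N\<close> from the range of the floors.\<close>

lemma AE_in_cell:
  assumes "0 < N"
  shows "AE x in lborel. x \<in> square L \<longrightarrow> (\<exists>k\<in>cell_index L N. x \<in> cell N k)"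
  using AE_off_grid[OF assms]
proof eventually_elim
  case (elim x)
  show ?case
  proof
    assume x: "x \<in> square L"
    have fl: "real_of_int \<lfloor>real N * x $ i\<rfloor> < real N * x $ i" "real N * x $ i < real_of_int \<lfloor>real N * x $ i\<rfloor> + 1" for i
      using elim[rule_format, of i "\<lfloor>real N * x $ i\<rfloor>"] by linarith+
    have range: "\<lfloor>real N * x $ i\<rfloor> \<in> {- int (L * N)..<int (L * N)}" for i
    proof -
      have "- real L \<le> x $ i" "x $ i \<le> real L" using x by (auto simp: mem_box_cart)
      then have "real N * - real L \<le> real N * x $ i" "real N * x $ i \<le> real N * real L"
        by (intro mult_left_mono; simp)+
      moreover have "real N * x $ i \<noteq> real N * real L"
        using elim[rule_format, of i "int (N * L)"] by simp
      ultimately have "real_of_int (- int (L * N)) \<le> real N * x $ i" "real N * x $ i < real_of_int (int (L * N))"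
        by (simp_all add: mult.commute)
      then show ?thesis by (simp add: le_floor_iff floor_less_iff)
    qed
    show "\<exists>k\<in>cell_index L N. x \<in> cell N k"
      by (rule bexI[of _ "(\<lfloor>real N * x $ 1\<rfloor>, \<lfloor>real N * x $ 2\<rfloor>)"])
        (use fl range in \<open>auto simp: mem_cell[OF assms] cell_index_def\<close>)
  qed
qed

text \<open>The \<open>l1\<close> norm bounds the distance: two coordinates, each off by at most
  \<open>1 / N\<close>.\<close>

lemma cell_diameter:
  assumes "0 < N" "x \<in> cell N k"
  shows "dist x (cell_corner N k) \<le> 2 / real N"
proof -
  have "\<bar>x $ i - cell_corner N k $ i\<bar> \<le> 1 / real N" for i
    using assms(2) unfolding cell_def mem_box_cart by (auto dest: spec[of _ i])
  then have "(\<Sum>i\<in>UNIV. \<bar>(x - cell_corner N k) $ i\<bar>) \<le> (\<Sum>i\<in>(UNIV :: 2 set). 1 / real N)"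
    by (intro sum_mono) simp
  with norm_le_l1_cart[of "x - cell_corner N k"] show ?thesis by (simp add: dist_norm)
qed

lemma emeasure_square_finite: "emeasure lborel (square L) < \<infinity>"
  by (rule emeasure_lborel_cbox_finite)

text \<open>Lebesgue measurability provides continuous functions converging to \<open>f\<close> off
  a negligible set, but without a dominating function. Truncating \<open>f\<close> at a height
  \<open>b\<close> costs little in \<open>L^1\<close> and makes the constant \<open>b\<close> on the
  bounded square a dominating function.\<close>

lemma continuous_L1_approx:
  fixes f :: "node \<Rightarrow> real"
  assumes f: "integrable lborel f" and nonneg: "\<And>x. 0 \<le> f x" and "0 < \<epsilon>"
  obtains q :: "node \<Rightarrow> real" where "continuous_on UNIV q" "\<And>x. 0 \<le> q x"
    "(\<integral>x. indicator (square L) x * \<bar>f x - q x\<bar> \<partial>lborel) < \<epsilon>"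
proof -
  let ?S = "square L"
  have [measurable]: "f \<in> borel_measurable borel" using borel_measurable_integrable[OF f] by simp
  have "(\<lambda>n. \<integral>x. \<bar>f x - min (f x) (real n)\<bar> \<partial>lborel) \<longlonglongrightarrow> (\<integral>x. 0 \<partial>(lborel :: node measure))"
  proof (rule integral_dominated_convergence[where w = f])
    show "AE x in lborel. (\<lambda>n. \<bar>f x - min (f x) (real n)\<bar>) \<longlonglongrightarrow> 0"
    proof (rule AE_I2)
      fix x
      obtain n0 :: nat where "f x \<le> real n0" using real_arch_simple by blast
      then have "\<forall>\<^sub>F n in sequentially. \<bar>f x - min (f x) (real n)\<bar> = 0"
        by (intro eventually_sequentiallyI[of n0]) auto
      then show "(\<lambda>n. \<bar>f x - min (f x) (real n)\<bar>) \<longlonglongrightarrow> 0" by (rule tendsto_eventually)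
    qed
  qed (use f nonneg in auto)
  then have "\<forall>\<^sub>F n in sequentially. (\<integral>x. \<bar>f x - min (f x) (real n)\<bar> \<partial>lborel) < \<epsilon> / 2"
    using assms(3) by (intro order_tendstoD(2)) auto
  then obtain b :: nat where b: "(\<integral>x. \<bar>f x - min (f x) (real b)\<bar> \<partial>lborel) < \<epsilon> / 2"
    by (auto simp: eventually_sequentially)
  let ?fb = "\<lambda>x. min (f x) (real b)"
  have "f \<in> borel_measurable lebesgue" by (rule measurable_completion) simp
  then have "f measurable_on UNIV" by (rule lebesgue_measurable_imp_measurable_on_real) simp
  then obtain Z g where Z: "negligible Z" "\<And>n. continuous_on UNIV (g n)"
    "\<And>x. x \<notin> Z \<Longrightarrow> (\<lambda>n. g n x) \<longlonglongrightarrow> f x"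
    unfolding measurable_on_def by auto
  \<comment> \<open>Clamping to values between 0 and \<open>b\<close> preserves continuity and gives
    the domination. The limit is not affected, since \<open>?fb\<close> has its values in the same
    range.\<close>
  define q where "q n x = max 0 (min (g n x) (real b))" for n x
  have clamp: "\<bar>min u v - max 0 (min w v)\<bar> \<le> v" if "0 \<le> u" "0 \<le> v" for u v w :: real
    using that by (simp add: abs_le_iff min_def max_def)
  have qc: "continuous_on UNIV (q n)" for n
    unfolding q_def by (intro continuous_intros Z(2))
  have [measurable]: "q n \<in> borel_measurable borel" for n
    using qc by (rule borel_measurable_continuous_onI)
  have "AE x in (lebesgue :: node measure). x \<notin> Z"
    by (rule AE_not_in) (use Z(1) in \<open>simp add: negligible_iff_null_sets\<close>)
  then have AEZ: "AE x in lborel. x \<notin> Z" unfolding AE_completion_iff .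
  have "(\<lambda>n. \<integral>x. indicator ?S x * \<bar>?fb x - q n x\<bar> \<partial>lborel) \<longlonglongrightarrow> (\<integral>x. 0 \<partial>(lborel :: node measure))"
  proof (rule integral_dominated_convergence[where w = "\<lambda>x. indicator ?S x * real b"])
    show "AE x in lborel. (\<lambda>n. indicator ?S x * \<bar>?fb x - q n x\<bar>) \<longlonglongrightarrow> 0"
      using AEZ
    proof eventually_elim
      case (elim x)
      have "(\<lambda>n. indicator ?S x * \<bar>?fb x - q n x\<bar>) \<longlonglongrightarrow> indicator ?S x * \<bar>?fb x - max 0 (min (f x) (real b))\<bar>"
        unfolding q_def by (intro tendsto_intros Z(3)[OF elim])
      then show ?case using nonneg[of x] by simp
    qed
    show "integrable lborel (\<lambda>x. indicator ?S x * real b)"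
      by (intro integrable_mult_left integrable_real_indicator emeasure_square_finite) auto
    show "AE x in lborel. norm (indicator ?S x * \<bar>?fb x - q n x\<bar>) \<le> indicator ?S x * real b" for n
      using nonneg by (intro AE_I2) (simp add: indicator_def q_def clamp)
  qed auto
  then have "\<forall>\<^sub>F n in sequentially. (\<integral>x. indicator ?S x * \<bar>?fb x - q n x\<bar> \<partial>lborel) < \<epsilon> / 2"
    using assms(3) by (intro order_tendstoD(2)) auto
  then obtain n where n: "(\<integral>x. indicator ?S x * \<bar>?fb x - q n x\<bar> \<partial>lborel) < \<epsilon> / 2"
    by (auto simp: eventually_sequentially)
  have i1: "integrable lborel (\<lambda>x. \<bar>f x - ?fb x\<bar>)"
    by (rule Bochner_Integration.integrable_bound[OF f]) (use nonneg in auto)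
  have i2: "integrable lborel (\<lambda>x. indicator ?S x * \<bar>?fb x - q n x\<bar>)"
  proof (rule Bochner_Integration.integrable_bound)
    show "integrable lborel (\<lambda>x. indicator ?S x * real b)"
      by (intro integrable_mult_left integrable_real_indicator emeasure_square_finite) auto
    show "(\<lambda>x. indicator ?S x * \<bar>?fb x - q n x\<bar>) \<in> borel_measurable lborel" by measurable
    show "AE x in lborel. norm (indicator ?S x * \<bar>?fb x - q n x\<bar>) \<le> norm (indicator ?S x * real b)"
      using nonneg by (intro AE_I2) (simp add: indicator_def q_def clamp)
  qed
  have "(\<integral>x. indicator ?S x * \<bar>f x - q n x\<bar> \<partial>lborel)
      \<le> (\<integral>x. \<bar>f x - ?fb x\<bar> + indicator ?S x * \<bar>?fb x - q n x\<bar> \<partial>lborel)"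
  proof (rule integral_mono_AE')
    show "integrable lborel (\<lambda>x. \<bar>f x - ?fb x\<bar> + indicator ?S x * \<bar>?fb x - q n x\<bar>)" using i1 i2 by simp
  qed (auto simp: indicator_def)
  also have "\<dots> = (\<integral>x. \<bar>f x - ?fb x\<bar> \<partial>lborel) + (\<integral>x. indicator ?S x * \<bar>?fb x - q n x\<bar> \<partial>lborel)"
    using i1 i2 by simp
  finally have "(\<integral>x. indicator ?S x * \<bar>f x - q n x\<bar> \<partial>lborel) < \<epsilon>" using b n by linarith
  then show thesis using that[OF qc[of n]] by (simp add: q_def)
qed

lemma square_subset_cball: "square L \<subseteq> cball 0 (2 * real L)"
proof
  fix x assume "x \<in> square L"
  then have "(\<Sum>i\<in>UNIV. \<bar>x $ i\<bar>) \<le> (\<Sum>i\<in>(UNIV :: 2 set). real L)"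
    by (intro sum_mono) (auto simp: mem_box_cart abs_le_iff minus_le_iff)
  with norm_le_l1_cart[of x] show "x \<in> cball 0 (2 * real L)" by simp
qed

text \<open>The values of \<open>f\<close> at the cell corners carry no information, as the corners
  form a null set. They are read off a continuous approximation instead, whose uniform continuity on
  the compact square controls the error on every cell.\<close>

lemma step_density_approx:
  fixes f :: "node \<Rightarrow> real"
  assumes \<beta>: "1 < \<beta>" and lim: "capacity_limit \<beta> (uniform_measure lborel (cbox 0 1)) A"
    and meas[measurable]: "f \<in> borel_measurable borel" and nonneg: "\<And>x. 0 \<le> f x"
    and one: "(\<integral>\<^sup>+x. f x \<partial>lborel) = 1" and supp: "AE x in lborel. x \<notin> square L \<longrightarrow> f x = 0"
    and \<epsilon>: "0 < \<epsilon>"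
  obtains g :: "node \<Rightarrow> real" where "g \<in> borel_measurable borel" "\<And>x. 0 \<le> g x" "(\<integral>\<^sup>+x. g x \<partial>lborel) = 1"
    "\<And>x. x \<notin> square L \<Longrightarrow> g x = 0" "integrable lborel f" "integrable lborel g"
    "(\<integral>x. \<bar>f x - g x\<bar> \<partial>lborel) \<le> \<epsilon>"
    "capacity_limit \<beta> (density lborel g) (A * (\<integral>x. sqrt (g x) \<partial>lborel))"
proof -
  let ?S = "square L"
  define V where "V = measure lborel ?S"
  have V: "0 \<le> V" by (simp add: V_def)
  \<comment> \<open>The bound \<open>1 / 2\<close> keeps the mass \<open>s\<close> of the
    unnormalized step function positive; \<open>\<epsilon> / 2\<close> leaves room for two errors,
    from \<open>f\<close> to \<open>u\<close> and from \<open>u\<close> to \<open>g\<close>.\<close>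
  define \<eta> where "\<eta> = min (\<epsilon> / 2) (1 / 2)"
  have \<eta>: "0 < \<eta>" "\<eta> \<le> 1 / 2" "2 * \<eta> \<le> \<epsilon>" using \<epsilon> by (auto simp: \<eta>_def)
  have f_int: "integrable lborel f"
    by (rule integrableI_nonneg) (use nonneg one in auto)
  have f_one: "(\<integral>x. f x \<partial>lborel) = 1"
    using nn_integral_eq_integral[OF f_int] nonneg one by simp
  obtain q :: "node \<Rightarrow> real" where q: "continuous_on UNIV q" "\<And>x. 0 \<le> q x"
    "(\<integral>x. indicator ?S x * \<bar>f x - q x\<bar> \<partial>lborel) < \<eta> / 2"
    using continuous_L1_approx[OF f_int nonneg, of "\<eta> / 2" L] \<eta>(1) by auto
  \<comment> \<open>A pointwise error \<open>\<theta>\<close> on the square integrates to at most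
    \<open>\<eta> / 2\<close>; \<open>V + 1\<close> instead of \<open>V\<close> avoids division by
    zero.\<close>
  define \<theta> where "\<theta> = \<eta> / (2 * (V + 1))"
  have \<theta>: "0 < \<theta>" "\<theta> * V \<le> \<eta> / 2" using \<eta>(1) V by (auto simp: \<theta>_def field_simps)
  have "uniformly_continuous_on ?S q"
    by (rule compact_uniformly_continuous[OF continuous_on_subset[OF q(1)]]) (auto simp: compact_cbox)
  then obtain d where d: "0 < d" "\<And>x x'. x \<in> ?S \<Longrightarrow> x' \<in> ?S \<Longrightarrow> dist x' x < d \<Longrightarrow> dist (q x') (q x) < \<theta>"
    using \<theta>(1) unfolding uniformly_continuous_on_def by metis
  obtain N0 where N0: "1 / real (Suc N0) < d / 2" using nat_approx_posE[of "d / 2"] d(1) by auto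
  define N where "N = Suc N0"
  have N: "0 < N" "2 / real N < d" using N0 by (auto simp: N_def)
  define K where "K = cell_index L N"
  have K: "finite K" "disjoint_family_on (cell N) K" by (auto simp: K_def cell_index_def disjoint_cells N)
  have KS: "cell N k \<subseteq> ?S" "cell_corner N k \<in> ?S" if "k \<in> K" for k
    using cell_subset_square[OF N(1)] that unfolding K_def by auto
  have cellm[measurable]: "cell N k \<in> sets borel" for k by (simp add: cell_def)
  have cell_e: "emeasure lborel (cell N k) = ennreal ((1 / real N)\<^sup>2)" for k
    unfolding cell_def by (rule emeasure_square) (use N in simp)
  have cell_m: "measure lborel (cell N k) = (1 / real N)\<^sup>2" for k using cell_e[of k] by (simp add: measure_def)
  define a where "a k = q (cell_corner N k)" for k
  define u where "u x = (\<Sum>k\<in>K. a k * indicator (cell N k) x)" for x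
  have a0: "0 \<le> a k" for k by (simp add: a_def q)
  have u0: "0 \<le> u x" for x unfolding u_def by (intro sum_nonneg mult_nonneg_nonneg a0) auto
  have u_out: "u x = 0" if "x \<notin> ?S" for x
    unfolding u_def by (rule sum_indicator_outside) (use that KS(1) in blast)
  have u_int: "integrable lborel u" unfolding u_def
    by (intro Bochner_Integration.integrable_sum integrable_mult_right integrable_real_indicator)
      (auto simp: cell_e)
  have um[measurable]: "u \<in> borel_measurable borel" using borel_measurable_integrable[OF u_int] by simp
  define s where "s = (\<integral>x. u x \<partial>lborel)"
  have s_eq: "s = (\<Sum>k\<in>K. a k * (1 / real N)\<^sup>2)"
    unfolding s_def u_def
    by (subst Bochner_Integration.integral_sum) (auto simp: cell_e cell_m)
  have q_int: "integrable lborel (\<lambda>x. indicator ?S x * \<bar>f x - q x\<bar>)"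
  proof -
    have "integrable lborel (\<lambda>x. indicator ?S x *\<^sub>R q x)"
      by (rule borel_integrable_compact) (auto intro: continuous_on_subset[OF q(1)] simp: compact_cbox)
    moreover have "integrable lborel (\<lambda>x. indicator ?S x * f x)"
      by (rule Bochner_Integration.integrable_bound[OF f_int]) (use nonneg in \<open>auto simp: indicator_def\<close>)
    ultimately have "integrable lborel (\<lambda>x. \<bar>indicator ?S x * f x - indicator ?S x *\<^sub>R q x\<bar>)"
      by (intro integrable_abs Bochner_Integration.integrable_diff)
    moreover have "\<bar>indicator ?S x * f x - indicator ?S x *\<^sub>R q x\<bar> = indicator ?S x * \<bar>f x - q x\<bar>" for x
      by (simp add: indicator_def)
    ultimately show ?thesis by simp
  qed
  have th_int: "integrable lborel (\<lambda>x. \<theta> * indicator ?S x)"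
    using emeasure_square_finite by (intro integrable_mult_right integrable_real_indicator) auto
  have fu: "(\<integral>x. \<bar>f x - u x\<bar> \<partial>lborel) \<le> \<eta>"
  proof -
    have "(\<integral>x. \<bar>f x - u x\<bar> \<partial>lborel) \<le> (\<integral>x. indicator ?S x * \<bar>f x - q x\<bar> + \<theta> * indicator ?S x \<partial>lborel)"
    proof (rule integral_mono_AE)
      show "AE x in lborel. \<bar>f x - u x\<bar> \<le> indicator ?S x * \<bar>f x - q x\<bar> + \<theta> * indicator ?S x"
        using supp AE_in_cell[OF N(1), of L]
      proof eventually_elim
        case (elim x)
        show ?case
        proof (cases "x \<in> ?S")
          case True
          then obtain k where k: "k \<in> K" "x \<in> cell N k" using elim(2) unfolding K_def by blast
          have ux: "u x = a k" unfolding u_def by (rule sum_indicator_disjoint[OF K k])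
          have "dist x (cell_corner N k) < d" using cell_diameter[OF N(1) k(2)] N(2) by linarith
          then have "dist (q x) (q (cell_corner N k)) < \<theta>"
            using KS(2)[OF k(1)] True by (intro d(2))
          then show ?thesis using True by (simp add: ux a_def dist_real_def)
        next
          case False
          then show ?thesis using elim(1) u_out by simp
        qed
      qed
    qed (use f_int u_int q_int th_int in auto)
    also have "\<dots> = (\<integral>x. indicator ?S x * \<bar>f x - q x\<bar> \<partial>lborel) + \<theta> * V"
      using q_int th_int by (subst Bochner_Integration.integral_add) (auto simp: V_def)
    finally show ?thesis using q(3) \<theta>(2) by linarith
  qed
  have s1: "\<bar>1 - s\<bar> \<le> \<eta>"
  proof -
    have "1 - s = (\<integral>x. f x - u x \<partial>lborel)"
      unfolding s_def using f_int u_int by (simp add: f_one)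
    then have "\<bar>1 - s\<bar> \<le> (\<integral>x. \<bar>f x - u x\<bar> \<partial>lborel)" using integral_abs_bound[of lborel "\<lambda>x. f x - u x"] by simp
    then show ?thesis using fu by linarith
  qed
  then have s0: "0 < s" using \<eta>(2) by linarith
  define g where "g x = (\<Sum>k\<in>K. (a k / s) * indicator (cell N k) x)" for x
  have g_eq: "g x = u x / s" for x by (simp add: g_def u_def sum_divide_distrib)
  have g_int: "integrable lborel g" unfolding g_eq using u_int by simp
  have gm[measurable]: "g \<in> borel_measurable borel" using borel_measurable_integrable[OF g_int] by simp
  have g0: "0 \<le> g x" for x using u0 s0 by (simp add: g_eq)
  have "(\<integral>x. g x \<partial>lborel) = 1" using s0 by (simp add: g_eq s_def)
  then have g_one: "(\<integral>\<^sup>+x. g x \<partial>lborel) = 1"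
    using nn_integral_eq_integral[OF g_int] g0 by simp
  \<comment> \<open>Normalizing moves \<open>u\<close> by exactly \<open>\<bar>1 - s\<bar>\<close>
    in \<open>L^1\<close>, which is no more than the error between \<open>f\<close> and
    \<open>u\<close>.\<close>
  have ug: "(\<integral>x. \<bar>u x - g x\<bar> \<partial>lborel) \<le> \<eta>"
  proof -
    have "\<bar>u x - g x\<bar> = u x * (\<bar>1 - s\<bar> / s)" for x
    proof -
      have "u x - g x = u x * ((s - 1) / s)" using s0 by (simp add: g_eq field_simps)
      then show ?thesis using u0[of x] s0 by (simp add: abs_mult abs_divide abs_minus_commute)
    qed
    then have "(\<integral>x. \<bar>u x - g x\<bar> \<partial>lborel) = s * (\<bar>1 - s\<bar> / s)" by (simp add: s_def)
    then show ?thesis using s1 s0 by simp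
  qed
  have fg: "(\<integral>x. \<bar>f x - g x\<bar> \<partial>lborel) \<le> \<epsilon>"
  proof -
    have "(\<integral>x. \<bar>f x - g x\<bar> \<partial>lborel) \<le> (\<integral>x. \<bar>f x - u x\<bar> + \<bar>u x - g x\<bar> \<partial>lborel)"
      by (rule integral_mono) (use f_int u_int g_int in auto)
    also have "\<dots> = (\<integral>x. \<bar>f x - u x\<bar> \<partial>lborel) + (\<integral>x. \<bar>u x - g x\<bar> \<partial>lborel)"
      by (rule Bochner_Integration.integral_add) (use f_int u_int g_int in auto)
    finally show ?thesis using fu ug \<eta>(3) by linarith
  qed
  have "capacity_limit \<beta> (density lborel g) (A * (\<integral>x. sqrt (g x) \<partial>lborel))"
    unfolding g_def cell_def
  proof (rule capacity_limit_step[OF \<beta> lim K(1)])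
    show "disjoint_family_on (\<lambda>k. box (cell_corner N k) (cell_corner N k + (1 / real N) *\<^sub>R 1)) K"
      using K(2) unfolding cell_def .
    show "box (cell_corner N k) (cell_corner N k + (1 / real N) *\<^sub>R 1) \<subseteq> cball 0 (2 * real L)" if "k \<in> K" for k
      using KS(1)[OF that] square_subset_cball[of L] unfolding cell_def by blast
    show "0 < 1 / real N" using N by simp
    show "0 \<le> a k / s" for k using a0 s0 by simp
    show "(\<Sum>k\<in>K. a k / s * (1 / real N)\<^sup>2) = 1"
      using s_eq s0 by (simp add: sum_divide_distrib[symmetric])
  qed
  then show thesis
    using that[OF gm g0 g_one _ f_int g_int fg] u_out by (simp add: g_eq)
qed

section \<open>Continuity of the limit value and general densities\<close>

lemma abs_sqrt_diff_le:
  assumes "0 \<le> a" "0 \<le> b" shows "\<bar>sqrt a - sqrt b\<bar> \<le> sqrt \<bar>a - b\<bar>"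
proof -
  have *: "sqrt x \<le> sqrt y + sqrt \<bar>x - y\<bar>" if "0 \<le> y" for x y :: real
  proof -
    have "sqrt x \<le> sqrt (y + \<bar>x - y\<bar>)" by (simp add: abs_if)
    also have "\<dots> \<le> sqrt y + sqrt \<bar>x - y\<bar>" by (rule sqrt_add_le_add_sqrt) (use that in auto)
    finally show ?thesis .
  qed
  from *[of b a] *[of a b] assms show ?thesis by (simp add: abs_le_iff abs_minus_commute)
qed

text \<open>Either \<open>sqrt t \<le> s\<close> or \<open>sqrt t \<le> t / s\<close>. This
  exchanges a square root for a linear term plus a constant, which is integrable on a bounded
  set.\<close>

lemma sqrt_le_add_divide:
  assumes "0 < s" "0 \<le> t" shows "sqrt t \<le> s + t / s"
proof (cases "sqrt t \<le> s")
  case True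
  then show ?thesis using assms by (simp add: add_increasing2)
next
  case False
  have "sqrt t * s \<le> sqrt t * sqrt t" using False assms by (intro mult_left_mono) auto
  then have "sqrt t \<le> t / s" using assms by (simp add: field_simps)
  then show ?thesis using assms by linarith
qed

text \<open>The difference of the roots is at most
  \<open>\<delta> + \<bar>f x - g x\<bar> / \<delta>\<close> on the common square and vanishes
  almost everywhere outside it. An \<open>L^1\<close> distance of order
  \<open>\<delta>\<^sup>2\<close> makes both terms contribute order \<open>\<delta>\<close>.\<close>

lemma integral_sqrt_diff:
  fixes f g :: "node \<Rightarrow> real"
  assumes f: "integrable lborel f" "\<And>x. 0 \<le> f x" "AE x in lborel. x \<notin> square L \<longrightarrow> f x = 0"
    and g: "integrable lborel g" "\<And>x. 0 \<le> g x" "AE x in lborel. x \<notin> square L \<longrightarrow> g x = 0"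
    and \<delta>: "0 < \<delta>" "(\<integral>x. \<bar>f x - g x\<bar> \<partial>lborel) \<le> \<delta>\<^sup>2"
  shows "\<bar>(\<integral>x. sqrt (f x) \<partial>lborel) - (\<integral>x. sqrt (g x) \<partial>lborel)\<bar> \<le> \<delta> * (measure lborel (square L) + 1)"
proof -
  let ?S = "square L"
  have S_int: "integrable lborel (\<lambda>x. c * indicator ?S x)" for c :: real
    using emeasure_square_finite by (intro integrable_mult_right integrable_real_indicator) auto
  have sq: "integrable lborel (\<lambda>x. sqrt (k x))"
    if k: "integrable lborel k" "\<And>x. 0 \<le> k x" "AE x in lborel. x \<notin> ?S \<longrightarrow> k x = 0" for k :: "node \<Rightarrow> real"
  proof (rule Bochner_Integration.integrable_bound)
    show "integrable lborel (\<lambda>x. 1 * indicator ?S x + k x)"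
      by (intro Bochner_Integration.integrable_add S_int k(1))
    show "(\<lambda>x. sqrt (k x)) \<in> borel_measurable lborel" using borel_measurable_integrable[OF k(1)] by measurable
    show "AE x in lborel. norm (sqrt (k x)) \<le> norm (1 * indicator ?S x + k x)"
      using k(3)
    proof eventually_elim
      case (elim x)
      then show ?case using k(2)[of x] sqrt_le_add_divide[of 1 "k x"] by (auto simp: indicator_def)
    qed
  qed
  have d_int: "integrable lborel (\<lambda>x. \<bar>f x - g x\<bar>)" using f(1) g(1) by auto
  have "\<bar>(\<integral>x. sqrt (f x) \<partial>lborel) - (\<integral>x. sqrt (g x) \<partial>lborel)\<bar> = \<bar>\<integral>x. sqrt (f x) - sqrt (g x) \<partial>lborel\<bar>"
    using sq[OF f] sq[OF g] by simp
  also have "\<dots> \<le> (\<integral>x. \<bar>sqrt (f x) - sqrt (g x)\<bar> \<partial>lborel)" by (rule integral_abs_bound)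
  also have "\<dots> \<le> (\<integral>x. \<delta> * indicator ?S x + \<bar>f x - g x\<bar> / \<delta> \<partial>lborel)"
  proof (rule integral_mono_AE)
    show "AE x in lborel. \<bar>sqrt (f x) - sqrt (g x)\<bar> \<le> \<delta> * indicator ?S x + \<bar>f x - g x\<bar> / \<delta>"
      using f(3) g(3)
    proof eventually_elim
      case (elim x)
      have "\<bar>sqrt (f x) - sqrt (g x)\<bar> \<le> \<delta> + \<bar>f x - g x\<bar> / \<delta>"
        using abs_sqrt_diff_le[OF f(2) g(2), of x x] sqrt_le_add_divide[OF \<delta>(1), of "\<bar>f x - g x\<bar>"] by linarith
      then show ?case using elim by (auto simp: indicator_def)
    qed
    show "integrable lborel (\<lambda>x. \<bar>sqrt (f x) - sqrt (g x)\<bar>)" using sq[OF f] sq[OF g] by auto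
    show "integrable lborel (\<lambda>x. \<delta> * indicator ?S x + \<bar>f x - g x\<bar> / \<delta>)"
      using S_int d_int by (intro Bochner_Integration.integrable_add integrable_divide)
  qed
  also have "\<dots> = \<delta> * measure lborel ?S + (\<integral>x. \<bar>f x - g x\<bar> \<partial>lborel) / \<delta>"
    using S_int[of \<delta>] d_int by (subst Bochner_Integration.integral_add) auto
  also have "\<dots> \<le> \<delta> * measure lborel ?S + \<delta>\<^sup>2 / \<delta>"
    using \<delta> by (intro add_left_mono divide_right_mono) auto
  finally show ?thesis using \<delta>(1) by (simp add: power2_eq_square algebra_simps)
qed

lemma capacity_limit_density:
  fixes f :: "node \<Rightarrow> real"
  assumes \<beta>: "1 < \<beta>" and lim: "capacity_limit \<beta> (uniform_measure lborel (cbox 0 1)) A"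
    and meas[measurable]: "f \<in> borel_measurable borel" and nonneg: "\<And>x. 0 \<le> f x"
    and one: "(\<integral>\<^sup>+x. f x \<partial>lborel) = 1" and supp: "AE x in lborel. x \<notin> square L \<longrightarrow> f x = 0"
  shows "capacity_limit \<beta> (density lborel f) (A * (\<integral>x. sqrt (f x) \<partial>lborel))"
proof -
  let ?b = "A * (\<integral>x. sqrt (f x) \<partial>lborel)"
  define C where "C = edge_const \<beta> (2 * real L)"
  define V where "V = measure lborel (square L)"
  have C: "0 \<le> C" unfolding C_def by (rule edge_const_nonneg[OF \<beta>])
  have V: "0 \<le> V" by (simp add: V_def)
  have supp': "AE x in lborel. x \<notin> cball 0 (2 * real L) \<longrightarrow> f x = 0"
    using supp by eventually_elim (use square_subset_cball[of L] in blast)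
  have "AE x in iid (density lborel f).
      \<forall>\<^sub>F n in sequentially. \<bar>slot_capacity \<beta> (x ` {..<n}) / sqrt (real n) - ?b\<bar> < e" if e: "0 < e" for e
  proof -
    \<comment> \<open>Two errors have to stay below \<open>e / 2\<close>: the coupling costs at most
      \<open>4 * C * t\<close>, since \<open>sqrt (2 * t\<^sup>2) \<le> 2 * t\<close>, and the
      change of the integral costs at most \<open>\<bar>A\<bar> * (V + 1) * t\<close>. The summand 1
      makes \<open>D\<close> positive and both comparisons strict.\<close>
    define D where "D = 4 * C + \<bar>A\<bar> * (V + 1) + 1"
    have D: "0 < D" "4 * C < D" "\<bar>A\<bar> * (V + 1) < D" using C V by (auto simp: D_def add_nonneg_pos add_pos_nonneg)
    define t where "t = e / (2 * D)"
    have t: "0 < t" "4 * C * t < e / 2" "\<bar>A\<bar> * (V + 1) * t < e / 2"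
    proof -
      show t: "0 < t" using e D by (simp add: t_def)
      have "D * t = e / 2" using D by (simp add: t_def)
      then show "4 * C * t < e / 2" "\<bar>A\<bar> * (V + 1) * t < e / 2"
        using mult_strict_right_mono[OF D(2) t] mult_strict_right_mono[OF D(3) t] by simp_all
    qed
    obtain g where g: "g \<in> borel_measurable borel" "\<And>x. 0 \<le> g x" "(\<integral>\<^sup>+x. g x \<partial>lborel) = 1"
      "\<And>x. x \<notin> square L \<Longrightarrow> g x = 0" "integrable lborel f" "integrable lborel g"
      "(\<integral>x. \<bar>f x - g x\<bar> \<partial>lborel) \<le> t\<^sup>2"
      "capacity_limit \<beta> (density lborel g) (A * (\<integral>x. sqrt (g x) \<partial>lborel))"
      using step_density_approx[OF \<beta> lim meas nonneg one supp, of "t\<^sup>2"] t(1) by auto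
    let ?b' = "A * (\<integral>x. sqrt (g x) \<partial>lborel)"
    have ev: "AE x in iid (density lborel f).
        \<forall>\<^sub>F n in sequentially. \<bar>slot_capacity \<beta> (x ` {..<n}) / sqrt (real n) - ?b'\<bar> < e / 2"
    proof (rule capacity_density_perturb[OF \<beta> meas g(1) nonneg g(2) one g(3) supp' _ _ _ g(8)])
      show "AE x in lborel. x \<notin> cball 0 (2 * real L) \<longrightarrow> g x = 0"
        by (rule AE_I2) (use g(4) square_subset_cball[of L] in blast)
      have "(\<integral>\<^sup>+x. \<bar>f x - g x\<bar> \<partial>lborel) = ennreal (\<integral>x. \<bar>f x - g x\<bar> \<partial>lborel)"
        by (rule nn_integral_eq_integral) (use g(5,6) in auto)
      then show "(\<integral>\<^sup>+x. \<bar>f x - g x\<bar> \<partial>lborel) \<le> ennreal (t\<^sup>2)" using g(7) by (simp add: ennreal_leI)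
      have "sqrt (2 * t\<^sup>2) \<le> 2 * t" using t(1) by (intro real_le_lsqrt) (auto simp: power2_eq_square)
      then have "2 * C * sqrt (2 * t\<^sup>2) \<le> 2 * C * (2 * t)" using C by (intro mult_left_mono) auto
      then show "2 * edge_const \<beta> (2 * real L) * sqrt (2 * t\<^sup>2) < e / 2"
        using t(2) unfolding C_def[symmetric] by linarith
    qed simp
    have lt: "\<bar>?b' - ?b\<bar> < e / 2"
    proof -
      have "\<bar>(\<integral>x. sqrt (f x) \<partial>lborel) - (\<integral>x. sqrt (g x) \<partial>lborel)\<bar> \<le> t * (V + 1)"
        unfolding V_def using g(4) by (intro integral_sqrt_diff[OF g(5) nonneg supp g(6) g(2) _ t(1) g(7)]) auto
      then have "\<bar>A\<bar> * \<bar>(\<integral>x. sqrt (f x) \<partial>lborel) - (\<integral>x. sqrt (g x) \<partial>lborel)\<bar> \<le> \<bar>A\<bar> * (t * (V + 1))"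
        by (intro mult_left_mono) auto
      also have "\<dots> = \<bar>A\<bar> * (V + 1) * t" by simp
      finally show ?thesis using t(3) by (simp add: abs_mult[symmetric] right_diff_distrib abs_minus_commute)
    qed
    show ?thesis
      using ev
    proof eventually_elim
      case (elim x)
      then show ?case by (rule eventually_mono) (use lt in linarith)
    qed
  qed
  then have "AE x in iid (density lborel f). \<forall>k. \<forall>\<^sub>F n in sequentially.
      \<bar>slot_capacity \<beta> (x ` {..<n}) / sqrt (real n) - ?b\<bar> < 1 / real (Suc k)"
    by (simp add: AE_all_countable)
  then show ?thesis
    unfolding capacity_limit_def
  proof eventually_elim
    case (elim x)
    show ?case
    proof (rule tendstoI)
      fix e :: real assume "0 < e"
      then obtain k where k: "1 / real (Suc k) < e" using nat_approx_posE by blast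
      show "\<forall>\<^sub>F n in sequentially. dist (slot_capacity \<beta> (x ` {..<n}) / sqrt (real n)) ?b < e"
        using elim[rule_format, of k] by eventually_elim (use k in \<open>simp add: dist_real_def\<close>)
    qed
  qed
qed

section \<open>From the random variables to the law of the sequence\<close>

theorem theorem3:
  fixes M :: "'a measure" and y :: "nat \<Rightarrow> 'a \<Rightarrow> real ^ 2" and f :: "real ^ 2 \<Rightarrow> real"
    and S :: "(real ^ 2) set" and \<beta> A\<^sub>2 :: real and c :: bool
  assumes "\<beta> > 1"
    and "prob_space M"
    and "prob_space.indep_vars M (\<lambda>_. borel) y UNIV"
    and "\<And>x. f x \<ge> 0"
    and "\<And>i. distributed M lborel (y i) (\<lambda>x. ennreal (f x))"
    and "bounded S" and "\<And>i. AE \<omega> in M. y i \<omega> \<in> S"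
    and "uniform_limit_constant \<beta> c A\<^sub>2"
  shows "AE \<omega> in M.
    (\<lambda>n. transport_capacity \<beta> c ((\<lambda>i. y i \<omega>) ` {..<n}) / sqrt (real n))
      \<longlonglongrightarrow> A\<^sub>2 * (\<integral>x. sqrt (f x) \<partial>lborel)"
proof -
  interpret prob_space M by fact
  have T: "transport_capacity \<beta> c (x ` {..<n}) = slot_capacity \<beta> (x ` {..<n})" for x :: "nat \<Rightarrow> node" and n
    by (rule transport_capacity_eq_slot_capacity) (use assms(1) in auto)
  have lim: "capacity_limit \<beta> (uniform_measure lborel (cbox 0 1)) A\<^sub>2"
    using assms(8) unfolding uniform_limit_constant_def capacity_limit_def T .
  \<comment> \<open>The density assumption only gives measurability of \<open>ennreal (f x)\<close>;
    nonnegativity recovers \<open>f\<close>.\<close>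
  have "(\<lambda>x. ennreal (f x)) \<in> borel_measurable borel" using assms(5)[of 0] by (simp add: distributed_def)
  then have "(\<lambda>x. enn2real (ennreal (f x))) \<in> borel_measurable borel" by (rule borel_measurable_enn2real)
  then have f[measurable]: "f \<in> borel_measurable borel" using assms(4) by simp
  have ym[measurable]: "y i \<in> borel_measurable M" for i using assms(5)[of i] by (simp add: distributed_def)
  have law: "distr M borel (y i) = density lborel f" for i
  proof -
    have "distr M borel (y i) = distr M lborel (y i)" by (rule distr_cong) auto
    then show ?thesis using assms(5)[of i] by (simp add: distributed_def)
  qed
  have one: "(\<integral>\<^sup>+x. f x \<partial>lborel) = 1"
  proof -
    have "emeasure (distr M borel (y 0)) UNIV = 1"
      using emeasure_space_1 by (simp add: emeasure_distr)
    then show ?thesis unfolding law by (simp add: emeasure_density)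
  qed
  obtain b where b: "\<And>x. x \<in> S \<Longrightarrow> norm x \<le> b" using assms(6) by (auto simp: bounded_iff)
  obtain L :: nat where L: "b \<le> real L" using real_arch_simple by blast
  have SL: "S \<subseteq> square L"
  proof
    fix x assume "x \<in> S"
    then have "\<bar>x $ i\<bar> \<le> real L" for i using b L component_le_norm_cart[of x i] by (meson order_trans)
    then show "x \<in> square L" by (simp add: mem_box_cart abs_le_iff minus_le_iff)
  qed
  \<comment> \<open>Boundedness of the samples becomes vanishing of \<open>f\<close> outside a
    square, though only almost everywhere.\<close>
  have supp: "AE x in lborel. x \<notin> square L \<longrightarrow> f x = 0"
  proof -
    have "AE \<omega> in M. y 0 \<omega> \<in> square L" using assms(7)[of 0] by eventually_elim (use SL in blast)
    then have "AE x in distr M borel (y 0). x \<in> square L" by (subst AE_distr_iff) auto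
    then have "AE x in lborel. 0 < ennreal (f x) \<longrightarrow> x \<in> square L" unfolding law by (subst (asm) AE_density) auto
    then show ?thesis
    proof eventually_elim
      case (elim x)
      then show ?case using assms(4)[of x] by (auto simp: order_le_less)
    qed
  qed
  \<comment> \<open>Independence and the common density determine the law of the whole sequence as a
    product, after which the underlying space \<open>M\<close> drops out.\<close>
  have "distr M (iid borel) (\<lambda>\<omega>. \<lambda>i\<in>UNIV. y i \<omega>) = (\<Pi>\<^sub>M i\<in>UNIV. distr M borel (y i))"
    using assms(3) by (subst (asm) indep_vars_iff_distr_eq_PiM') auto
  then have joint: "distr M (iid borel) (\<lambda>\<omega> i. y i \<omega>) = iid (density lborel f)"
    by (simp add: restrict_UNIV law)
  have ym': "(\<lambda>\<omega> i. y i \<omega>) \<in> measurable M (iid borel)"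
    by (rule measurable_PiM_single') auto
  have "AE x in distr M (iid borel) (\<lambda>\<omega> i. y i \<omega>).
      (\<lambda>n. slot_capacity \<beta> (x ` {..<n}) / sqrt (real n)) \<longlonglongrightarrow> A\<^sub>2 * (\<integral>x. sqrt (f x) \<partial>lborel)"
    using capacity_limit_density[OF assms(1) lim f assms(4) one supp] unfolding joint capacity_limit_def .
  from AE_distrD[OF ym' this] show ?thesis unfolding T .
qed

end
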